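(* The collection of multiplicative functions $f\colon\mathbb{N}\to\mathbb{R}-\{0\}$ for which $\{f(n)\}_{n\ge 1}$ is not a strong Benford sequence forms a group under pointwise multiplication.
   Context: $\mathbb{N}$ is the set of positive integers. A multiplicative function $f$ satisfies $f(mn)=f(m)f(n)$ whenever $\gcd(m,n)=1$. Strong Benford: Every positive real $a$ is written $a=10^{M}\sum_{j\ge 0} d_j 10^{-j}$ with $M\in\mathbb{Z}$, $1\le d_0\le 9$, $0\le d_j\le 9$ for $j\ge 1$ (usual convention: the digits are not eventually all $9$); the $d_j$ are the digits of $a$. A sequence $\{a_k\}_{k\ge1}$ of positive reals is strong Benford if for every positive integer $K$ and every digit string $S=d_0d_1\cdots d_{K-1}$ with $d_0\ne 0$, $$\lim_{N\to\infty}\frac{\#\{k\le N: \text{the first } K \text{ digits of } a_k \text{ are } d_0,\dots,d_{K-1}\}}{N}=\log_{10}(r+10^{-K+1})-\log_{10} r,\qquad r=\sum_{j=0}^{K-1}d_j10^{-j}.$$ A sequence of nonzero real numbers is called strong Benford if the sequence of absolute values is strong Benford. *)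

theory Defs
  imports Complex_Main "HOL-Algebra.Group"
begin

text \<open>
  Functions on the positive integers are elements of \<open>{1..} \<rightarrow>\<^sub>E B\<close>, that is, functions on \<open>nat\<close>
  with the fixed junk value \<open>undefined\<close> at \<open>0\<close>.  Two such functions are equal iff they agree
  on the positive integers.
\<close>

definition multiplicative :: "(nat \<Rightarrow> real) \<Rightarrow> bool" where
  "multiplicative f \<longleftrightarrow> (\<forall>m\<ge>1. \<forall>n\<ge>1. coprime m n \<longrightarrow> f (m * n) = f m * f n)"

text \<open>
  Normalised decimal expansion of a positive real.  Expansions ending in all nines are
  excluded, so every positive real has exactly one.
\<close>
definition decimal_expansion :: "real \<Rightarrow> int \<Rightarrow> (nat \<Rightarrow> nat) \<Rightarrow> bool" where
  "decimal_expansion a M d \<longleftrightarrow>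
     1 \<le> d 0 \<and> (\<forall>j. d j \<le> 9) \<and> (\<forall>J. \<exists>j\<ge>J. d j \<noteq> 9) \<and>
     a = 10 powi M * (\<Sum>j. real (d j) / 10 ^ j)"

definition leading_digits :: "real \<Rightarrow> nat list \<Rightarrow> bool" where
  "leading_digits a S \<longleftrightarrow> (\<exists>M d. decimal_expansion a M d \<and> (\<forall>j<length S. d j = S ! j))"

definition digit_string :: "nat list \<Rightarrow> bool" where
  "digit_string S \<longleftrightarrow> S \<noteq> [] \<and> (\<forall>j<length S. S ! j \<le> 9) \<and> S ! 0 \<noteq> 0"

definition significand :: "nat list \<Rightarrow> real" where
  "significand S = (\<Sum>j<length S. real (S ! j) / 10 ^ j)"

text \<open>
  For sequences \<open>a 1, a 2, \<dots>\<close> of positive reals; \<open>a 0\<close> is irrelevant.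
\<close>
definition strong_benford_pos :: "(nat \<Rightarrow> real) \<Rightarrow> bool" where
  "strong_benford_pos a \<longleftrightarrow>
     (\<forall>S. digit_string S \<longrightarrow>
        (\<lambda>N. real (card {k \<in> {1..N}. leading_digits (a k) S}) / real N)
          \<longlonglongrightarrow> log 10 (significand S + 10 powi (- int (length S) + 1)) - log 10 (significand S))"

text \<open>For sequences \<open>a 1, a 2, \<dots>\<close> of nonzero reals.\<close>
definition strong_benford :: "(nat \<Rightarrow> real) \<Rightarrow> bool" where
  "strong_benford a \<longleftrightarrow> strong_benford_pos (\<lambda>k. \<bar>a k\<bar>)"

definition non_benford_multiplicative :: "(nat \<Rightarrow> real) monoid" where
  "non_benford_multiplicative =
     \<lparr>carrier = {f \<in> {1..} \<rightarrow>\<^sub>E (UNIV - {0}). multiplicative f \<and> \<not> strong_benford f},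
      mult = (\<lambda>f g. \<lambda>n\<in>{1..}. f n * g n),
      one = (\<lambda>n\<in>{1..}. 1)\<rparr>"

end

theory Submission
  imports Defs "HOL-Complex_Analysis.Great_Picard" "HOL-Analysis.Harmonic_Numbers" "HOL-Real_Asymp.Real_Asymp"
begin

text \<open>
  By Weyl's criterion, \<open>f\<close> is not strong Benford iff for some \<open>m > 0\<close> the unimodular multiplicative function
  \<open>g = exp (2 \<pi> i m log\<^sub>1\<^sub>0 |f|)\<close> has mean values not tending to \<open>0\<close>.  Up to replacing \<open>m\<close> by a multiple this
  means that \<open>g\<close> pretends to be some \<open>n\<^sup>i\<^sup>t\<close>, in the sense that the sum of \<open>|g p - p\<^sup>i\<^sup>t|\<^sup>2 / p\<close> over primes
  converges, and this property is closed under products and powers.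

  One direction is a qualitative Halasz theorem.  A limit \<open>\<phi>\<close> of the functions \<open>u \<mapsto> mean g (x\<^sub>j e\<^sup>u)\<close> is Lipschitz, and
  the dual Turan--Kubilius inequality bounds the sum of \<open>|g p \<phi> (u - ln p) - \<phi> u|\<^sup>2 / p\<close>.  Eliminating \<open>g p\<close> shows
  that \<open>\<phi> u cnj (\<phi> v)\<close> is nearly invariant under the diagonal shift by \<open>ln q - ln p\<close> for most primes \<open>p, q\<close>.
  Since primes do not cluster too much, these differences come arbitrarily close to \<open>0\<close>, so \<open>\<phi>\<close> is a multiple of a
  character.  The other direction compares the Dirichlet series of \<open>g n n\<^sup>-\<^sup>i\<^sup>t\<close> with zeta near \<open>1\<close>; passing to a power
  of \<open>g\<close> keeps the Euler factor at \<open>2\<close> away from \<open>0\<close>.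
\<close>

section \<open>Mean values on the logarithmic scale\<close>

text \<open>Failure of the mean values to tend to 0 is not visibly stable under products: knowing it
  for \<open>phase f m\<close> and \<open>phase g l\<close> says little about the phases of the
  product. Pretending is the stable property, so both implications between the two are needed. The
  converse fails at a fixed frequency. If \<open>g n\<close> twisted by n^(-it) equals 1 at odd
  \<open>n\<close> and -1 at even \<open>n\<close>, its Euler factor at 2 is (1 - 2y) / (1 - y) with
  y = 2^(-s). This vanishes at s = 1, and the mean tends to 0. Powers of a phase are phases at
  multiples of the frequency, and Weyl's criterion quantifies over all frequencies, so the value at
  2 may be moved to the right half-plane first. In the Halasz direction, no asymptotics for primes
  is used. Divergence of the sum of 1 / p and an upper bound in short logarithmic intervals suffice.
  The latter keeps the shifts ln q - ln p away from 0 while the accuracy improves; otherwise the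
  limiting shift could be 0 and carry no information.\<close>

definition mean_upto :: "(nat \<Rightarrow> complex) \<Rightarrow> real \<Rightarrow> complex" where
  "mean_upto g x = (\<Sum>n | 0 < n \<and> real n \<le> x. g n) / of_real x"

lemma nats_upto_eq: "{n. 0 < n \<and> real n \<le> x} = {1..nat \<lfloor>x\<rfloor>}"
  by (auto simp: le_nat_floor Suc_le_eq) linarith

lemma finite_nats_upto [simp]: "finite {n. 0 < n \<and> real n \<le> x}"
  unfolding nats_upto_eq by simp

lemma card_nats_upto_le: "x \<ge> 0 \<Longrightarrow> real (card {n. 0 < n \<and> real n \<le> x}) \<le> x"
  unfolding nats_upto_eq by simp

lemma mean_upto_of_nat: "mean_upto g (real N) = (\<Sum>n\<in>{1..N}. g n) / of_nat N"
  by (simp add: mean_upto_def nats_upto_eq[of "real N", simplified])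

lemma mean_upto_add: "mean_upto (\<lambda>n. g n + h n) x = mean_upto g x + mean_upto h x"
  by (simp add: mean_upto_def sum.distrib add_divide_distrib)

lemma mean_upto_diff: "mean_upto (\<lambda>n. g n - h n) x = mean_upto g x - mean_upto h x"
  by (simp add: mean_upto_def sum_subtractf diff_divide_distrib)

lemma mean_upto_cmult: "mean_upto (\<lambda>n. c * g n) x = c * mean_upto g x"
  by (simp add: mean_upto_def sum_distrib_left)

lemma mean_upto_sum: "mean_upto (\<lambda>n. \<Sum>i\<in>I. g i n) x = (\<Sum>i\<in>I. mean_upto (g i) x)"
  unfolding mean_upto_def by (subst sum.swap) (simp add: sum_divide_distrib)

lemma mean_upto_cnj: "mean_upto (\<lambda>n. cnj (g n)) x = cnj (mean_upto g x)"
  by (simp add: mean_upto_def cnj_sum)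

lemma mean_upto_cong:
  "(\<And>n. n > 0 \<Longrightarrow> g n = h n) \<Longrightarrow> mean_upto g x = mean_upto h x"
  by (simp add: mean_upto_def)

lemma norm_sum_upto_le:
  assumes "\<forall>n>0. norm (g n) \<le> 1" "x \<ge> 0"
  shows "norm (\<Sum>n | 0 < n \<and> real n \<le> x. g n :: complex) \<le> x"
proof -
  have "norm (\<Sum>n | 0 < n \<and> real n \<le> x. g n) \<le> (\<Sum>n | 0 < n \<and> real n \<le> x. 1)"
    by (rule sum_norm_le) (use assms in auto)
  also have "\<dots> \<le> x" using card_nats_upto_le[OF assms(2)] by simp
  finally show ?thesis .
qed

lemma norm_mean_upto_le:
  assumes "\<forall>n>0. norm (g n) \<le> 1"
  shows "norm (mean_upto g x) \<le> 1"
proof (cases "x > 0")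
  case True
  then show ?thesis
    using norm_sum_upto_le[of g x] assms by (auto simp: mean_upto_def norm_divide)
next
  case False
  then have "{n. 0 < n \<and> real n \<le> x} = {}" by auto
  then show ?thesis unfolding mean_upto_def by (simp only:) simp
qed

text \<open>The at most \<open>y - x + 1\<close> new terms and the change of normalisation each cost
  \<open>1 - x / y\<close>, which is at most \<open>ln y - ln x\<close>; the extra
  \<open>1 / y\<close> comes from counting integers in an interval.\<close>

lemma mean_upto_almost_lipschitz_ordered:
  assumes g: "\<forall>n>0. norm (g n) \<le> 1" and "0 < x" "x \<le> y"
  shows "norm (mean_upto g y - mean_upto g x) \<le> 2 * (ln y - ln x) + 1 / y"
proof -
  define A where "A = {n. 0 < n \<and> real n \<le> x}"
  define B where "B = {n. x < real n \<and> real n \<le> y}"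
  have AB: "{n. 0 < n \<and> real n \<le> y} = A \<union> B" "A \<inter> B = {}"
    using assms by (auto simp: A_def B_def)
  have fin: "finite A" "finite B"
    using finite_nats_upto[of y] unfolding AB(1) by auto
  have sumy: "(\<Sum>n | 0 < n \<and> real n \<le> y. g n) = sum g A + sum g B"
    unfolding AB(1) using AB(2) fin by (simp add: sum.union_disjoint)
  have "B = {nat \<lfloor>x\<rfloor><..nat \<lfloor>y\<rfloor>}"
    using assms by (auto simp: B_def le_nat_floor) linarith+
  then have "real (card B) \<le> y - x + 1"
    using assms by simp linarith
  moreover have "norm (sum g B) \<le> real (card B)"
    using sum_norm_bound[of B g 1] g assms(2) by (auto simp: B_def)
  ultimately have B: "norm (sum g B) \<le> y - x + 1" by linarith
  have A: "norm (sum g A) \<le> x"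
    unfolding A_def by (rule norm_sum_upto_le) (use assms in auto)
  have "mean_upto g y - mean_upto g x = sum g B / of_real y + sum g A * of_real (1 / y - 1 / x)"
    unfolding mean_upto_def sumy A_def[symmetric] using assms by (simp add: field_simps)
  also have "norm \<dots> \<le> norm (sum g B / of_real y) + norm (sum g A * of_real (1 / y - 1 / x))"
    by (rule norm_triangle_ineq)
  also have "\<dots> = norm (sum g B) / y + norm (sum g A) * (1 / x - 1 / y)"
  proof -
    have "1 / y \<le> 1 / x" using assms by (simp add: frac_le)
    then show ?thesis using assms(2,3) by (simp add: norm_divide norm_mult del: of_real_diff of_real_divide)
  qed
  also have "\<dots> \<le> (y - x + 1) / y + x * (1 / x - 1 / y)"
    using A B assms by (intro add_mono divide_right_mono mult_right_mono) (auto simp: frac_le)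
  also have "\<dots> = 2 * (1 - x / y) + 1 / y" using assms by (simp add: field_simps)
  also have "1 - x / y \<le> ln y - ln x"
    using ln_le_minus_one[of "x / y"] assms by (simp add: ln_div)
  finally show ?thesis by simp
qed

lemma mean_upto_almost_lipschitz:
  assumes g: "\<forall>n>0. norm (g n) \<le> 1" and "0 < x" "0 < y"
  shows "norm (mean_upto g y - mean_upto g x) \<le> 2 * \<bar>ln y - ln x\<bar> + (1 / x + 1 / y)"
proof -
  have pos: "0 < 1 / x" "0 < 1 / y" using assms by auto
  show ?thesis
  proof (cases "x \<le> y")
    case True
    then have "ln x \<le> ln y" using assms by simp
    then show ?thesis
      using mean_upto_almost_lipschitz_ordered[where g = g, OF g assms(2) True] pos \<open>ln x \<le> ln y\<close> by linarith
  next
    case False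
    then have "ln y \<le> ln x" "y \<le> x" using assms by simp_all
    have "norm (mean_upto g y - mean_upto g x) = norm (mean_upto g x - mean_upto g y)"
      by (rule norm_minus_commute)
    also have "\<dots> \<le> 2 * (ln x - ln y) + 1 / x"
      by (rule mean_upto_almost_lipschitz_ordered[OF g assms(3) \<open>y \<le> x\<close>])
    also have "\<dots> \<le> 2 * \<bar>ln y - ln x\<bar> + (1 / x + 1 / y)"
      using assms by (intro add_mono mult_left_mono) auto
    finally show ?thesis .
  qed
qed

text \<open>
  On the logarithmic scale the mean values are asymptotically Lipschitz, so an
  Arzela--Ascoli argument produces limit profiles.
\<close>
lemma obtain_mean_profile:
  assumes g: "\<forall>n>0. norm (g n) \<le> 1"
    and nz: "\<not> (\<lambda>N. mean_upto g (real N)) \<longlonglongrightarrow> 0"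
  obtains X :: "nat \<Rightarrow> real" and \<phi> :: "real \<Rightarrow> complex"
  where "filterlim X at_top sequentially" "\<And>u. (\<lambda>j. mean_upto g (X j * exp u)) \<longlonglongrightarrow> \<phi> u"
    "\<And>u v. norm (\<phi> u - \<phi> v) \<le> 2 * \<bar>u - v\<bar>" "\<And>u. norm (\<phi> u) \<le> 1" "\<phi> 0 \<noteq> 0"
proof -
  \<comment> \<open>Staying on integers at which the mean has norm at least \<open>e\<close> is what
    makes the limit profile nonzero at 0.\<close>
  obtain e where e: "e > 0" "\<not> (\<forall>\<^sub>F N in sequentially. dist (mean_upto g (real N)) 0 < e)"
    using nz unfolding tendsto_iff by blast
  then have "\<exists>\<^sub>F N in sequentially. norm (mean_upto g (real N)) \<ge> e"
    by (simp add: frequently_def not_le)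
  then have "infinite {N. norm (mean_upto g (real N)) \<ge> e}"
    using INFM_iff_infinite cofinite_eq_sequentially by metis
  then obtain r :: "nat \<Rightarrow> nat" where r: "strict_mono r" "\<And>n. norm (mean_upto g (real (r n))) \<ge> e"
    using infinite_enumerate by blast
  \<comment> \<open>A diagonal argument handles countably many \<open>u\<close>, hence the
    rationals; the Lipschitz bound carries convergence over to all real \<open>u\<close>.\<close>
  obtain k where k: "strict_mono k"
    "\<And>u. u \<in> \<rat> \<Longrightarrow> \<exists>l. (\<lambda>n. mean_upto g (real (r (k n)) * exp u)) \<longlonglongrightarrow> l"
    using function_convergent_subsequence[OF countable_rat, of "\<lambda>n u. mean_upto g (real (r n) * exp u)" 1]
      norm_mean_upto_le[where g = g, OF g] by blast
  define X where "X j = real (r (k j))" for j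
  have Xlim: "filterlim X at_top sequentially"
    unfolding X_def using filterlim_subseq[OF strict_mono_o[OF r(1) k(1)]]
    by (intro filterlim_compose[OF filterlim_real_sequentially]) (simp add: o_def)
  have Xpos: "\<forall>\<^sub>F j in sequentially. X j > 0"
    using Xlim by (simp add: filterlim_at_top_dense)
  have small: "(\<lambda>j. 1 / (X j * exp u) + 1 / (X j * exp v)) \<longlonglongrightarrow> 0" for u v
  proof -
    have "(\<lambda>j. 1 / (X j * exp w)) \<longlonglongrightarrow> 0" for w
    proof -
      have "(\<lambda>j. inverse (X j)) \<longlonglongrightarrow> 0" 
        using tendsto_inverse_0_at_top[OF Xlim] .
      from tendsto_mult_right[OF this, of "inverse (exp w)"] show ?thesis
        by (simp add: field_simps)
    qed
    from tendsto_add[OF this this] show ?thesis by simp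
  qed
  have lip: "\<forall>\<^sub>F j in sequentially. norm (mean_upto g (X j * exp u) - mean_upto g (X j * exp v))
     \<le> 2 * \<bar>u - v\<bar> + (1 / (X j * exp u) + 1 / (X j * exp v))" for u v
    using Xpos
  proof eventually_elim
    case (elim j)
    then show ?case
      using mean_upto_almost_lipschitz[where g = g, OF g, of "X j * exp v" "X j * exp u"]
      by (simp add: ln_mult add.commute)
  qed
  have "Cauchy (\<lambda>j. mean_upto g (X j * exp u))" for u
  proof (rule metric_CauchyI)
    fix d :: real assume d: "d > 0"
    obtain v where v: "v \<in> \<rat>" "u < v" "v < u + d / 16"
      using Rats_dense_in_real[of u "u + d / 16"] d by auto
    obtain l where "(\<lambda>n. mean_upto g (X n * exp v)) \<longlonglongrightarrow> l"
      using k(2)[OF v(1)] unfolding X_def ..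
    then have c: "\<forall>\<^sub>F n in sequentially. dist (mean_upto g (X n * exp v)) l < d / 4"
      by (rule tendstoD) (use d in simp)
    have s: "\<forall>\<^sub>F j in sequentially. \<bar>1 / (X j * exp u) + 1 / (X j * exp v)\<bar> < d / 16"
      using tendstoD[OF small[of u v], of "d / 16"] d by (simp add: dist_real_def)
    have "\<forall>\<^sub>F n in sequentially. dist (mean_upto g (X n * exp u)) l < d / 2"
      using c s lip[of u v]
    proof eventually_elim
      case (elim n)
      have "norm (mean_upto g (X n * exp u) - mean_upto g (X n * exp v)) < d / 4"
        using elim(2,3) v d by (simp add: abs_if split: if_splits)
      then show ?case
        using elim(1) norm_triangle_ineq[of "mean_upto g (X n * exp u) - mean_upto g (X n * exp v)"
            "mean_upto g (X n * exp v) - l"]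
        by (simp add: dist_norm)
    qed
    then obtain M where "\<And>n. n \<ge> M \<Longrightarrow> dist (mean_upto g (X n * exp u)) l < d / 2"
      by (auto simp: eventually_sequentially)
    then show "\<exists>M. \<forall>m\<ge>M. \<forall>n\<ge>M. dist (mean_upto g (X m * exp u)) (mean_upto g (X n * exp u)) < d"
      by (intro exI[of _ M] allI impI) (rule dist_triangle_half_l)
  qed
  then have "\<forall>u. \<exists>l. (\<lambda>j. mean_upto g (X j * exp u)) \<longlonglongrightarrow> l"
    unfolding Cauchy_convergent_iff convergent_def by (rule allI)
  from choice[OF this] obtain \<phi> where \<phi>: "\<And>u. (\<lambda>j. mean_upto g (X j * exp u)) \<longlonglongrightarrow> \<phi> u"
    by auto
  show thesis
  proof (rule that[OF Xlim \<phi>])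
    fix u v
    have "(\<lambda>j. 2 * \<bar>u - v\<bar> + (1 / (X j * exp u) + 1 / (X j * exp v))) \<longlonglongrightarrow> 2 * \<bar>u - v\<bar> + 0"
      by (intro tendsto_intros small)
    then show "norm (\<phi> u - \<phi> v) \<le> 2 * \<bar>u - v\<bar>"
      using tendsto_le[OF _ _ tendsto_norm[OF tendsto_diff[OF \<phi> \<phi>]] lip] by simp
    show "norm (\<phi> u) \<le> 1"
      by (rule tendsto_upperbound[OF tendsto_norm[OF \<phi>]]) (auto intro: always_eventually norm_mean_upto_le[where g = g, OF g])
  next
    have "norm (\<phi> 0) \<ge> e"
      using tendsto_lowerbound[OF tendsto_norm[OF \<phi>[of 0]], of e] r(2) by (simp add: X_def)
    then show "\<phi> 0 \<noteq> 0" using e(1) by auto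
  qed
qed

section \<open>Densities of multiples and their covariances\<close>

lemma mean_upto_dvd:
  assumes "d > 0"
  shows "mean_upto (\<lambda>n. of_bool (d dvd n) * h n) x = mean_upto (\<lambda>m. h (d * m)) (x / real d) / of_nat d"
proof -
  have "(\<Sum>n | 0 < n \<and> real n \<le> x. of_bool (d dvd n) * h n)
      = (\<Sum>n | (0 < n \<and> real n \<le> x) \<and> d dvd n. h n)"
    by (rule sum.mono_neutral_cong_right) auto
  also have "\<dots> = (\<Sum>m | 0 < m \<and> real m \<le> x / real d. h (d * m))"
    by (rule sum.reindex_bij_witness[of _ "\<lambda>m. d * m" "\<lambda>n. n div d"])
      (use assms in \<open>auto simp: field_simps elim!: dvdE\<close>)
  finally show ?thesis
    unfolding mean_upto_def using assms by simp
qed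

lemma mean_upto_one_tendsto: "((\<lambda>x. mean_upto (\<lambda>_. 1) x) \<longlongrightarrow> 1) at_top"
proof -
  have "((\<lambda>x::real. of_int \<lfloor>x\<rfloor> / x) \<longlongrightarrow> 1) at_top" by real_asymp
  then have "((\<lambda>x::real. complex_of_real (of_int \<lfloor>x\<rfloor> / x)) \<longlongrightarrow> of_real 1) at_top"
    by (rule tendsto_of_real)
  moreover have "\<forall>\<^sub>F x in at_top. complex_of_real (of_int \<lfloor>x\<rfloor> / x) = mean_upto (\<lambda>_. 1) x"
    using eventually_ge_at_top[of 0]
    by eventually_elim (simp add: mean_upto_def nats_upto_eq)
  ultimately show ?thesis by (auto elim: Lim_transform_eventually)
qed

lemma mean_upto_dvd_tendsto:
  assumes "d > 0"
  shows "((\<lambda>x. mean_upto (\<lambda>n. of_bool (d dvd n)) x) \<longlongrightarrow> 1 / of_nat d) at_top"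
proof -
  have "filterlim (\<lambda>x. x / real d) at_top at_top" using assms by real_asymp
  from filterlim_compose[OF mean_upto_one_tendsto this]
  have "((\<lambda>x. mean_upto (\<lambda>_. 1) (x / real d) / of_nat d) \<longlongrightarrow> 1 / of_nat d) at_top"
    by (intro tendsto_intros) (use assms in auto)
  moreover have "mean_upto (\<lambda>n. of_bool (d dvd n)) x = mean_upto (\<lambda>_. 1) (x / real d) / of_nat d" for x
    using mean_upto_dvd[OF assms, of "\<lambda>_. 1" x] by simp
  ultimately show ?thesis by simp
qed

text \<open>Divisibility by distinct primes is asymptotically independent, so the centred indicators
  have a diagonal covariance matrix, with the variance of an event of density \<open>1 / p\<close>
  on the diagonal.\<close>

lemma mean_upto_dvd_covariance:
  assumes "prime p" "prime q"
  shows "((\<lambda>x. mean_upto (\<lambda>n. (of_bool (p dvd n) - 1 / of_nat p) * (of_bool (q dvd n) - 1 / of_nat q)) x)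
    \<longlongrightarrow> (if p = q then 1 / of_nat p - 1 / of_nat p ^ 2 else 0)) at_top"
proof -
  define d where "d = lcm p q"
  have pos: "p > 0" "q > 0" "d > 0" using assms by (auto simp: d_def prime_gt_0_nat lcm_pos_nat)
  have *: "mean_upto (\<lambda>n. (of_bool (p dvd n) - 1 / of_nat p) * (of_bool (q dvd n) - 1 / of_nat q)) x =
     mean_upto (\<lambda>n. of_bool (d dvd n)) x - 1 / of_nat q * mean_upto (\<lambda>n. of_bool (p dvd n)) x
      - 1 / of_nat p * mean_upto (\<lambda>n. of_bool (q dvd n)) x + 1 / (of_nat p * of_nat q) * mean_upto (\<lambda>_. 1) x"
    (is "?L = _") for x
  proof -
    have "?L = mean_upto (\<lambda>n. of_bool (d dvd n) - 1 / of_nat q * of_bool (p dvd n)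
       - 1 / of_nat p * of_bool (q dvd n) + 1 / (of_nat p * of_nat q) * 1) x"
      by (rule mean_upto_cong) (auto simp: d_def algebra_simps)
    then show ?thesis unfolding mean_upto_add mean_upto_diff mean_upto_cmult .
  qed
  have "((\<lambda>x. mean_upto (\<lambda>n. (of_bool (p dvd n) - 1 / of_nat p) * (of_bool (q dvd n) - 1 / of_nat q)) x)
    \<longlongrightarrow> 1 / of_nat d - 1 / of_nat q * (1 / of_nat p) - 1 / of_nat p * (1 / of_nat q)
       + 1 / (of_nat p * of_nat q) * 1) at_top"
    unfolding * by (intro tendsto_intros mean_upto_dvd_tendsto mean_upto_one_tendsto pos)
  moreover have "d = (if p = q then p else p * q)"
    using assms primes_coprime[of p q] by (auto simp: d_def lcm_coprime)
  ultimately show ?thesis by (auto simp: power2_eq_square split: if_splits)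
qed

section \<open>The dual Turan--Kubilius inequality\<close>

locale unimodular_multiplicative =
  fixes g :: "nat \<Rightarrow> complex"
  assumes norm_eq_1: "n > 0 \<Longrightarrow> norm (g n) = 1"
    and mult_coprime: "0 < m \<Longrightarrow> 0 < n \<Longrightarrow> coprime m n \<Longrightarrow> g (m * n) = g m * g n"
begin

lemma norm_le_1: "\<forall>n>0. norm (g n) \<le> 1"
  by (simp add: norm_eq_1)

text \<open>\<open>g\<close> is only multiplicative, so \<open>g (p * m) = g p * g m\<close> can
  fail when \<open>p\<close> divides \<open>m\<close>. These exceptions have density
  \<open>1 / p\<close> among the \<open>m\<close>, the restriction to multiples of \<open>p\<close>
  gives another factor \<open>1 / p\<close>, and each discrepancy has norm at most 2.\<close>

lemma mean_upto_prime_dvd: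
  assumes "prime p"
  shows "norm (mean_upto (\<lambda>n. of_bool (p dvd n) * g n) x - g p * mean_upto g (x / p) / p) \<le> 2 / real p ^ 2"
proof -
  have p: "p > 0" using assms by (simp add: prime_gt_0_nat)
  define h where "h m = g (p * m) - g p * g m" for m
  have coprime: "h m = of_bool (p dvd m) * h m" if "m > 0" for m
    using that mult_coprime[OF p that] prime_imp_coprime[OF assms, of m] by (auto simp: h_def)
  have "norm (mean_upto (\<lambda>m. h (p * m) / 2) y) \<le> 1" for y
  proof (rule norm_mean_upto_le, intro allI impI)
    fix m :: nat assume "m > 0"
    then have "norm (h (p * m)) \<le> norm (g (p * (p * m))) + norm (g p * g (p * m))"
      unfolding h_def by (intro norm_triangle_ineq4)
    also have "\<dots> = 2" using p \<open>m > 0\<close> by (simp add: norm_mult norm_eq_1)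
    finally show "norm (h (p * m) / 2) \<le> 1" by (simp add: norm_divide)
  qed
  then have le: "norm (mean_upto (\<lambda>m. h (p * m)) y) \<le> 2" for y
    using mean_upto_cmult[of 2 "\<lambda>m. h (p * m) / 2" y] by (simp add: norm_mult)
  have "mean_upto (\<lambda>n. of_bool (p dvd n) * g n) x - g p * mean_upto g (x / p) / p
      = (mean_upto (\<lambda>m. g (p * m)) (x / p) - mean_upto (\<lambda>m. g p * g m) (x / p)) / p"
    unfolding mean_upto_dvd[OF p] mean_upto_cmult by (simp add: diff_divide_distrib)
  also have "\<dots> = mean_upto h (x / p) / p"
    unfolding h_def mean_upto_diff ..
  also have "mean_upto h (x / p) = mean_upto (\<lambda>m. of_bool (p dvd m) * h m) (x / p)"
    by (rule mean_upto_cong) (rule coprime)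
  also have "\<dots> = mean_upto (\<lambda>m. h (p * m)) (x / p / p) / p"
    by (rule mean_upto_dvd[OF p])
  finally have "norm (mean_upto (\<lambda>n. of_bool (p dvd n) * g n) x - g p * mean_upto g (x / p) / p)
      = norm (mean_upto (\<lambda>m. h (p * m)) (x / p / p)) / real p ^ 2"
    by (simp add: norm_divide norm_mult power2_eq_square)
  also have "\<dots> \<le> 2 / real p ^ 2"
    by (intro divide_right_mono le) simp
  finally show ?thesis .
qed

text \<open>The left side has nonnegative real part; with suitable \<open>b\<close> and a nearly
  diagonal Gram matrix this becomes Bessel's inequality. As \<open>d i\<close> is real valued, the
  two cross terms are conjugate to each other.\<close>

lemma bessel_identity:
  fixes d :: "'i \<Rightarrow> nat \<Rightarrow> complex" and b :: "'i \<Rightarrow> complex"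
  assumes d: "\<And>i n. cnj (d i n) = d i n"
  shows "mean_upto (\<lambda>n. of_real ((norm (g n - (\<Sum>i\<in>I. b i * d i n)))\<^sup>2)) x
    = mean_upto (\<lambda>_. 1) x - (\<Sum>i\<in>I. cnj (b i) * mean_upto (\<lambda>n. d i n * g n) x)
      - cnj (\<Sum>i\<in>I. cnj (b i) * mean_upto (\<lambda>n. d i n * g n) x)
      + (\<Sum>i\<in>I. \<Sum>j\<in>I. b i * cnj (b j) * mean_upto (\<lambda>n. d i n * d j n) x)"
proof -
  define T where "T n = (\<Sum>i\<in>I. b i * d i n)" for n
  have A: "(\<Sum>i\<in>I. cnj (b i) * mean_upto (\<lambda>n. d i n * g n) x) = mean_upto (\<lambda>n. g n * cnj (T n)) x"
    unfolding mean_upto_cmult[symmetric] mean_upto_sum[symmetric]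
    by (rule mean_upto_cong) (simp add: T_def d sum_distrib_left mult_ac)
  have B: "(\<Sum>i\<in>I. \<Sum>j\<in>I. b i * cnj (b j) * mean_upto (\<lambda>n. d i n * d j n) x)
      = mean_upto (\<lambda>n. T n * cnj (T n)) x"
    unfolding mean_upto_cmult[symmetric] mean_upto_sum[symmetric]
    by (rule mean_upto_cong) (simp add: T_def d sum_product mult_ac)
  show ?thesis
    unfolding A B mean_upto_cnj[symmetric] mean_upto_diff[symmetric] mean_upto_add[symmetric]
      T_def[symmetric]
  proof (rule mean_upto_cong)
    fix n :: nat assume "n > 0"
    have "complex_of_real ((norm (g n - T n))\<^sup>2) = (g n - T n) * cnj (g n - T n)"
      by (rule complex_norm_square)
    moreover have "g n * cnj (g n) = 1"
      using norm_eq_1[OF \<open>n > 0\<close>] complex_norm_square[of "g n"] by simp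
    ultimately show "complex_of_real ((norm (g n - T n))\<^sup>2)
        = 1 - g n * cnj (T n) - cnj (g n * cnj (T n)) + T n * cnj (T n)"
      by (simp add: algebra_simps)
  qed
qed

text \<open>
  The dual Turan--Kubilius inequality: Bessel's inequality for the asymptotically orthogonal
  functions \<open>1\<^bsub>p dvd n\<^esub> - 1 / p\<close>.
\<close>
lemma profile_prime_relation:
  assumes X: "filterlim X at_top sequentially"
    and \<phi>: "\<And>u. (\<lambda>j. mean_upto g (X j * exp u)) \<longlonglongrightarrow> \<phi> u"
    and P: "finite P" "\<And>p. p \<in> P \<Longrightarrow> prime p"
  shows "(\<Sum>p\<in>P. (norm (g p * \<phi> (u - ln p) - \<phi> u))\<^sup>2 / real p) \<le> 1 + 8 * (\<Sum>p\<in>P. 1 / real p ^ 2)"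
proof -
  \<comment> \<open>Along \<open>Y\<close> the inner product of \<open>g\<close> with
    \<open>d p\<close> is \<open>b p / p\<close> up to O(1 / p^2), while \<open>d p\<close> has mean
    square about \<open>1 / p\<close>; so \<open>b p\<close> is essentially the projection
    coefficient.\<close>
  define b where "b p = g p * \<phi> (u - ln p) - \<phi> u" for p
  define d where "d p n = (of_bool (p dvd n) - 1 / of_nat p :: complex)" for p n :: nat
  define Y where "Y j = X j * exp u" for j
  have Y: "filterlim Y at_top sequentially"
    unfolding Y_def by (intro filterlim_at_top_mult_tendsto_pos[OF tendsto_const _ X]) simp
  have pos: "p > 0" if "p \<in> P" for p using P(2)[OF that] by (simp add: prime_gt_0_nat)
  have \<phi>_le: "norm (\<phi> v) \<le> 1" for v
    by (rule tendsto_upperbound[OF tendsto_norm[OF \<phi>]])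
      (intro always_eventually allI norm_mean_upto_le norm_le_1 | simp)+
  have b_le: "norm (b p) \<le> 2" if "p \<in> P" for p
  proof -
    have "norm (b p) \<le> norm (g p * \<phi> (u - ln p)) + norm (\<phi> u)"
      unfolding b_def by (rule norm_triangle_ineq4)
    also have "\<dots> \<le> 1 + 1"
      using \<phi>_le[of u] \<phi>_le[of "u - ln p"] norm_eq_1[OF pos[OF that]] by (simp add: norm_mult)
    finally show ?thesis by simp
  qed
  define c where "c p j = (g p * mean_upto g (X j * exp (u - ln p)) - mean_upto g (Y j)) / of_nat p" for p j
  have c_lim: "(\<lambda>j. Re (cnj (b p) * c p j)) \<longlonglongrightarrow> (norm (b p))\<^sup>2 / real p" for p
  proof -
    have "(\<lambda>j. cnj (b p) * c p j) \<longlonglongrightarrow> cnj (b p) * (b p / of_nat p)"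
      unfolding c_def b_def Y_def divide_inverse by (intro tendsto_intros \<phi>)
    moreover have "cnj (b p) * (b p / of_nat p) = of_real ((norm (b p))\<^sup>2 / real p)"
      using complex_norm_square[of "b p"] by (simp add: mult.commute)
    ultimately show ?thesis using tendsto_Re by fastforce
  qed
  have corr: "Re (cnj (b p) * mean_upto (\<lambda>n. d p n * g n) (Y j)) \<ge> Re (cnj (b p) * c p j) - 4 / real p ^ 2"
    if "p \<in> P" for p j
  proof -
    have pp: "real p > 0" using pos[OF that] by simp
    have "mean_upto (\<lambda>n. d p n * g n) (Y j)
        = mean_upto (\<lambda>n. of_bool (p dvd n) * g n - 1 / of_nat p * g n) (Y j)"
      by (rule mean_upto_cong) (simp add: d_def algebra_simps)
    also have "\<dots> = mean_upto (\<lambda>n. of_bool (p dvd n) * g n) (Y j) - 1 / of_nat p * mean_upto g (Y j)"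
      unfolding mean_upto_diff mean_upto_cmult ..
    finally have "mean_upto (\<lambda>n. d p n * g n) (Y j) - c p j
        = mean_upto (\<lambda>n. of_bool (p dvd n) * g n) (Y j) - g p * mean_upto g (Y j / p) / p"
      using pp by (simp add: c_def Y_def exp_diff diff_divide_distrib)
    then have "norm (mean_upto (\<lambda>n. d p n * g n) (Y j) - c p j) \<le> 2 / real p ^ 2"
      using mean_upto_prime_dvd[OF P(2)[OF that], of "Y j"] by simp
    then have "norm (cnj (b p) * (mean_upto (\<lambda>n. d p n * g n) (Y j) - c p j)) \<le> 2 * (2 / real p ^ 2)"
      unfolding norm_mult by (intro mult_mono) (use b_le[OF that] in auto)
    then have "\<bar>Re (cnj (b p) * (mean_upto (\<lambda>n. d p n * g n) (Y j) - c p j))\<bar> \<le> 4 / real p ^ 2"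
      using abs_Re_le_cmod[of "cnj (b p) * (mean_upto (\<lambda>n. d p n * g n) (Y j) - c p j)"] by linarith
    then show ?thesis by (simp add: right_diff_distrib abs_le_iff)
  qed
  define Q where "Q j = (\<Sum>p\<in>P. \<Sum>q\<in>P. b p * cnj (b q) * mean_upto (\<lambda>n. d p n * d q n) (Y j))" for j
  have "Q \<longlonglongrightarrow> (\<Sum>p\<in>P. \<Sum>q\<in>P. b p * cnj (b q) * (if p = q then 1 / of_nat p - 1 / of_nat p ^ 2 else 0))"
    unfolding Q_def d_def
    by (intro tendsto_sum tendsto_mult tendsto_const
        filterlim_compose[OF mean_upto_dvd_covariance Y] P)
  also have "(\<Sum>p\<in>P. \<Sum>q\<in>P. b p * cnj (b q) * (if p = q then 1 / of_nat p - 1 / of_nat p ^ 2 else 0))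
      = of_real (\<Sum>p\<in>P. (norm (b p))\<^sup>2 * (1 / real p - 1 / real p ^ 2))"
    unfolding of_real_sum of_real_mult complex_norm_square
    by (rule sum.cong[OF refl]) (use P(1) in \<open>simp add: if_distrib cong: if_cong\<close>)
  finally have Q: "(\<lambda>j. Re (Q j)) \<longlonglongrightarrow> (\<Sum>p\<in>P. (norm (b p))\<^sup>2 * (1 / real p - 1 / real p ^ 2))"
    using tendsto_Re by fastforce
  have "(\<lambda>j. Re (mean_upto (\<lambda>_. 1) (Y j)) - 2 * (\<Sum>p\<in>P. Re (cnj (b p) * c p j) - 4 / real p ^ 2) + Re (Q j))
      \<longlonglongrightarrow> Re 1 - 2 * (\<Sum>p\<in>P. (norm (b p))\<^sup>2 / real p - 4 / real p ^ 2)
          + (\<Sum>p\<in>P. (norm (b p))\<^sup>2 * (1 / real p - 1 / real p ^ 2))"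
    by (intro tendsto_intros c_lim Q filterlim_compose[OF mean_upto_one_tendsto Y])
  moreover have "\<forall>\<^sub>F j in sequentially. 0 \<le> Re (mean_upto (\<lambda>_. 1) (Y j))
      - 2 * (\<Sum>p\<in>P. Re (cnj (b p) * c p j) - 4 / real p ^ 2) + Re (Q j)"
    using filterlim_at_top_dense[THEN iffD1, OF Y, rule_format, of 0]
  proof eventually_elim
    case (elim j)
    define E where "E = (\<Sum>p\<in>P. cnj (b p) * mean_upto (\<lambda>n. d p n * g n) (Y j))"
    have "0 \<le> Re (mean_upto (\<lambda>n. of_real ((norm (g n - (\<Sum>p\<in>P. b p * d p n)))\<^sup>2)) (Y j))"
      using elim unfolding mean_upto_def of_real_sum[symmetric] of_real_divide[symmetric] Re_complex_of_real
      by (intro divide_nonneg_pos sum_nonneg) auto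
    also have "\<dots> = Re (mean_upto (\<lambda>_. 1) (Y j)) - 2 * Re E + Re (Q j)"
      by (subst bessel_identity) (auto simp: d_def E_def Q_def)
    finally have "0 \<le> Re (mean_upto (\<lambda>_. 1) (Y j)) - 2 * Re E + Re (Q j)" .
    moreover have "Re E \<ge> (\<Sum>p\<in>P. Re (cnj (b p) * c p j) - 4 / real p ^ 2)"
      unfolding E_def Re_sum by (intro sum_mono corr)
    ultimately show ?case by linarith
  qed
  \<comment> \<open>The main sum occurs with factor -2 from the cross terms and at most +1 from the
    Gram matrix, so one copy survives; the errors \<open>4 / p ^ 2\<close>, doubled, produce the
    8.\<close>
  ultimately have "0 \<le> 1 - 2 * (\<Sum>p\<in>P. (norm (b p))\<^sup>2 / real p - 4 / real p ^ 2)
          + (\<Sum>p\<in>P. (norm (b p))\<^sup>2 * (1 / real p - 1 / real p ^ 2))"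
    using tendsto_lowerbound by fastforce
  also have "\<dots> \<le> 1 - 2 * (\<Sum>p\<in>P. (norm (b p))\<^sup>2 / real p - 4 / real p ^ 2) + (\<Sum>p\<in>P. (norm (b p))\<^sup>2 / real p)"
    by (intro add_left_mono sum_mono) (simp add: right_diff_distrib)
  finally show ?thesis
    unfolding b_def[symmetric] sum_subtractf using sum_distrib_left[of 4 "\<lambda>p. 1 / real p ^ 2" P] by simp
qed

end

section \<open>Euler products and the distribution of primes\<close>

definition smooth_over :: "nat set \<Rightarrow> nat set" where
  "smooth_over P = {n. n > 0 \<and> (\<forall>p. prime p \<longrightarrow> p dvd n \<longrightarrow> p \<in> P)}"

lemma smooth_over_empty: "smooth_over {} = {1}"
  unfolding smooth_over_def using prime_factor_nat by (auto simp: Suc_le_eq)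

lemma bij_betw_smooth_over_insert:
  assumes p: "prime p" "p \<notin> P"
  shows "bij_betw (\<lambda>(m, j). p ^ j * m) (smooth_over P \<times> UNIV) (smooth_over (insert p P))"
proof (rule bij_betw_byWitness[where f' = "\<lambda>n. (n div p ^ multiplicity p n, multiplicity p n)"])
  have p0: "p > 0" using p by (simp add: prime_gt_0_nat)
  have ndvd: "\<not> p dvd m" if "m \<in> smooth_over P" for m
    using that p unfolding smooth_over_def by blast
  have "\<forall>a\<in>smooth_over P \<times> UNIV.
      (case a of (m, j) \<Rightarrow> p ^ j * m) div p ^ multiplicity p (case a of (m, j) \<Rightarrow> p ^ j * m) = fst a
      \<and> multiplicity p (case a of (m, j) \<Rightarrow> p ^ j * m) = snd a"
  proof (clarify, goal_cases)
    case (1 m j)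
    then have "multiplicity p (p ^ j * m) = j"
      using ndvd p0 by (intro multiplicity_decomposeI[of _ _ _ m]) auto
    then show ?case using p0 by simp
  qed
  then show "\<forall>a\<in>smooth_over P \<times> UNIV.
      ((case a of (m, j) \<Rightarrow> p ^ j * m) div p ^ multiplicity p (case a of (m, j) \<Rightarrow> p ^ j * m),
       multiplicity p (case a of (m, j) \<Rightarrow> p ^ j * m)) = a"
    by (auto simp: prod_eq_iff)
  show "\<forall>n\<in>smooth_over (insert p P). (case (n div p ^ multiplicity p n, multiplicity p n) of (m, j) \<Rightarrow> p ^ j * m) = n"
    by (simp add: multiplicity_dvd)
  show "(\<lambda>(m, j). p ^ j * m) ` (smooth_over P \<times> UNIV) \<subseteq> smooth_over (insert p P)"
    using p0 p(1) unfolding smooth_over_def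
    by (auto simp: prime_dvd_mult_iff) (metis prime_dvd_power primes_dvd_imp_eq)+
  show "(\<lambda>n. (n div p ^ multiplicity p n, multiplicity p n)) ` smooth_over (insert p P) \<subseteq> smooth_over P \<times> UNIV"
  proof (clarify, goal_cases)
    case (1 _ _ n)
    then have n: "n > 0" "\<And>q. prime q \<Longrightarrow> q dvd n \<Longrightarrow> q \<in> insert p P"
      unfolding smooth_over_def by auto
    have "n div p ^ multiplicity p n > 0"
      using n(1) p0 by (simp add: div_greater_zero_iff dvd_imp_le multiplicity_dvd)
    moreover have "q \<in> P" if "prime q" "q dvd n div p ^ multiplicity p n" for q
    proof -
      have "q dvd n" using that(2) by (metis dvd_div_mult_self dvd_mult2 multiplicity_dvd)
      moreover have "q \<noteq> p"
        using multiplicity_decompose[of n p] that(2) n(1) prime_gt_1_nat[OF p(1)] by auto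
      ultimately show ?thesis using n(2)[OF that(1)] by auto
    qed
    ultimately show ?case by (simp add: smooth_over_def)
  qed
qed

text \<open>Induction on \<open>P\<close>: splitting off the power of a new prime turns the sum over
  smooth numbers into a double sum, and absolute summability allows iterated summation. The field is
  generic because both the real zeta series and its complex twist are needed.\<close>

lemma euler_product_finite:
  fixes a :: "nat \<Rightarrow> 'a :: {real_normed_field, banach}"
  assumes P: "finite P" "\<And>p. p \<in> P \<Longrightarrow> prime p"
    and a1: "a 1 = 1"
    and mult: "\<And>m n. m > 0 \<Longrightarrow> n > 0 \<Longrightarrow> coprime m n \<Longrightarrow> a (m * n) = a m * a n"
    and summ: "\<And>p. p \<in> P \<Longrightarrow> summable (\<lambda>j. norm (a (p ^ j)))"
  shows "(\<lambda>n. norm (a n)) summable_on smooth_over P"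
    and "(a has_sum (\<Prod>p\<in>P. \<Sum>j. a (p ^ j))) (smooth_over P)"
proof -
  have "(\<lambda>n. norm (a n)) summable_on smooth_over P \<and>
      (a has_sum (\<Prod>p\<in>P. \<Sum>j. a (p ^ j))) (smooth_over P)"
    using P summ
  proof (induction P rule: finite_induct)
    case empty
    then show ?case
      using has_sum_finite[of "{1::nat}" a] a1 by (simp add: smooth_over_empty)
  next
    case (insert p P)
    have p: "prime p" "p \<notin> P" and s: "summable (\<lambda>j. norm (a (p ^ j)))"
      using insert.prems insert.hyps by auto
    have IH: "(\<lambda>n. norm (a n)) summable_on smooth_over P"
        "(a has_sum (\<Prod>p\<in>P. \<Sum>j. a (p ^ j))) (smooth_over P)"
      using insert.IH insert.prems by auto
    define F where "F = (\<lambda>(m, j). a m * a (p ^ j))"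
    have bij: "bij_betw (\<lambda>(m, j). p ^ j * m) (smooth_over P \<times> UNIV) (smooth_over (insert p P))"
      by (rule bij_betw_smooth_over_insert[OF p])
    have aF: "a ((\<lambda>(m, j). p ^ j * m) z) = F z" if z': "z \<in> smooth_over P \<times> UNIV" for z
    proof -
      obtain m j where z: "z = (m, j)" "m \<in> smooth_over P" using z' by auto
      then have m: "m > 0" "\<not> p dvd m" using p by (auto simp: smooth_over_def)
      then have "coprime (p ^ j) m"
        using prime_imp_coprime[OF p(1)] by simp
      then show ?thesis
        using mult[of "p ^ j" m] m p(1) by (simp add: z F_def prime_gt_0_nat)
    qed
    have inner: "((\<lambda>j. norm (a (p ^ j))) has_sum (\<Sum>j. norm (a (p ^ j)))) UNIV"
      using s by (intro norm_summable_imp_has_sum summable_sums) auto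
    have "(\<lambda>z. norm (F z)) summable_on smooth_over P \<times> UNIV"
    proof (rule summable_on_SigmaI)
      show "((\<lambda>j. norm (F (m, j))) has_sum norm (a m) * (\<Sum>j. norm (a (p ^ j)))) UNIV" for m
        using has_sum_cmult_right[OF inner, of "norm (a m)"] by (simp add: F_def norm_mult)
      show "(\<lambda>m. norm (a m) * (\<Sum>j. norm (a (p ^ j)))) summable_on smooth_over P"
        by (intro summable_on_cmult_left IH)
    qed auto
    moreover have "(F has_sum (\<Prod>p\<in>P. \<Sum>j. a (p ^ j)) * (\<Sum>j. a (p ^ j))) (smooth_over P \<times> UNIV)"
    proof (rule has_sum_SigmaI)
      have "((\<lambda>j. a (p ^ j)) has_sum (\<Sum>j. a (p ^ j))) UNIV"
        using s by (intro norm_summable_imp_has_sum summable_sums) (auto intro: summable_norm_cancel)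
      from has_sum_cmult_right[OF this]
      show "((\<lambda>j. F (m, j)) has_sum a m * (\<Sum>j. a (p ^ j))) UNIV" for m
        by (simp add: F_def)
      show "((\<lambda>m. a m * (\<Sum>j. a (p ^ j))) has_sum (\<Prod>p\<in>P. \<Sum>j. a (p ^ j)) * (\<Sum>j. a (p ^ j))) (smooth_over P)"
        by (intro has_sum_cmult_left IH)
      show "F summable_on smooth_over P \<times> UNIV"
        by (rule abs_summable_summable) fact
    qed
    moreover have prod_eq: "(\<Prod>q\<in>insert p P. \<Sum>j. a (q ^ j)) = (\<Prod>p\<in>P. \<Sum>j. a (p ^ j)) * (\<Sum>j. a (p ^ j))"
      using p(2) insert.hyps(1) by simp
    ultimately show ?case
      unfolding prod_eq has_sum_reindex_bij_betw[OF bij, symmetric] summable_on_reindex_bij_betw[OF bij, symmetric]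
      by (simp only: aF simp_thms cong: has_sum_cong summable_on_cong)
  qed
  then show "(\<lambda>n. norm (a n)) summable_on smooth_over P"
    and "(a has_sum (\<Prod>p\<in>P. \<Sum>j. a (p ^ j))) (smooth_over P)" by auto
qed

section \<open>Sums of reciprocals of primes\<close>

lemma sum_inverse_squares_le:
  assumes "finite A" "\<And>n. n \<in> A \<Longrightarrow> n \<ge> (2::nat)"
  shows "(\<Sum>n\<in>A. 1 / real n ^ 2) \<le> 1"
proof -
  have *: "(\<Sum>n=2..Suc N. 1 / real n ^ 2) \<le> 1 - 1 / real (Suc N)" for N
  proof (induction N)
    case (Suc N)
    have "1 / real (Suc (Suc N)) ^ 2 \<le> 1 / real (Suc N) - 1 / real (Suc (Suc N))"
    proof -
      have "1 / real (Suc (Suc N)) ^ 2 \<le> 1 / (real (Suc N) * real (Suc (Suc N)))"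
        unfolding power2_eq_square by (intro frac_le mult_right_mono) auto
      also have "\<dots> = 1 / real (Suc N) - 1 / real (Suc (Suc N))"
        by (simp add: field_simps)
      finally show ?thesis .
    qed
    with Suc show ?case by simp
  qed auto
  obtain N where "A \<subseteq> {..N}" using assms(1) finite_nat_set_iff_bounded_le by auto
  then have "A \<subseteq> {2..Suc N}" using assms(2) by fastforce
  then have "(\<Sum>n\<in>A. 1 / real n ^ 2) \<le> (\<Sum>n=2..Suc N. 1 / real n ^ 2)"
    by (intro sum_mono2) auto
  also have "\<dots> \<le> 1" using *[of N] by (smt (verit) divide_nonneg_nonneg of_nat_0_le_iff)
  finally show ?thesis .
qed

lemma finite_primes_upto [simp]: "finite {p. prime p \<and> real p \<le> x}"
  by (rule finite_subset[of _ "{..nat \<lfloor>x\<rfloor>}"]) (auto simp: le_nat_floor)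

text \<open>Euler's argument: every \<open>n\<close> up to \<open>x\<close> is smooth over the
  primes up to \<open>x\<close>, so the finite Euler product dominates a harmonic number. After
  taking logarithms, the terms of order \<open>1 / p ^ 2\<close> total at most 2.\<close>

lemma sum_prime_reciprocals_ge:
  assumes "x > 1"
  shows "(\<Sum>p | prime p \<and> real p \<le> x. 1 / real p) \<ge> ln (ln x) - 2"
proof -
  define P where "P = {p. prime p \<and> real p \<le> x}"
  define N where "N = nat \<lfloor>x\<rfloor>"
  have fin: "finite P" by (simp add: P_def)
  have P: "prime p" "p \<ge> 2" "1 / real p \<le> 1 / 2" if "p \<in> P" for p
    using that prime_ge_2_nat[of p] by (auto simp: P_def field_simps)
  have geo: "(\<Sum>j. 1 / real (p ^ j)) = 1 / (1 - 1 / real p)" "summable (\<lambda>j. 1 / real (p ^ j))" if "p \<in> P" for p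
    using suminf_geometric[of "1 / real p"] summable_geometric[of "1 / real p"] P[OF that]
    by (simp_all add: power_one_over)
  have "((\<lambda>n. 1 / real n) has_sum (\<Prod>p\<in>P. \<Sum>j. 1 / real (p ^ j))) (smooth_over P)"
    by (rule euler_product_finite(2)) (use P geo fin in auto)
  then have hs: "((\<lambda>n. 1 / real n) has_sum (\<Prod>p\<in>P. 1 / (1 - 1 / real p))) (smooth_over P)"
    using geo(1) by simp
  have "ln x \<le> ln (real N + 1)"
    using assms by (subst ln_le_cancel_iff) (auto simp: N_def, linarith)
  also have "\<dots> \<le> harm N" by (rule ln_le_harm)
  also have "\<dots> = (\<Sum>n\<in>{1..N}. 1 / real n)"
    by (simp add: harm_def inverse_eq_divide)
  also have "\<dots> \<le> (\<Prod>p\<in>P. 1 / (1 - 1 / real p))"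
  proof (rule finite_sum_le_has_sum[OF hs])
    show "{1..N} \<subseteq> smooth_over P"
    proof
      fix n assume n: "n \<in> {1..N}"
      then have "real n \<le> x" using assms by (simp add: N_def le_nat_iff le_floor_iff)
      then show "n \<in> smooth_over P"
        using n by (auto simp: smooth_over_def P_def intro: order.trans[of _ "real n"] dest: dvd_imp_le)
    qed
  qed auto
  finally have le: "ln x \<le> (\<Prod>p\<in>P. 1 / (1 - 1 / real p))" .
  have "0 < ln x" using assms by simp
  then have "ln (ln x) \<le> ln (\<Prod>p\<in>P. 1 / (1 - 1 / real p))"
    using le by (subst ln_le_cancel_iff) auto
  also have "\<dots> = (\<Sum>p\<in>P. ln (1 / (1 - 1 / real p)))"
    by (rule ln_prod) (use fin P in \<open>force simp: field_simps\<close>)+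
  also have "\<dots> \<le> (\<Sum>p\<in>P. 1 / real p + 2 * (1 / real p ^ 2))"
  proof (rule sum_mono)
    fix p assume "p \<in> P"
    note p = P[OF this]
    have "ln (1 / (1 - 1 / real p)) = - ln (1 - 1 / real p)"
      using p by (simp add: ln_div)
    also have "\<dots> \<le> 1 / real p + 2 * (1 / real p)\<^sup>2"
      using ln_one_minus_pos_lower_bound[of "1 / real p"] p by simp
    finally show "ln (1 / (1 - 1 / real p)) \<le> 1 / real p + 2 * (1 / real p ^ 2)"
      by (simp add: power_one_over)
  qed
  also have "\<dots> = (\<Sum>p\<in>P. 1 / real p) + 2 * (\<Sum>p\<in>P. 1 / real p ^ 2)"
    by (simp add: sum.distrib sum_distrib_left)
  also have "\<dots> \<le> (\<Sum>p\<in>P. 1 / real p) + 2"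
    using sum_inverse_squares_le[OF fin P(2)] by simp
  finally show ?thesis by (simp add: P_def)
qed

lemma prod_primes_dvd:
  fixes n :: nat
  assumes "finite S" "\<And>p. p \<in> S \<Longrightarrow> prime p" "\<And>p. p \<in> S \<Longrightarrow> p dvd n"
  shows "\<Prod>S dvd n"
  using assms
proof (induction S rule: finite_induct)
  case (insert p S)
  have "coprime p (\<Prod>S)"
    by (rule prod_coprime_right) (use insert in \<open>auto intro!: primes_coprime\<close>)
  then show ?case using insert by (simp add: divides_mult)
qed auto

text \<open>
  All primes in \<open>(x, x + k]\<close> with \<open>k \<le> x\<close> divide \<open>(x + k) choose k\<close>, which is at most
  \<open>(1 + e) ^ (x + k) / e ^ k\<close> for every \<open>e > 0\<close>.
\<close>
lemma sum_prime_reciprocals_short_interval: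
  fixes \<delta> :: real
  assumes "\<delta> > 0"
  shows "\<exists>h>0. \<exists>y0. \<forall>y\<ge>y0. (\<Sum>p | prime p \<and> exp y < real p \<and> real p \<le> exp (y + h). 1 / real p) \<le> \<delta> / y"
proof -
  \<comment> \<open>Multiplied by \<open>x\<close>, this expression bounds \<open>card S * y\<close>
    below: \<open>z\<close> is at most \<open>(1 + 2 * e) * x\<close>, \<open>k\<close> is at most
    \<open>2 * e * x\<close>, and removing the weight \<open>e ^ k\<close> costs
    \<open>ln (1 / e)\<close> per factor.\<close>
  have "((\<lambda>e::real. e * (1 + 2 * e) + 2 * e * ln (1 / e)) \<longlongrightarrow> 0) (at_right 0)" by real_asymp
  then have "\<forall>\<^sub>F e in at_right 0. e * (1 + 2 * e) + 2 * e * ln (1 / e) < \<delta>"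
    using assms by (rule order_tendstoD)
  moreover have "\<forall>\<^sub>F e in at_right (0::real). 0 < e \<and> e < 1 / 4"
    by (rule eventually_at_rightI[of 0 "1 / 4"]) auto
  ultimately have "\<forall>\<^sub>F e in at_right 0. e * (1 + 2 * e) + 2 * e * ln (1 / e) < \<delta> \<and> 0 < e \<and> e < 1 / 4"
    by eventually_elim auto
  then obtain e :: real where e: "e * (1 + 2 * e) + 2 * e * ln (1 / e) < \<delta>" "0 < e" "e < 1 / 4"
    using eventually_happens'[OF trivial_limit_at_right_real] by blast
  \<comment> \<open>The second threshold absorbs the rounding error: it is equivalent to
    \<open>e * exp y + 1 \<le> 2 * e * (exp y - 1)\<close>.\<close>
  define y0 where "y0 = max 1 (ln ((1 + 2 * e) / e))"
  have "\<forall>y\<ge>y0. (\<Sum>p | prime p \<and> exp y < real p \<and> real p \<le> exp (y + e / 2). 1 / real p) \<le> \<delta> / y"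
  proof (intro allI impI)
    fix y assume "y \<ge> y0"
    then have y: "y \<ge> 1" "exp y \<ge> (1 + 2 * e) / e"
      using e exp_le_cancel_iff[of "ln ((1 + 2 * e) / e)" y] by (auto simp: y0_def)
    define x where "x = nat \<lfloor>exp y\<rfloor>"
    define z where "z = nat \<lfloor>exp (y + e / 2)\<rfloor>"
    define k where "k = z - x"
    have xz: "x \<le> z" unfolding x_def z_def by (intro nat_mono floor_mono) (use e in auto)
    have xr: "real x \<le> exp y" "exp y < real x + 1" unfolding x_def by (auto, linarith?)
    have zr: "real z \<le> exp (y + e / 2)" unfolding z_def by auto
    have zk: "z = x + k" using xz by (simp add: k_def)
    have "exp (e / 2) \<le> 1 + e / 2 + (e / 2)\<^sup>2"
      using exp_bound[of "e / 2"] e by simp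
    also have "\<dots> \<le> 1 + e" using e by (simp add: power2_eq_square field_simps)
    finally have "exp (y + e / 2) \<le> exp y * (1 + e)" by (simp add: exp_add)
    then have "real k \<le> e * exp y + 1" using zr xr zk by (simp add: algebra_simps)
    also have "\<dots> \<le> 2 * e * (exp y - 1)" using y(2) e by (simp add: field_simps)
    also have "\<dots> \<le> 2 * e * real x" using xr e by (intro mult_left_mono) auto
    finally have k: "real k \<le> 2 * e * real x" .
    also have "\<dots> \<le> 1 * real x" using e by (intro mult_right_mono) auto
    finally have kx: "k \<le> x" by simp
    define S where "S = {p. prime p \<and> exp y < real p \<and> real p \<le> exp (y + e / 2)}"
    have S: "prime p" "x < p" "p \<le> z" "exp y < real p" if "p \<in> S" for p
      using that xr by (auto simp: S_def z_def le_nat_floor) 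
    have fin: "finite S" by (rule finite_subset[of _ "{..z}"]) (use S in auto)
    have "\<Prod>S dvd (z choose k)"
    proof (rule prod_primes_dvd[OF fin S(1)])
      fix p assume "p \<in> S"
      note p = S[OF this]
      have "fact k * fact x * (z choose k) = fact z"
        using binomial_fact_lemma[of k z] by (simp add: zk)
      moreover have "p dvd fact z" "\<not> p dvd fact k" "\<not> p dvd fact x"
        using p kx by (auto simp: prime_dvd_fact_iff)
      ultimately show "p dvd (z choose k)"
        using p(1) by (metis prime_dvd_mult_iff)
    qed
    then have "\<Prod>S \<le> (z choose k)" using zk by (intro dvd_imp_le) auto
    have "exp y ^ card S = (\<Prod>p\<in>S. exp y)" by simp
    also have "\<dots> \<le> (\<Prod>p\<in>S. real p)"
      by (rule prod_mono) (use S(4) in \<open>auto intro: less_imp_le\<close>)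
    also have "\<dots> = real (\<Prod>S)" by simp
    also have "\<dots> \<le> real (z choose k)" using \<open>\<Prod>S \<le> (z choose k)\<close> by (rule of_nat_mono)
    also have "\<dots> = (real (z choose k) * e ^ k) * (1 / e) ^ k"
      using e by (simp add: power_one_over)
    also have "real (z choose k) * e ^ k \<le> (e + 1) ^ z"
      unfolding binomial_ring using zk e
      by (intro order.trans[OF _ member_le_sum[of k "{..z}"]]) auto
    also have "(e + 1) ^ z \<le> exp e ^ z"
      using e by (intro power_mono) (auto simp: exp_ge_add_one_self add.commute)
    also have "(1 / e) ^ k = exp (ln (1 / e)) ^ k" using e by simp
    finally have "exp (real (card S) * y) \<le> exp (real z * e + real k * ln (1 / e))"
      using e by (simp add: exp_add exp_of_nat_mult mult_right_mono)
    then have "real (card S) * y \<le> real z * e + real k * ln (1 / e)" by simp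
    also have "\<dots> \<le> (real x + 2 * e * real x) * e + (2 * e * real x) * ln (1 / e)"
      using k zk e by (intro add_mono mult_right_mono) auto
    also have "\<dots> = real x * (e * (1 + 2 * e) + 2 * e * ln (1 / e))" by (simp add: algebra_simps)
    also have "\<dots> \<le> exp y * \<delta>" using xr e by (intro mult_mono) (auto intro!: add_nonneg_nonneg)
    finally have card: "real (card S) \<le> exp y * \<delta> / y" using y by (simp add: field_simps)
    have "(\<Sum>p\<in>S. 1 / real p) \<le> (\<Sum>p\<in>S. 1 / exp y)"
      by (intro sum_mono frac_le) (use S(4) in \<open>auto intro: less_imp_le\<close>)
    also have "\<dots> = real (card S) / exp y" by simp
    also have "\<dots> \<le> \<delta> / y" using card by (simp add: field_simps)
    finally show "(\<Sum>p | prime p \<and> exp y < real p \<and> real p \<le> exp (y + e / 2). 1 / real p) \<le> \<delta> / y"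
      by (simp add: S_def)
  qed
  then show ?thesis using e(2) by (metis half_gt_zero)
qed

section \<open>Halasz's theorem for unimodular functions\<close>

text \<open>
  Stands in for the functions \<open>n \<mapsto> n\<^sup>i\<^sup>t\<close>: slow variation is all that partial summation needs, so \<open>t\<close> is never
  extracted.
\<close>
definition archimedean_character :: "(nat \<Rightarrow> complex) \<Rightarrow> bool" where
  "archimedean_character \<kappa> \<longleftrightarrow> (\<forall>n>0. norm (\<kappa> n) = 1) \<and> (\<forall>m>0. \<forall>n>0. \<kappa> (m * n) = \<kappa> m * \<kappa> n) \<and>
     (\<exists>L. \<forall>n>0. norm (\<kappa> (Suc n) - \<kappa> n) \<le> L / real n)"

text \<open>For unimodular values the squared norm is
  \<open>2 - 2 * Re (g p * cnj (\<kappa> p))\<close>, so this is twice the usual squared pretentious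
  distance; a common bound for all finite sets of primes expresses that it is finite.\<close>

definition pretends :: "(nat \<Rightarrow> complex) \<Rightarrow> (nat \<Rightarrow> complex) \<Rightarrow> bool" where
  "pretends g \<kappa> \<longleftrightarrow> (\<exists>B. \<forall>P. finite P \<longrightarrow> (\<forall>p\<in>P. prime p) \<longrightarrow> (\<Sum>p\<in>P. (norm (g p - \<kappa> p))\<^sup>2 / real p) \<le> B)"

lemma norm_mult_diff_le:
  assumes "norm b \<le> 1" "norm c \<le> 1"
  shows "norm (a * b - c * d) \<le> norm (a - c) + norm (b - d :: complex)"
proof -
  have "a * b - c * d = (a - c) * b + c * (b - d)" by (simp add: algebra_simps)
  also have "norm \<dots> \<le> norm ((a - c) * b) + norm (c * (b - d))" by (rule norm_triangle_ineq)
  also have "\<dots> = norm (a - c) * norm b + norm c * norm (b - d)" by (simp only: norm_mult)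
  also have "\<dots> \<le> norm (a - c) * 1 + 1 * norm (b - d)"
    by (intro add_mono mult_left_mono mult_right_mono) (use assms in auto)
  finally show ?thesis by simp
qed

lemma norm_mult_cnj_diff_le:
  assumes "norm b \<le> 1" "norm c \<le> 1"
  shows "norm (a * cnj b - c * cnj d) \<le> norm (a - c) + norm (b - d :: complex)"
  using norm_mult_diff_le[of "cnj b" c a "cnj d"] assms
  by (simp flip: complex_cnj_diff)

text \<open>The rigidity argument below sees only the values of \<open>g\<close> at primes;
  multiplicativity enters through \<open>relation\<close> alone.\<close>

locale prime_profile =
  fixes g :: "nat \<Rightarrow> complex" and \<phi> :: "real \<Rightarrow> complex" and C :: real
  assumes norm_g: "prime p \<Longrightarrow> norm (g p) = 1"
    and lipschitz: "norm (\<phi> u - \<phi> v) \<le> 2 * \<bar>u - v\<bar>"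
    and norm_le_1: "norm (\<phi> u) \<le> 1"
    and nonzero: "\<phi> 0 \<noteq> 0"
    and relation: "finite P \<Longrightarrow> (\<And>p. p \<in> P \<Longrightarrow> prime p) \<Longrightarrow>
       (\<Sum>p\<in>P. (norm (g p * \<phi> (u - ln (real p)) - \<phi> u))\<^sup>2 / real p) \<le> C"
begin

definition good :: "real \<Rightarrow> real \<Rightarrow> nat \<Rightarrow> bool" where
  "good R e p \<longleftrightarrow> (\<forall>u. \<bar>u\<bar> \<le> R \<longrightarrow> norm (g p * \<phi> (u - ln (real p)) - \<phi> u) \<le> e)"

text \<open>The defect at \<open>p\<close> is 4-Lipschitz in \<open>u\<close>, so a defect above
  \<open>e\<close> in the window forces one of at least \<open>e / 2\<close> at a point of a finite
  net of mesh \<open>e / 8\<close>. Summing \<open>relation\<close> over the net bounds the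
  exceptional primes.\<close>

lemma sum_not_good_bounded:
  assumes "e > 0"
  shows "\<exists>B. \<forall>P. finite P \<longrightarrow> (\<forall>p\<in>P. prime p \<and> \<not> good R e p) \<longrightarrow> (\<Sum>p\<in>P. 1 / real p) \<le> B"
proof -
  define b where "b p u = norm (g p * \<phi> (u - ln (real p)) - \<phi> u)" for p u
  have b_lip: "b p u \<le> b p v + 4 * \<bar>u - v\<bar>" if "prime p" for p u v
  proof -
    have "g p * \<phi> (u - ln (real p)) - \<phi> u = (g p * \<phi> (v - ln (real p)) - \<phi> v)
       + (g p * (\<phi> (u - ln (real p)) - \<phi> (v - ln (real p))) - (\<phi> u - \<phi> v))"
      by (simp add: algebra_simps)
    then have "b p u \<le> b p v + norm (g p * (\<phi> (u - ln (real p)) - \<phi> (v - ln (real p))) - (\<phi> u - \<phi> v))"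
      unfolding b_def by (metis norm_triangle_ineq)
    also have "norm (g p * (\<phi> (u - ln (real p)) - \<phi> (v - ln (real p))) - (\<phi> u - \<phi> v))
       \<le> norm (\<phi> (u - ln (real p)) - \<phi> (v - ln (real p))) + norm (\<phi> u - \<phi> v)"
      using norm_triangle_ineq4[of "g p * (\<phi> (u - ln (real p)) - \<phi> (v - ln (real p)))" "\<phi> u - \<phi> v"]
      by (simp add: norm_mult norm_g[OF that])
    also have "\<dots> \<le> 2 * \<bar>u - v\<bar> + 2 * \<bar>u - v\<bar>"
      using lipschitz[of "u - ln (real p)" "v - ln (real p)"] lipschitz[of u v] by simp
    finally show ?thesis by simp
  qed
  have "\<exists>k. finite k \<and> {-R..R} \<subseteq> (\<Union>x\<in>k. ball x (e / 8))"
    using compact_Icc[of "-R" R] assms unfolding compact_eq_totally_bounded by simp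
  then obtain G where G: "finite G" "{-R..R} \<subseteq> (\<Union>x\<in>G. ball x (e / 8))" by blast
  show ?thesis
  proof (intro exI allI impI)
    fix P assume P: "finite P" "\<forall>p\<in>P. prime p \<and> \<not> good R e p"
    have "(\<Sum>p\<in>P. 1 / real p) \<le> (\<Sum>p\<in>P. \<Sum>v\<in>G. 4 / e\<^sup>2 * ((b p v)\<^sup>2 / real p))"
    proof (rule sum_mono)
      fix p assume "p \<in> P"
      then have p: "prime p" "\<not> good R e p" using P(2) by auto
      then obtain u where u: "\<bar>u\<bar> \<le> R" "b p u > e" by (auto simp: good_def b_def not_le)
      then have "u \<in> {-R..R}" by auto
      then obtain v where v: "v \<in> G" "dist v u < e / 8" using G(2) by fastforce
      then have "b p v \<ge> e / 2"
        using b_lip[OF p(1), of u v] u(2) by (simp add: dist_real_def abs_minus_commute)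
      then have "(b p v)\<^sup>2 \<ge> (e / 2)\<^sup>2" using assms by (intro power_mono) auto
      then have "1 / real p \<le> 4 / e\<^sup>2 * ((b p v)\<^sup>2 / real p)"
        using assms prime_gt_0_nat[OF p(1)] by (simp add: field_simps)
      also have "\<dots> \<le> (\<Sum>v\<in>G. 4 / e\<^sup>2 * ((b p v)\<^sup>2 / real p))"
        by (rule member_le_sum) (use v G in auto)
      finally show "1 / real p \<le> (\<Sum>v\<in>G. 4 / e\<^sup>2 * ((b p v)\<^sup>2 / real p))" .
    qed
    also have "\<dots> = (\<Sum>v\<in>G. 4 / e\<^sup>2 * (\<Sum>p\<in>P. (b p v)\<^sup>2 / real p))"
      unfolding sum_distrib_left by (rule sum.swap)
    also have "\<dots> \<le> (\<Sum>v\<in>G. 4 / e\<^sup>2 * C)"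
      unfolding b_def by (intro sum_mono mult_left_mono relation) (use P in auto)
    finally show "(\<Sum>p\<in>P. 1 / real p) \<le> (\<Sum>v\<in>G. 4 / e\<^sup>2 * C)" .
  qed
qed

text \<open>
  If all good primes with logarithms in a common cell \<open>(k \<eta>, (k + 1) \<eta>]\<close> were closer than \<open>h\<close>, the
  cells would contribute too little to the divergent sum of \<open>1 / p\<close>.
\<close>
lemma ex_good_prime_pairs:
  assumes "\<eta> > 0"
  shows "\<exists>h>0. \<forall>R e. e > 0 \<longrightarrow> (\<exists>p q. prime p \<and> prime q \<and> good R e p \<and> good R e q \<and>
     h \<le> ln (real q) - ln (real p) \<and> ln (real q) - ln (real p) \<le> \<eta>)"
proof -
  \<comment> \<open>With this choice a cell contributes at most
    \<open>2 * \<delta> / (k * \<eta>) = 1 / (2 * k)\<close>. The good primes below cell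
    \<open>K\<close> then account for about half of \<open>ln K\<close>, while all primes together
    must produce all of it.\<close>
  define \<delta> where "\<delta> = \<eta> / 4"
  have \<delta>: "\<delta> > 0" using assms by (simp add: \<delta>_def)
  obtain h y0 where h: "h > 0" and y0: "\<And>y. y \<ge> y0 \<Longrightarrow>
      (\<Sum>p | prime p \<and> exp y < real p \<and> real p \<le> exp (y + h). 1 / real p) \<le> \<delta> / y"
    using sum_prime_reciprocals_short_interval[OF \<delta>] by blast
  \<comment> \<open>\<open>h\<close> is fixed before \<open>R\<close> and \<open>e\<close>; this
    uniformity later keeps the limit of such differences positive.\<close>
  show ?thesis
  proof (intro exI[of _ h] conjI h allI impI, rule ccontr)
    fix R e :: real assume "e > 0"
    assume no_pair: "\<not> (\<exists>p q. prime p \<and> prime q \<and> good R e p \<and> good R e q \<and>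
      h \<le> ln (real q) - ln (real p) \<and> ln (real q) - ln (real p) \<le> \<eta>)"
    obtain B where B: "\<And>P. finite P \<Longrightarrow> (\<forall>p\<in>P. prime p \<and> \<not> good R e p) \<Longrightarrow> (\<Sum>p\<in>P. 1 / real p) \<le> B"
      using sum_not_good_bounded[OF \<open>e > 0\<close>, of R] by blast
    have "((\<lambda>x::real. ln x / x) \<longlongrightarrow> 0) at_top" by real_asymp
    then have "\<forall>\<^sub>F x in at_top. ln x / x < \<delta>" using \<delta> by (rule order_tendstoD)
    then obtain x0 where x0: "\<And>x. x \<ge> x0 \<Longrightarrow> ln x / x < \<delta>" by (auto simp: eventually_at_top_linorder)
    have "filterlim (\<lambda>k. real k * \<eta>) at_top sequentially" using assms by real_asymp
    then have "\<forall>\<^sub>F k in sequentially. real k * \<eta> \<ge> max (max 1 y0) x0"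
      unfolding filterlim_at_top by blast
    then obtain k0 where k0: "\<And>k. k \<ge> k0 \<Longrightarrow> real k * \<eta> \<ge> max (max 1 y0) x0"
      by (auto simp: eventually_sequentially)
    define G where "G k = {p. (prime p \<and> real p \<le> exp (real k * \<eta>)) \<and> good R e p}" for k :: nat
    have fin_G: "finite (G k)" for k
      unfolding G_def by (rule finite_subset[OF _ finite_primes_upto[of "exp (real k * \<eta>)"]]) auto
    have cell: "(\<Sum>p\<in>G (Suc k) - G k. 1 / real p) \<le> 1 / 2 * (1 / real k)" if "k \<ge> k0" for k
    proof (cases "G (Suc k) - G k = {}")
      case False
      \<comment> \<open>Without an admissible pair, every other good prime of the cell lies
        logarithmically within \<open>h\<close> of the least one.\<close>
      define p where "p = Min (G (Suc k) - G k)"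
      have "p \<in> G (Suc k) - G k" unfolding p_def by (rule Min_in) (use False fin_G in auto)
      then have p: "prime p" "good R e p" "exp (real k * \<eta>) < real p" by (auto simp: G_def)
      have pos: "real p > 0" using p(1) by (simp add: prime_gt_0_nat)
      have kn: "real k * \<eta> \<ge> 1" "real k * \<eta> \<ge> y0" "real k * \<eta> \<ge> x0" using k0[OF that] by auto
      then have "k > 0" by (auto intro: Nat.gr0I)
      have lnp: "ln (real p) > real k * \<eta>" using p(3) pos ln_less_cancel_iff[of "exp (real k * \<eta>)" "real p"] by simp
      have sub: "G (Suc k) - G k \<subseteq> insert p {q. prime q \<and> exp (ln (real p)) < real q \<and> real q \<le> exp (ln (real p) + h)}"
      proof
        fix q assume q: "q \<in> G (Suc k) - G k"
        then have q': "prime q" "good R e q" "real q \<le> exp (real (Suc k) * \<eta>)" by (auto simp: G_def)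
        have posq: "real q > 0" using q'(1) by (simp add: prime_gt_0_nat)
        have "p \<le> q" unfolding p_def using q fin_G by simp
        have "ln (real q) \<le> real (Suc k) * \<eta>" using q'(3) posq ln_le_cancel_iff[of "real q" "exp (real (Suc k) * \<eta>)"] by (simp del: of_nat_Suc)
        then have "ln (real q) - ln (real p) \<le> \<eta>" using lnp by (simp add: algebra_simps)
        then have "\<not> h \<le> ln (real q) - ln (real p)"
          using no_pair p(1,2) q'(1,2) by blast
        then have "ln (real q) \<le> ln (real p) + h" by simp
        then have "real q \<le> exp (ln (real p) + h)" using posq exp_le_cancel_iff[of "ln (real q)" "ln (real p) + h"] by simp
        then show "q \<in> insert p {q. prime q \<and> exp (ln (real p)) < real q \<and> real q \<le> exp (ln (real p) + h)}"
          using \<open>p \<le> q\<close> q'(1) pos by auto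
      qed
      have fin: "finite {q. prime q \<and> exp (ln (real p)) < real q \<and> real q \<le> exp (ln (real p) + h)}"
        by (rule finite_subset[OF _ finite_primes_upto[of "exp (ln (real p) + h)"]]) auto
      have "(\<Sum>p\<in>G (Suc k) - G k. 1 / real p) \<le>
          (\<Sum>q\<in>insert p {q. prime q \<and> exp (ln (real p)) < real q \<and> real q \<le> exp (ln (real p) + h)}. 1 / real q)"
        by (rule sum_mono2) (use sub fin in auto)
      also have "\<dots> = 1 / real p + (\<Sum>q | prime q \<and> exp (ln (real p)) < real q \<and> real q \<le> exp (ln (real p) + h). 1 / real q)"
        using fin pos by simp
      also have "\<dots> \<le> \<delta> / ln (real p) + \<delta> / ln (real p)"
      proof (rule add_mono)
        show "(\<Sum>q | prime q \<and> exp (ln (real p)) < real q \<and> real q \<le> exp (ln (real p) + h). 1 / real q) \<le> \<delta> / ln (real p)"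
          by (rule y0) (use lnp kn in linarith)
        \<comment> \<open>The half-open interval in \<open>y0\<close> omits \<open>p\<close> itself,
          whose single term is covered by \<open>ln x / x < \<delta>\<close>.\<close>
        have "real p \<ge> x0" using kn(3) p(3) exp_ge_add_one_self[of "real k * \<eta>"] by linarith
        then have "ln (real p) / real p < \<delta>" by (rule x0)
        then show "1 / real p \<le> \<delta> / ln (real p)"
          using pos lnp kn(1) less_le_trans[of 0 1 "ln (real p)"] by (simp add: field_simps)
      qed
      also have "\<dots> = 2 * \<delta> / ln (real p)" by simp
      also have "\<dots> \<le> 2 * \<delta> / (real k * \<eta>)"
        using lnp kn(1) \<delta> assms \<open>k > 0\<close> by (intro divide_left_mono mult_pos_pos) auto
      also have "\<dots> = 1 / 2 * (1 / real k)" using assms \<open>k > 0\<close> by (simp add: \<delta>_def)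
      finally show ?thesis .
    next
      case True
      then show ?thesis by (simp only: sum.empty) simp
    qed
    define S where "S k = (\<Sum>p\<in>G k. 1 / real p)" for k
    have S_Suc: "S (Suc k) \<le> S k + 1 / 2 * (1 / real k)" if "k \<ge> k0" for k
    proof -
      have "G k \<subseteq> G (Suc k)"
        using assms by (auto simp: G_def intro: order.trans)
      then have "S (Suc k) = (\<Sum>p\<in>G (Suc k) - G k. 1 / real p) + S k"
        unfolding S_def by (intro sum.subset_diff fin_G)
      then show ?thesis using cell[OF that] by simp
    qed
    have S_le: "S (Suc K) \<le> S (Suc k0) + 1 / 2 * harm K" if "K \<ge> k0" for K
      using that
    proof (induction K rule: dec_induct)
      case base
      then show ?case by (simp add: harm_nonneg)
    next
      case (step K)
      have "harm (Suc K) = harm K + 1 / real (Suc K)"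
        by (simp only: harm_Suc inverse_eq_divide)
      then show ?case using S_Suc[of "Suc K"] step by linarith
    qed
    have harm_le: "harm (Suc K) \<le> 1 + ln (real (Suc K))" for K
      using decseqD[OF decseq_harm_diff_ln, of 0 K] by (simp add: harm_expand)
    \<comment> \<open>With \<open>l\<close> for \<open>ln (real (Suc K))\<close>, solving
      \<open>l + ln \<eta> - 2 \<le> S (Suc k0) + (1 + l) / 2 + B\<close> for \<open>l\<close> gives
      the bound \<open>2 * D\<close>.\<close>
    define D where "D = S (Suc k0) + B + 1 / 2 + 2 - ln \<eta>"
    have bound: "ln (real (Suc K)) \<le> 2 * D" if "Suc K \<ge> k0" "real (Suc (Suc K)) * \<eta> > 0" for K
    proof -
      let ?x = "exp (real (Suc (Suc K)) * \<eta>)"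
      define Bad where "Bad = {p. (prime p \<and> real p \<le> ?x) \<and> \<not> good R e p}"
      have "{p. prime p \<and> real p \<le> ?x} = G (Suc (Suc K)) \<union> Bad" by (auto simp: G_def Bad_def)
      moreover have "finite Bad" unfolding Bad_def by (rule finite_subset[OF _ finite_primes_upto[of ?x]]) auto
      moreover have "G (Suc (Suc K)) \<inter> Bad = {}" by (auto simp: G_def Bad_def)
      ultimately have "(\<Sum>p | prime p \<and> real p \<le> ?x. 1 / real p) = S (Suc (Suc K)) + (\<Sum>p\<in>Bad. 1 / real p)"
        unfolding S_def by (simp add: sum.union_disjoint fin_G)
      also have "(\<Sum>p\<in>Bad. 1 / real p) \<le> B" by (rule B) (use \<open>finite Bad\<close> in \<open>auto simp: Bad_def\<close>)
      also have "S (Suc (Suc K)) \<le> S (Suc k0) + 1 / 2 * (1 + ln (real (Suc K)))"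
        by (intro order.trans[OF S_le[OF that(1)]] add_left_mono mult_left_mono harm_le) simp
      finally have "(\<Sum>p | prime p \<and> real p \<le> ?x. 1 / real p) \<le> S (Suc k0) + 1 / 2 * (1 + ln (real (Suc K))) + B"
        by linarith
      moreover have "ln (real (Suc (Suc K)) * \<eta>) - 2 \<le> (\<Sum>p | prime p \<and> real p \<le> ?x. 1 / real p)"
        using sum_prime_reciprocals_ge[of ?x] that(2) by simp
      moreover have "ln (real (Suc (Suc K)) * \<eta>) = ln (real (Suc (Suc K))) + ln \<eta>"
        using assms by (simp add: ln_mult)
      moreover have "ln (real (Suc (Suc K))) \<ge> ln (real (Suc K))" by simp
      moreover have "l \<le> 2 * (s + B + 1 / 2 + 2 - e)"
        if "t \<le> s + 1 / 2 * (1 + l) + B" "l'' - 2 \<le> t" "l'' = l' + e" "l \<le> l'" for t l l' l'' s e :: real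
        using that by (simp add: field_simps)
      ultimately show ?thesis unfolding D_def by blast
    qed
    have "filterlim (\<lambda>K. ln (real (Suc K))) at_top sequentially" by real_asymp
    then have "\<forall>\<^sub>F K in sequentially. ln (real (Suc K)) > 2 * D" by (simp add: filterlim_at_top_dense)
    moreover have "\<forall>\<^sub>F K in sequentially. K \<ge> k0" by (rule eventually_ge_at_top)
    ultimately have "\<forall>\<^sub>F K in sequentially. ln (real (Suc K)) > 2 * D \<and> K \<ge> k0" by eventually_elim simp
    then obtain K where "ln (real (Suc K)) > 2 * D" "K \<ge> k0"
      using eventually_happens'[OF sequentially_bot] by blast
    then show False using bound[of K] assms by auto
  qed
qed

section \<open>Shift invariance of the two-point correlation\<close>

definition corr :: "real \<Rightarrow> real \<Rightarrow> complex" where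
  "corr u v = \<phi> u * cnj (\<phi> v)"

lemma corr_lipschitz: "norm (corr u v - corr u' v') \<le> 2 * \<bar>u - u'\<bar> + 2 * \<bar>v - v'\<bar>"
  unfolding corr_def using norm_mult_cnj_diff_le[OF norm_le_1 norm_le_1, of "\<phi> u" v u' "\<phi> v'"] lipschitz[of u u'] lipschitz[of v v'] by linarith

text \<open>The unknown factor disappears because \<open>g p * cnj (g p) = 1\<close>; each of the
  two arguments costs one \<open>e\<close>.\<close>

lemma corr_prime_shift:
  assumes "prime p" "good R e p" "\<bar>u\<bar> \<le> R" "\<bar>v\<bar> \<le> R"
  shows "norm (corr (u - ln (real p)) (v - ln (real p)) - corr u v) \<le> 2 * e"
proof -
  have "g p * cnj (g p) = 1"
    using norm_g[OF assms(1)] complex_norm_square[of "g p"] by simp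
  then have "corr (u - ln (real p)) (v - ln (real p)) =
     (g p * \<phi> (u - ln (real p))) * cnj (g p * \<phi> (v - ln (real p)))"
    by (simp add: corr_def mult_ac)
  also have "norm (\<dots> - corr u v) \<le> norm (g p * \<phi> (u - ln (real p)) - \<phi> u) + norm (g p * \<phi> (v - ln (real p)) - \<phi> v)"
    unfolding corr_def
    by (rule norm_mult_cnj_diff_le) (auto simp: norm_mult norm_g[OF assms(1)] norm_le_1)
  also have "\<dots> \<le> e + e" using assms(2-4) unfolding good_def by (intro add_mono) auto
  finally show ?thesis by simp
qed

text \<open>Comparing the shifts by two good primes gives the approximate period
  \<open>ln q - ln p\<close>. The window grows and the error shrinks with \<open>j\<close>, so a
  convergent subsequence yields an exact period. It is positive because all candidates lie in
  \<open>{h..\<eta>}\<close> with \<open>h\<close> independent of \<open>j\<close>.\<close>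

lemma corr_small_period:
  assumes "\<eta> > 0"
  shows "\<exists>s. 0 < s \<and> s \<le> \<eta> \<and> (\<forall>u v. corr (u - s) (v - s) = corr u v)"
proof -
  obtain h where h: "h > 0" and pairs: "\<And>R e. e > 0 \<Longrightarrow> \<exists>p q. prime p \<and> prime q \<and> good R e p \<and> good R e q \<and>
     h \<le> ln (real q) - ln (real p) \<and> ln (real q) - ln (real p) \<le> \<eta>"
    using ex_good_prime_pairs[OF assms] by blast
  have "\<forall>j. \<exists>s. s \<in> {h..\<eta>} \<and> (\<forall>u v. \<bar>u\<bar> + \<eta> \<le> real j \<longrightarrow> \<bar>v\<bar> + \<eta> \<le> real j \<longrightarrow>
      norm (corr (u - s) (v - s) - corr u v) \<le> 4 * (1 / real (Suc j)))"
  proof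
    fix j
    define e where "e = 1 / real (Suc j)"
    obtain p q where pq: "prime p" "prime q" "good (real j) e p" "good (real j) e q"
      "h \<le> ln (real q) - ln (real p)" "ln (real q) - ln (real p) \<le> \<eta>"
      using pairs[of e "real j"] by (auto simp: e_def)
    define s where "s = ln (real q) - ln (real p)"
    show "\<exists>s. s \<in> {h..\<eta>} \<and> (\<forall>u v. \<bar>u\<bar> + \<eta> \<le> real j \<longrightarrow> \<bar>v\<bar> + \<eta> \<le> real j \<longrightarrow>
      norm (corr (u - s) (v - s) - corr u v) \<le> 4 * (1 / real (Suc j)))"
      unfolding e_def[symmetric]
    proof (intro exI[of _ s] conjI allI impI)
      fix u v assume uv: "\<bar>u\<bar> + \<eta> \<le> real j" "\<bar>v\<bar> + \<eta> \<le> real j"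
      have "\<bar>u - s\<bar> \<le> real j" "\<bar>v - s\<bar> \<le> real j" "\<bar>u\<bar> \<le> real j" "\<bar>v\<bar> \<le> real j"
        using uv pq(5,6) h by (auto simp: s_def)
      note a = corr_prime_shift[OF pq(1,3) this(1,2)] and b = corr_prime_shift[OF pq(2,4) this(3,4)]
      have "corr (u - s - ln (real p)) (v - s - ln (real p)) = corr (u - ln (real q)) (v - ln (real q))"
        by (simp add: s_def)
      then have "norm (corr (u - s) (v - s) - corr u v)
        \<le> norm (corr (u - ln (real q)) (v - ln (real q)) - corr (u - s) (v - s))
          + norm (corr (u - ln (real q)) (v - ln (real q)) - corr u v)"
        using norm_triangle_ineq[of "corr (u - s) (v - s) - corr (u - ln (real q)) (v - ln (real q))"
          "corr (u - ln (real q)) (v - ln (real q)) - corr u v"] by (simp add: norm_minus_commute)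
      then show "norm (corr (u - s) (v - s) - corr u v) \<le> 4 * e"
        using a b \<open>corr (u - s - _) _ = _\<close> by simp
    qed (use pq in \<open>simp add: s_def\<close>)
  qed
  from choice[OF this] obtain s where s: "\<And>j. s j \<in> {h..\<eta>}"
    "\<And>j u v. \<bar>u\<bar> + \<eta> \<le> real j \<Longrightarrow> \<bar>v\<bar> + \<eta> \<le> real j \<Longrightarrow>
      norm (corr (u - s j) (v - s j) - corr u v) \<le> 4 * (1 / real (Suc j))" by blast
  obtain l r where l: "l \<in> {h..\<eta>}" "strict_mono (r :: nat \<Rightarrow> nat)" "(s \<circ> r) \<longlonglongrightarrow> l"
    using compact_Icc[of h \<eta>] s(1) unfolding compact_def by metis
  have "corr (u - l) (v - l) = corr u v" for u v
  proof -
    have lim: "(\<lambda>j. corr (u - s (r j)) (v - s (r j)) - corr u v) \<longlonglongrightarrow> 0"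
    proof (rule Lim_null_comparison)
      have "\<forall>\<^sub>F j in sequentially. real j \<ge> max (\<bar>u\<bar> + \<eta>) (\<bar>v\<bar> + \<eta>)"
        by (rule eventually_ge_at_top[THEN eventually_compose_filterlim, OF filterlim_real_sequentially])
      then show "\<forall>\<^sub>F j in sequentially. norm (corr (u - s (r j)) (v - s (r j)) - corr u v) \<le> 4 * (1 / real (Suc j))"
      proof eventually_elim
        case (elim j)
        have rj: "j \<le> r j" by (rule seq_suble[OF l(2)])
        then have "norm (corr (u - s (r j)) (v - s (r j)) - corr u v) \<le> 4 * (1 / real (Suc (r j)))"
          using elim by (intro s(2)) auto
        also have "\<dots> \<le> 4 * (1 / real (Suc j))" using rj by (simp add: frac_le)
        finally show ?case .
      qed
      show "(\<lambda>j. 4 * (1 / real (Suc j))) \<longlonglongrightarrow> 0" by real_asymp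
    qed
    have "(\<lambda>j. corr (u - s (r j)) (v - s (r j)) - corr (u - l) (v - l)) \<longlonglongrightarrow> 0"
    proof (rule Lim_null_comparison)
      show "\<forall>\<^sub>F j in sequentially. norm (corr (u - s (r j)) (v - s (r j)) - corr (u - l) (v - l)) \<le> 4 * \<bar>s (r j) - l\<bar>"
      proof (rule always_eventually, rule allI)
        fix j
        show "norm (corr (u - s (r j)) (v - s (r j)) - corr (u - l) (v - l)) \<le> 4 * \<bar>s (r j) - l\<bar>"
          using corr_lipschitz[of "u - s (r j)" "v - s (r j)" "u - l" "v - l"] by (simp add: abs_minus_commute)
      qed
      have "(\<lambda>j. 4 * \<bar>(s \<circ> r) j - l\<bar>) \<longlonglongrightarrow> 4 * \<bar>l - l\<bar>" by (intro tendsto_intros l)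
      then show "(\<lambda>j. 4 * \<bar>s (r j) - l\<bar>) \<longlonglongrightarrow> 0" by simp
    qed
    from tendsto_diff[OF lim this] have "(\<lambda>j. corr (u - l) (v - l) - corr u v) \<longlonglongrightarrow> 0"
      by simp
    then show ?thesis by (simp add: LIMSEQ_const_iff)
  qed
  then show ?thesis using l(1) h by (intro exI[of _ l]) auto
qed

text \<open>Multiples of a small period \<open>t\<close> come within \<open>t\<close> of any real
  \<open>s\<close>, and the Lipschitz bound turns this into an error of at most
  \<open>4 * t\<close>.\<close>

lemma corr_shift: "corr (u - s) (v - s) = corr u v"
proof -
  have "norm (corr (u - s) (v - s) - corr u v) \<le> e" if "e > 0" for e
  proof -
    obtain t where t: "0 < t" "t \<le> e / 4" and per: "\<And>u v. corr (u - t) (v - t) = corr u v"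
      using corr_small_period[of "e / 4"] \<open>e > 0\<close> by auto
    have per_int: "corr (u - of_int n * t) (v - of_int n * t) = corr u v" for n :: int and u v
    proof (induction n rule: int_induct[where k = 0])
      case (step1 n)
      then show ?case using per[of "u - of_int n * t" "v - of_int n * t"] by (simp add: algebra_simps)
    next
      case (step2 n)
      then show ?case using per[of "u - of_int (n - 1) * t" "v - of_int (n - 1) * t"] by (simp add: algebra_simps)
    qed simp
    define n where "n = \<lfloor>s / t\<rfloor>"
    have "of_int n \<le> s / t" "s / t < of_int n + 1" by (simp_all add: n_def)
    then have n: "0 \<le> s - of_int n * t" "s - of_int n * t \<le> t" using t(1) by (simp_all add: field_simps)
    have "norm (corr (u - s) (v - s) - corr (u - of_int n * t) (v - of_int n * t)) \<le> 4 * t"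
      using corr_lipschitz[of "u - s" "v - s" "u - of_int n * t" "v - of_int n * t"] n by (simp add: algebra_simps)
    then show ?thesis unfolding per_int using t(2) by simp
  qed
  then have "norm (corr (u - s) (v - s) - corr u v) \<le> 0 + e" if "e > 0" for e
    using that by (simp only: add_0)
  then have "norm (corr (u - s) (v - s) - corr u v) \<le> 0" by (rule field_le_epsilon)
  then show ?thesis by simp
qed

text \<open>Equal arguments in \<open>corr_shift\<close> make the modulus of \<open>\<phi>\<close>
  constant; shifting by \<open>v\<close> gives
  \<open>\<psi> u * cnj (\<psi> v) = \<psi> (u - v)\<close>, so the normalised profile is a
  homomorphism into the circle. At \<open>u = 0\<close>, \<open>relation\<close> then measures the
  distance of \<open>g p\<close> from \<open>\<kappa> p\<close>.\<close>

lemma ex_character: "\<exists>\<kappa>. archimedean_character \<kappa> \<and> pretends g \<kappa>"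
proof -
  define c where "c = norm (\<phi> 0)"
  have c: "c > 0" using nonzero by (simp add: c_def)
  define \<psi> where "\<psi> u = \<phi> u / \<phi> 0" for u
  have abs: "norm (\<phi> u) = c" for u
  proof -
    have "of_real ((norm (\<phi> u))\<^sup>2) = (of_real (c\<^sup>2) :: complex)"
      using corr_shift[of u u u] unfolding complex_norm_square c_def by (simp add: corr_def)
    then have "(norm (\<phi> u))\<^sup>2 = c\<^sup>2" by (simp only: of_real_eq_iff)
    then show ?thesis using c by (simp add: power2_eq_iff_nonneg)
  qed
  have norm_\<psi>: "norm (\<psi> u) = 1" for u
    using c by (simp add: \<psi>_def norm_divide abs)
  have \<psi>_cnj: "\<psi> u * cnj (\<psi> u) = 1" for u
    using norm_\<psi>[of u] complex_norm_square[of "\<psi> u"] by simp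
  have \<psi>_diff: "\<psi> u * cnj (\<psi> v) = \<psi> (u - v)" for u v
    using corr_shift[of u v v] nonzero by (simp add: corr_def \<psi>_def field_simps)
  have \<psi>_0: "\<psi> 0 = 1" using nonzero by (simp add: \<psi>_def)
  have \<psi>_add: "\<psi> (u + v) = \<psi> u * \<psi> v" for u v
  proof -
    have "\<psi> (u + v) = \<psi> (u + v) * (cnj (\<psi> v) * \<psi> v)" using \<psi>_cnj[of v] by (simp add: mult.commute)
    also have "\<dots> = \<psi> u * \<psi> v" using \<psi>_diff[of "u + v" v] by (simp add: mult.assoc[symmetric])
    finally show ?thesis .
  qed
  have \<psi>_neg: "\<psi> (- u) = cnj (\<psi> u)" for u
    using \<psi>_diff[of 0 u] \<psi>_0 by simp
  define \<kappa> where "\<kappa> n = \<psi> (ln (real n))" for n :: nat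
  have "archimedean_character \<kappa>"
    unfolding archimedean_character_def
  proof (intro conjI allI impI exI)
    fix n :: nat assume n: "n > 0"
    show "norm (\<kappa> n) = 1" by (simp add: \<kappa>_def norm_\<psi>)
    have "norm (\<kappa> (Suc n) - \<kappa> n) = norm (\<phi> (ln (real (Suc n))) - \<phi> (ln (real n))) / c"
      by (simp add: \<kappa>_def \<psi>_def c_def norm_divide flip: diff_divide_distrib)
    also have "\<dots> \<le> 2 * \<bar>ln (real (Suc n)) - ln (real n)\<bar> / c"
      using c by (intro divide_right_mono lipschitz) simp
    also have "ln (real (Suc n)) - ln (real n) = ln (1 + 1 / real n)"
    proof -
      have "1 + 1 / real n = real (Suc n) / real n" using n by (simp add: field_simps)
      then show ?thesis using n by (simp only: ln_divide_pos of_nat_0_less_iff zero_less_Suc)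
    qed
    also have "\<bar>\<dots>\<bar> \<le> 1 / real n" using n ln_add_one_self_le_self2[of "1 / real n"] ln_ge_zero[of "1 + 1 / real n"]
      by (simp add: less_le_trans[of "-1" 0])
    finally show "norm (\<kappa> (Suc n) - \<kappa> n) \<le> (2 / c) / real n"
      using c by (simp add: field_simps)
  next
    fix m n :: nat assume "m > 0" "n > 0"
    then show "\<kappa> (m * n) = \<kappa> m * \<kappa> n" by (simp add: \<kappa>_def ln_mult \<psi>_add)
  qed
  moreover have "pretends g \<kappa>"
    unfolding pretends_def
  proof (intro exI allI impI)
    fix P :: "nat set" assume P: "finite P" "\<forall>p\<in>P. prime p"
    have "norm (g p - \<kappa> p) = norm (g p * \<phi> (0 - ln (real p)) - \<phi> 0) / c" for p
    proof -
      have "(g p * \<phi> (0 - ln (real p)) - \<phi> 0) / \<phi> 0 = g p * \<psi> (- ln (real p)) - 1"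
        using nonzero by (simp add: \<psi>_def diff_divide_distrib)
      also have "\<dots> = (g p - \<kappa> p) * cnj (\<kappa> p)"
        by (simp add: \<kappa>_def \<psi>_neg \<psi>_cnj left_diff_distrib)
      finally have "norm ((g p * \<phi> (0 - ln (real p)) - \<phi> 0) / \<phi> 0) = norm (g p - \<kappa> p)"
        by (simp add: norm_mult \<kappa>_def norm_\<psi>)
      then show ?thesis by (simp add: norm_divide c_def)
    qed
    then have "(\<Sum>p\<in>P. (norm (g p - \<kappa> p))\<^sup>2 / real p)
        = (\<Sum>p\<in>P. (norm (g p * \<phi> (0 - ln (real p)) - \<phi> 0))\<^sup>2 / real p) / c\<^sup>2"
      by (simp add: power_divide sum_divide_distrib mult.commute)
    also have "\<dots> \<le> C / c\<^sup>2" by (intro divide_right_mono relation) (use P in auto)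
    finally show "(\<Sum>p\<in>P. (norm (g p - \<kappa> p))\<^sup>2 / real p) \<le> C / c\<^sup>2" .
  qed
  ultimately show ?thesis by blast
qed

end

theorem (in unimodular_multiplicative) pretends_if_mean_not_tendsto_0:
  assumes "\<not> (\<lambda>N. mean_upto g (real N)) \<longlonglongrightarrow> 0"
  shows "\<exists>\<kappa>. archimedean_character \<kappa> \<and> pretends g \<kappa>"
proof -
  obtain X \<phi> where X: "filterlim X at_top sequentially" "\<And>u. (\<lambda>j. mean_upto g (X j * exp u)) \<longlonglongrightarrow> \<phi> u"
    and \<phi>: "\<And>u v. norm (\<phi> u - \<phi> v) \<le> 2 * \<bar>u - v\<bar>" "\<And>u. norm (\<phi> u) \<le> 1" "\<phi> 0 \<noteq> 0"
    using obtain_mean_profile[OF norm_le_1 assms] by metis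
  \<comment> \<open>\<open>9 = 1 + 8 * 1\<close>, the sum of \<open>1 / p ^ 2\<close> being at most
    1.\<close>
  interpret prime_profile g \<phi> 9
  proof
    fix P :: "nat set" and u :: real
    assume P: "finite P" "\<And>p. p \<in> P \<Longrightarrow> prime p"
    have "(\<Sum>p\<in>P. (norm (g p * \<phi> (u - ln (real p)) - \<phi> u))\<^sup>2 / real p) \<le> 1 + 8 * (\<Sum>p\<in>P. 1 / real p ^ 2)"
      by (rule profile_prime_relation[OF X P])
    also have "\<dots> \<le> 9"
      using sum_inverse_squares_le[OF P(1)] P(2) prime_ge_2_nat by auto
    finally show "(\<Sum>p\<in>P. (norm (g p * \<phi> (u - ln (real p)) - \<phi> u))\<^sup>2 / real p) \<le> 9" .
  qed (use \<phi> norm_eq_1 prime_gt_0_nat in auto)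
  show ?thesis by (rule ex_character)
qed

section \<open>A converse via Euler products\<close>

lemma archimedean_characterD:
  assumes "archimedean_character \<kappa>"
  shows "n > 0 \<Longrightarrow> norm (\<kappa> n) = 1" "m > 0 \<Longrightarrow> n > 0 \<Longrightarrow> \<kappa> (m * n) = \<kappa> m * \<kappa> n"
  using assms by (auto simp: archimedean_character_def)

lemma powr_neg_diff_le:
  assumes "n > 0" "s > 0"
  shows "0 \<le> real n powr (-s) - real (Suc n) powr (-s)"
    "real n powr (-s) - real (Suc n) powr (-s) \<le> s * (real n powr (-s) / real n)"
proof -
  show "0 \<le> real n powr (-s) - real (Suc n) powr (-s)"
    using assms by (simp add: powr_mono2')
  have "real (Suc n) = real n * (1 + 1 / real n)" using assms by (simp add: field_simps)
  then have "real (Suc n) powr (-s) = real n powr (-s) * (1 + 1 / real n) powr (-s)"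
    by (simp only:) (rule powr_mult)
  moreover have "(1 + 1 / real n) powr (-s) \<ge> 1 - s / real n"
  proof -
    have "ln (1 + 1 / real n) \<le> 1 / real n"
      using assms by (intro ln_add_one_self_le_self) simp
    then have "s * ln (1 + 1 / real n) \<le> s * (1 / real n)" using assms by (intro mult_left_mono) auto
    then have "1 - s / real n \<le> 1 + (- s * ln (1 + 1 / real n))" by simp
    also have "\<dots> \<le> exp (- s * ln (1 + 1 / real n))" by (rule exp_ge_add_one_self)
    also have "\<dots> = (1 + 1 / real n) powr (-s)"
    proof -
      have "1 + 1 / real n \<noteq> 0" using assms by (simp add: add_pos_pos less_imp_neq[symmetric])
      then show ?thesis by (simp add: powr_def)
    qed
    finally show ?thesis .
  qed
  ultimately have "real (Suc n) powr (-s) \<ge> real n powr (-s) * (1 - s / real n)"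
    by (simp add: mult_left_mono)
  then show "real n powr (-s) - real (Suc n) powr (-s) \<le> s * (real n powr (-s) / real n)"
    by (simp add: algebra_simps)
qed

lemma abel_summation:
  fixes g b :: "nat \<Rightarrow> complex"
  shows "(\<Sum>n\<in>{1..N}. g n * b n) = sum g {1..N} * b (Suc N) + (\<Sum>n\<in>{1..N}. sum g {1..n} * (b n - b (Suc n)))"
  by (induction N) (auto simp: algebra_simps)

text \<open>Partial summation: the weight changes by at most
  \<open>(L + 2) * n powr (-s) / n\<close> per step, with \<open>L\<close> from the character and
  \<open>s \<le> 2\<close> from the power. The bound is a multiple of \<open>e\<close> times a
  partial sum of zeta, plus a constant independent of \<open>s\<close> and \<open>N\<close>.\<close>

lemma sum_twisted_le:
  assumes \<kappa>: "archimedean_character \<kappa>" and L: "\<forall>n>0. norm (\<kappa> (Suc n) - \<kappa> n) \<le> L / real n"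
    and S: "\<And>n. norm (sum g {1..n}) \<le> e * real n + D" and "e \<ge> 0" "D \<ge> 0" and s: "1 < s" "s \<le> 2"
  shows "norm (\<Sum>n\<in>{1..N}. g n * (cnj (\<kappa> n) * of_real (real n powr (-s))))
    \<le> e + D + (L + 2) * (e * (\<Sum>n\<in>{1..N}. real n powr (-s)) + 2 * D)"
proof -
  define b where "b n = cnj (\<kappa> n) * of_real (real n powr (-s))" for n
  have L0: "L \<ge> 0" using L[rule_format, of 1] by (simp add: order.trans[OF norm_ge_zero])
  have b_le: "norm (b n) \<le> 1 / real n" if "n > 0" for n
  proof -
    have "norm (b n) = real n powr (-s)"
      using archimedean_characterD(1)[OF \<kappa> that] by (simp add: b_def norm_mult)
    also have "\<dots> \<le> real n powr (-1)" using s that by (intro powr_mono) auto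
    finally show ?thesis using that by (simp add: powr_minus_divide)
  qed
  have b_diff: "norm (b n - b (Suc n)) \<le> (L + 2) * (real n powr (-s) / real n)" if "n > 0" for n
  proof -
    note d = powr_neg_diff_le[OF that, of s]
    have "b n - b (Suc n) = cnj (\<kappa> n) * of_real (real n powr (-s) - real (Suc n) powr (-s))
       - cnj (\<kappa> (Suc n) - \<kappa> n) * of_real (real (Suc n) powr (-s))"
      by (simp add: b_def algebra_simps)
    then have "norm (b n - b (Suc n)) \<le> norm (cnj (\<kappa> n) * of_real (real n powr (-s) - real (Suc n) powr (-s)))
       + norm (cnj (\<kappa> (Suc n) - \<kappa> n) * of_real (real (Suc n) powr (-s)))"
      by (simp only: norm_triangle_ineq4)
    also have "\<dots> = (real n powr (-s) - real (Suc n) powr (-s)) + norm (\<kappa> (Suc n) - \<kappa> n) * real (Suc n) powr (-s)"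
      using archimedean_characterD(1)[OF \<kappa> that] d(1) s
      unfolding norm_mult complex_mod_cnj norm_of_real by simp
    also have "\<dots> \<le> s * (real n powr (-s) / real n) + L / real n * real n powr (-s)"
      using d s L that L0 by (intro add_mono mult_mono) auto
    also have "\<dots> = (L + s) * (real n powr (-s) / real n)" by (simp add: algebra_simps add_divide_distrib)
    also have "\<dots> \<le> (L + 2) * (real n powr (-s) / real n)" using s by (intro mult_right_mono) auto
    finally show ?thesis .
  qed
  have "(\<Sum>n\<in>{1..N}. 1 / real n ^ 2) \<le> 2"
  proof (cases "N = 0")
    case False
    then have "{1..N} = insert 1 {2..N}" by auto
    then have "(\<Sum>n\<in>{1..N}. 1 / real n ^ 2) = 1 + (\<Sum>n\<in>{2..N}. 1 / real n ^ 2)" by (simp only:) simp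
    moreover have "(\<Sum>n\<in>{2..N}. 1 / real n ^ 2) \<le> 1"
      by (rule sum_inverse_squares_le) auto
    ultimately show ?thesis by linarith
  qed auto
  note squares = this
  have summand: "norm (sum g {1..n} * (b n - b (Suc n))) \<le> (L + 2) * (e * real n powr (-s) + D * (1 / real n ^ 2))"
    if "n \<in> {1..N}" for n
  proof -
    have n: "n > 0" using that by simp
    have "real n powr (-s) / real n \<le> real n powr (-1) / real n"
      using s n by (intro divide_right_mono powr_mono) auto
    then have sq: "real n powr (-s) / real n \<le> 1 / real n ^ 2"
      using n by (simp add: powr_minus_divide power2_eq_square)
    have "norm (sum g {1..n} * (b n - b (Suc n))) \<le> (e * real n + D) * ((L + 2) * (real n powr (-s) / real n))"
      unfolding norm_mult using S[of n] b_diff[OF n] assms(4,5) by (intro mult_mono) auto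
    also have "\<dots> = (L + 2) * (e * real n powr (-s) + D * (real n powr (-s) / real n))"
      using n by (simp add: field_simps)
    also have "\<dots> \<le> (L + 2) * (e * real n powr (-s) + D * (1 / real n ^ 2))"
      using L0 sq assms(4,5) by (intro mult_left_mono add_mono) auto
    finally show ?thesis .
  qed
  have "norm (\<Sum>n\<in>{1..N}. g n * b n) \<le> norm (sum g {1..N} * b (Suc N)) + norm (\<Sum>n\<in>{1..N}. sum g {1..n} * (b n - b (Suc n)))"
    unfolding abel_summation[of g b N] by (rule norm_triangle_ineq)
  also have "norm (sum g {1..N} * b (Suc N)) \<le> (e * real N + D) * (1 / real (Suc N))"
    unfolding norm_mult using S[of N] b_le[of "Suc N"] assms(4,5) by (intro mult_mono) auto
  also have "\<dots> \<le> e + D" using assms(4,5) by (simp add: field_simps)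
  also have "norm (\<Sum>n\<in>{1..N}. sum g {1..n} * (b n - b (Suc n)))
     \<le> (\<Sum>n\<in>{1..N}. (L + 2) * (e * real n powr (-s) + D * (1 / real n ^ 2)))"
    by (rule sum_norm_le) (rule summand)
  also have "\<dots> = (L + 2) * (e * (\<Sum>n\<in>{1..N}. real n powr (-s)) + D * (\<Sum>n\<in>{1..N}. 1 / real n ^ 2))"
    by (simp only: sum_distrib_left[symmetric] sum.distrib)
  also have "\<dots> \<le> (L + 2) * (e * (\<Sum>n\<in>{1..N}. real n powr (-s)) + 2 * D)"
    using L0 squares assms(5) by (intro mult_left_mono add_left_mono) (auto simp: mult.commute mult_left_mono)
  finally show ?thesis by (simp add: b_def)
qed

section \<open>Lower bounds for Euler factors and Euler products\<close>

lemma euler_factor_lower_bound: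
  fixes h :: "nat \<Rightarrow> complex" and y :: real
  assumes h: "h 0 = 1" "\<And>j. norm (h j) = 1" and y: "0 < y" "y < 1"
  shows "norm (\<Sum>j. h j * of_real (y ^ j)) * (1 - y) \<ge> (1 - y) * (1 + Re (h 1) * y) - y\<^sup>2"
proof -
  have summ: "summable (\<lambda>j. norm (h j * of_real (y ^ j)))"
    using y by (simp add: norm_mult h norm_power)
  then have summ': "summable (\<lambda>j. h j * of_real (y ^ j))" by (rule summable_norm_cancel)
  \<comment> \<open>Only the terms of index 0 and 1 are controlled; the others are bounded by the
    geometric series \<open>y\<^sup>2 / (1 - y)\<close>. Multiplying by \<open>1 - y\<close> clears
    the denominator and is also division by the corresponding zeta factor.\<close>
  define T where "T = (\<Sum>j. h (j + 2) * of_real (y ^ (j + 2)))"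
  have "norm T \<le> (\<Sum>j. norm (h (j + 2) * of_real (y ^ (j + 2))))"
    unfolding T_def by (rule summable_norm) (rule summable_ignore_initial_segment[OF summ])
  also have "\<dots> = (\<Sum>j. y\<^sup>2 * y ^ j)"
    using y by (simp add: norm_mult h norm_power power2_eq_square mult_ac)
  also have "\<dots> = y\<^sup>2 / (1 - y)"
    using y by (simp add: suminf_mult suminf_geometric summable_geometric)
  finally have T: "norm T * (1 - y) \<le> y\<^sup>2" using y by (simp add: field_simps)
  have "(\<Sum>j. h j * of_real (y ^ j)) = T + (\<Sum>j<2. h j * of_real (y ^ j))"
    unfolding T_def by (rule suminf_split_initial_segment[OF summ'])
  then have "Re (\<Sum>j. h j * of_real (y ^ j)) = Re T + 1 + Re (h 1) * y"
    by (simp add: numeral_2_eq_2 h)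
  then have "norm (\<Sum>j. h j * of_real (y ^ j)) \<ge> 1 + Re (h 1) * y - norm T"
    using complex_Re_le_cmod[of "\<Sum>j. h j * of_real (y ^ j)"] abs_Re_le_cmod[of T] by linarith
  then have "norm (\<Sum>j. h j * of_real (y ^ j)) * (1 - y) \<ge> (1 + Re (h 1) * y - norm T) * (1 - y)"
    using y by (intro mult_right_mono) auto
  moreover have "(1 + Re (h 1) * y - norm T) * (1 - y) = (1 - y) * (1 + Re (h 1) * y) - norm T * (1 - y)"
    by (simp add: algebra_simps)
  ultimately show ?thesis using T by linarith
qed

text \<open>To be applied to \<open>h n = g n * cnj (\<kappa> n)\<close>. Without
  \<open>Re_2\<close>, the lower bound at the prime 2 would be \<open>1 - 2 * y\<close>, which
  degenerates as \<open>y\<close> approaches \<open>1 / 2\<close>.\<close>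

locale pretentious_to_1 = unimodular_multiplicative h for h +
  fixes B :: real
  assumes bound: "finite P \<Longrightarrow> (\<And>p. p \<in> P \<Longrightarrow> prime p) \<Longrightarrow> (\<Sum>p\<in>P. (norm (h p - 1))\<^sup>2 / real p) \<le> B"
    and Re_2: "Re (h 2) \<ge> 0"
begin

lemma at_1: "h 1 = 1"
proof -
  have "h 1 = h 1 * h 1" using mult_coprime[of 1 1] by simp
  moreover have "h 1 \<noteq> 0" using norm_eq_1[of 1] by auto
  ultimately show ?thesis by simp
qed

text \<open>For \<open>p \<ge> 5\<close> the factor is at least \<open>1 - E\<close> with
  \<open>E \<le> 1 / 2\<close>, hence at least \<open>exp (- (2 * E))\<close>, and for unimodular
  \<open>h p\<close> the exponent \<open>2 * E\<close> is the stated one. The primes 2 and 3 are too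
  small for this and get the constant \<open>1 / 4\<close>, which exceeds
  \<open>exp (-2)\<close>.\<close>

lemma euler_factor_ge:
  assumes p: "prime p" and s: "s > 1"
  defines "y \<equiv> real p powr (-s)"
  shows "norm (\<Sum>j. h (p ^ j) * of_real (y ^ j)) * (1 - y)
     \<ge> exp (- ((norm (h p - 1))\<^sup>2 / real p + 4 * (1 / real p ^ 2) + (if p < 5 then 2 else 0)))"
proof -
  have p2: "real p \<ge> 2" using prime_ge_2_nat[OF p] by simp
  have "y \<le> real p powr (-1)" unfolding y_def using s p2 by (intro powr_mono) auto
  then have y: "0 < y" "y \<le> 1 / real p" using p2 by (auto simp: y_def powr_minus_divide)
  have "1 / real p \<le> 1 / 2" using p2 by (simp add: field_simps)
  then have y2: "y \<le> 1 / 2" using y by linarith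
  have "norm (\<Sum>j. h (p ^ j) * of_real (y ^ j)) * (1 - y) \<ge> (1 - y) * (1 + Re (h (p ^ 1)) * y) - y\<^sup>2"
    by (rule euler_factor_lower_bound) (use at_1 y y2 p2 norm_eq_1 in auto)
  then have r: "norm (\<Sum>j. h (p ^ j) * of_real (y ^ j)) * (1 - y) \<ge> (1 - y) * (1 + Re (h p) * y) - y\<^sup>2"
    by simp
  have nh: "norm (h p) = 1" using p2 by (intro norm_eq_1) auto
  have Re_h: "- 1 \<le> Re (h p)" "Re (h p) \<le> 1" using abs_Re_le_cmod[of "h p"] nh by auto
  have sq: "(norm (h p - 1))\<^sup>2 = 2 - 2 * Re (h p)"
  proof -
    have "(Re (h p))\<^sup>2 + (Im (h p))\<^sup>2 = 1" using nh by (simp add: cmod_def)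
    then show ?thesis unfolding cmod_power2 by (simp add: power2_eq_square algebra_simps)
  qed
  show ?thesis
  proof (cases "p < 5")
    case True
    moreover have "p \<noteq> 4" using p by auto
    ultimately have "p = 2 \<or> p = 3" using prime_ge_2_nat[OF p] by arith
    then consider "p = 2" | "p = 3" by blast
    then have "(1 - y) * (1 + Re (h p) * y) - y\<^sup>2 \<ge> 1 / 4"
    proof cases
      case 1
      then have "(1 - y) * (1 + Re (h p) * y) \<ge> (1 - y) * 1"
        using Re_2 y y2 by (intro mult_left_mono) auto
      moreover have "y\<^sup>2 \<le> (1 / 2)\<^sup>2" using y y2 by (intro power_mono) auto
      moreover have "a - b \<ge> 1 / 4" if "a \<ge> (1 - y) * 1" "b \<le> (1 / 2)\<^sup>2" for a b :: real
        using that y2 by (simp add: power2_eq_square)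
      ultimately show ?thesis by blast
    next
      case 2
      have "(-1) * y \<le> Re (h p) * y" using Re_h y by (intro mult_right_mono) auto
      then have "(1 - y) * (1 + Re (h p) * y) \<ge> (1 - y) * (1 - y)"
        using y2 by (intro mult_left_mono) auto
      moreover have "y \<le> 1 / 3" using y 2 by simp
      moreover have "a - y\<^sup>2 \<ge> 1 / 4" if "a \<ge> (1 - y) * (1 - y)" "y \<le> 1 / 3" for a :: real
        using that by (simp add: power2_eq_square algebra_simps)
      ultimately show ?thesis by blast
    qed
    moreover have "exp (- ((norm (h p - 1))\<^sup>2 / real p + 4 * (1 / real p ^ 2) + (if p < 5 then 2 else 0))) \<le> exp (-2 :: real)"
    proof -
      have "0 \<le> (norm (h p - 1))\<^sup>2 / real p" "0 \<le> 4 * (1 / real p ^ 2)" by simp_all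
      moreover have "- (a + b + 2) \<le> - 2" if "0 \<le> a" "0 \<le> b" for a b :: real
        using that by simp
      ultimately show ?thesis unfolding exp_le_cancel_iff if_P[OF True] by blast
    qed
    moreover have "exp (-2 :: real) \<le> 1 / 4"
    proof -
      have "(2::real) \<le> exp 1" using exp_ge_add_one_self[of 1] by simp
      then have "2 * 2 \<le> exp 1 * exp (1::real)" by (intro mult_mono) auto
      then show ?thesis by (simp add: exp_minus mult_exp_exp field_simps)
    qed
    ultimately show ?thesis using r by linarith
  next
    case False
    define E where "E = (1 - Re (h p)) / real p + 2 * (1 / real p ^ 2)"
    have "1 - E \<le> 1 - (1 - Re (h p)) * y - 2 * y\<^sup>2"
    proof -
      have "y\<^sup>2 \<le> (1 / real p)\<^sup>2" using y by (intro power_mono) auto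
      moreover have "(1 - Re (h p)) * y \<le> (1 - Re (h p)) * (1 / real p)"
        using y Re_h by (intro mult_left_mono) auto
      ultimately show ?thesis by (simp add: E_def power_one_over)
    qed
    also have "\<dots> \<le> (1 - y) * (1 + Re (h p) * y) - y\<^sup>2"
    proof -
      have "Re (h p) * y\<^sup>2 \<le> 1 * y\<^sup>2" using Re_h by (intro mult_right_mono) auto
      then show ?thesis by (simp add: algebra_simps power2_eq_square)
    qed
    finally have rE: "norm (\<Sum>j. h (p ^ j) * of_real (y ^ j)) * (1 - y) \<ge> 1 - E" using r by linarith
    have p5: "real p \<ge> 5" using False by simp
    have "(1 - Re (h p)) / real p \<le> 2 / 5"
      using Re_h p5 by (intro frac_le) auto
    moreover have "1 / real p ^ 2 \<le> 1 / 5 ^ 2"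
      using p5 by (intro frac_le power_mono) auto
    ultimately have "E \<le> 2 / 5 + 2 * (1 / 5 ^ 2)"
      unfolding E_def by (intro add_mono mult_left_mono) auto
    then have "E \<le> 1 / 2" by (simp add: power2_eq_square)
    moreover have "E \<ge> 0" using Re_h by (simp add: E_def)
    ultimately have "ln (1 - E) \<ge> - E - 2 * E\<^sup>2" "E * E \<le> 1 / 2 * E"
      by (simp_all only: ln_one_minus_pos_lower_bound mult_right_mono)
    moreover from this(2) have "2 * E\<^sup>2 \<le> E" by (simp add: power2_eq_square)
    ultimately have "- (2 * E) \<le> ln (1 - E)" by linarith
    then have exp_le: "exp (- (2 * E)) \<le> 1 - E"
      using \<open>E \<le> 1 / 2\<close> exp_le_cancel_iff[of "- (2 * E)" "ln (1 - E)"] by simp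
    have eq: "2 * E = (norm (h p - 1))\<^sup>2 / real p + 4 * (1 / real p ^ 2) + (if p < 5 then 2 else 0)"
      using False p5 by (simp add: E_def sq field_simps)
    from order.trans[OF exp_le rE] show ?thesis unfolding eq .
  qed
qed

text \<open>\<open>14 = 4 + 10\<close>: four times the sum of \<open>1 / p ^ 2\<close>, plus 2 for
  each of the five numbers below 5. The loss against the zeta product depends on neither
  \<open>P\<close> nor \<open>s\<close>.\<close>

lemma euler_product_ge:
  assumes P: "finite P" "\<And>p. p \<in> P \<Longrightarrow> prime p" and s: "s > 1"
  shows "norm (\<Prod>p\<in>P. \<Sum>j. h (p ^ j) * of_real ((real p powr (-s)) ^ j))
    \<ge> exp (- (B + 14)) * (\<Prod>p\<in>P. 1 / (1 - real p powr (-s)))"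
proof -
  define w where "w p = (norm (h p - 1))\<^sup>2 / real p + 4 * (1 / real p ^ 2) + (if p < 5 then 2 else 0)" for p :: nat
  have "(\<Sum>p\<in>P. if p < 5 then 2 else (0::real)) = (\<Sum>p\<in>P \<inter> {..<5}. 2)"
    using sum.inter_restrict[OF P(1), of "\<lambda>_. 2::real" "{..<5}"] by simp
  also have "\<dots> \<le> 10" using card_mono[of "{..<5::nat}" "P \<inter> {..<5}"] by simp
  finally have "(\<Sum>p\<in>P. if p < 5 then 2 else (0::real)) \<le> 10" .
  moreover have "(\<Sum>p\<in>P. 1 / real p ^ 2) \<le> 1"
    using P prime_ge_2_nat by (intro sum_inverse_squares_le) auto
  ultimately have "(\<Sum>p\<in>P. w p) \<le> B + 14"
    using bound[OF P] unfolding w_def sum.distrib sum_distrib_left[symmetric] by linarith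
  then have w: "exp (- (B + 14)) \<le> (\<Prod>p\<in>P. exp (- w p))"
    using P(1) by (simp add: exp_sum[symmetric] sum_negf)
  have y: "real p powr (-s) < 1" if "p \<in> P" for p
  proof -
    have "1 < real p" using prime_gt_1_nat[OF P(2)[OF that]] by simp
    then show ?thesis using powr_less_mono[of "-s" 0 "real p"] s by simp
  qed
  have "exp (- (B + 14)) * (\<Prod>p\<in>P. 1 / (1 - real p powr (-s)))
      \<le> (\<Prod>p\<in>P. exp (- w p)) * (\<Prod>p\<in>P. 1 / (1 - real p powr (-s)))"
    by (intro mult_right_mono w prod_nonneg) (use y in \<open>auto intro: less_imp_le\<close>)
  also have "\<dots> = (\<Prod>p\<in>P. exp (- w p) * (1 / (1 - real p powr (-s))))"
    by (simp only: prod.distrib)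
  also have "\<dots> \<le> (\<Prod>p\<in>P. norm (\<Sum>j. h (p ^ j) * of_real ((real p powr (-s)) ^ j)))"
  proof (rule prod_mono, rule conjI)
    fix p assume p: "p \<in> P"
    show "0 \<le> exp (- w p) * (1 / (1 - real p powr (-s)))" using y[OF p] by simp
    show "exp (- w p) * (1 / (1 - real p powr (-s))) \<le> norm (\<Sum>j. h (p ^ j) * of_real ((real p powr (-s)) ^ j))"
      using euler_factor_ge[OF P(2)[OF p] s] y[OF p] by (simp add: w_def field_simps)
  qed
  also have "\<dots> = norm (\<Prod>p\<in>P. \<Sum>j. h (p ^ j) * of_real ((real p powr (-s)) ^ j))"
    by (simp only: prod_norm)
  finally show ?thesis .
qed

text \<open>This avoids infinite Euler products. \<open>W\<close> is the zeta product over the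
  primes up to \<open>N\<close>, that is, the sum over all numbers smooth over them. As
  \<open>h\<close> is unimodular, those beyond \<open>N\<close> contribute to the twisted series at
  most what they contribute to \<open>W\<close>.\<close>

lemma partial_sum_zeta_le:
  assumes s: "s > 1" and N: "N > 0"
  shows "\<exists>W. (\<Sum>n\<in>{1..N}. real n powr (-s)) \<le> W \<and> W \<le> (\<Sum>n. real n powr (-s)) \<and>
    exp (- (B + 14)) * W \<le> norm (\<Sum>n\<in>{1..N}. h n * of_real (real n powr (-s)))
      + (W - (\<Sum>n\<in>{1..N}. real n powr (-s)))"
proof -
  define P where "P = {p. prime p \<and> real p \<le> real N}"
  have P: "finite P" "\<And>p. p \<in> P \<Longrightarrow> prime p"
    unfolding P_def by (rule finite_primes_upto) auto
  have pw: "real (p ^ j) powr (-s) = (real p powr (-s)) ^ j" if "p \<in> P" for p j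
    using prime_gt_0_nat[OF P(2)[OF that]]
    by (simp add: powr_realpow[symmetric] powr_powr powr_power mult.commute)
  have y: "0 \<le> real p powr (-s)" "real p powr (-s) < 1" if "p \<in> P" for p
  proof -
    have "1 < real p" using prime_gt_1_nat[OF P(2)[OF that]] by simp
    then show "real p powr (-s) < 1" using powr_less_mono[of "-s" 0 "real p"] s by simp
  qed simp
  define W where "W = (\<Prod>p\<in>P. 1 / (1 - real p powr (-s)))"
  define H where "H = (\<Prod>p\<in>P. \<Sum>j. h (p ^ j) * of_real ((real p powr (-s)) ^ j))"
  have summ: "summable (\<lambda>j. (real p powr (-s)) ^ j)" if "p \<in> P" for p
    using y[OF that] by (intro summable_geometric) simp
  have "((\<lambda>n. real n powr (-s)) has_sum (\<Prod>p\<in>P. \<Sum>j. real (p ^ j) powr (-s))) (smooth_over P)"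
    by (rule euler_product_finite(2)[OF P]) (use summ pw powr_mult in auto)
  also have "(\<Prod>p\<in>P. \<Sum>j. real (p ^ j) powr (-s)) = W"
    unfolding W_def by (rule prod.cong[OF refl]) (use pw y in \<open>simp add: suminf_geometric\<close>)
  finally have hsW: "((\<lambda>n. real n powr (-s)) has_sum W) (smooth_over P)" .
  define a where "a n = h n * of_real (real n powr (-s))" for n
  have "(a has_sum (\<Prod>p\<in>P. \<Sum>j. a (p ^ j))) (smooth_over P)"
  proof (rule euler_product_finite(2)[OF P])
    show "a (m * n) = a m * a n" if "m > 0" "n > 0" "coprime m n" for m n
      using mult_coprime[OF that] by (simp add: a_def powr_mult)
    show "summable (\<lambda>j. norm (a (p ^ j)))" if "p \<in> P" for p
    proof -
      have "norm (a (p ^ j)) = (real p powr (-s)) ^ j" for j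
        using norm_eq_1[of "p ^ j"] pw[OF that, of j] prime_gt_0_nat[OF P(2)[OF that]]
        by (simp add: a_def norm_mult norm_power)
      then show ?thesis using summ[OF that] by simp
    qed
  qed (auto simp: a_def at_1[simplified])
  also have "(\<Prod>p\<in>P. \<Sum>j. a (p ^ j)) = H"
    unfolding H_def a_def by (rule prod.cong[OF refl]) (simp only: pw)
  finally have hsH: "(a has_sum H) (smooth_over P)" .
  have sub: "{1..N} \<subseteq> smooth_over P"
  proof
    fix n assume n: "n \<in> {1..N}"
    then show "n \<in> smooth_over P"
      by (auto simp: smooth_over_def P_def intro: order.trans[of _ n] dest: dvd_imp_le)
  qed
  have dW: "((\<lambda>n. real n powr (-s)) has_sum (W - (\<Sum>n\<in>{1..N}. real n powr (-s)))) (smooth_over P - {1..N})"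
    by (rule has_sum_Diff[OF hsW has_sum_finite sub]) simp
  have dH: "(a has_sum (H - sum a {1..N})) (smooth_over P - {1..N})"
    by (rule has_sum_Diff[OF hsH has_sum_finite sub]) simp
  have "norm (H - sum a {1..N}) \<le> W - (\<Sum>n\<in>{1..N}. real n powr (-s))"
  proof (rule norm_has_sum_bound[OF _ dH])
    have norm_a: "norm (a n) = real n powr (-s)" if "n \<in> smooth_over P - {1..N}" for n
      using that norm_eq_1[of n] by (simp add: a_def norm_mult smooth_over_def)
    show "((\<lambda>n. norm (a n)) has_sum (W - (\<Sum>n\<in>{1..N}. real n powr (-s)))) (smooth_over P - {1..N})"
      by (rule iffD2[OF has_sum_cong dW]) (rule norm_a)
  qed
  moreover have "norm H \<le> norm (sum a {1..N}) + norm (H - sum a {1..N})"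
    using norm_triangle_ineq[of "sum a {1..N}" "H - sum a {1..N}"] by simp
  moreover have "exp (- (B + 14)) * W \<le> norm H"
    unfolding W_def H_def by (rule euler_product_ge[OF P s])
  moreover have "(\<Sum>n\<in>{1..N}. real n powr (-s)) \<le> W"
    using has_sum_nonneg[OF dW] by simp
  \<comment> \<open>Since \<open>0 powr (-s) = 0\<close>, the series over all natural numbers is
    zeta at \<open>s\<close>.\<close>
  moreover have "W \<le> (\<Sum>n. real n powr (-s))"
  proof (rule has_sum_mono2[OF hsW])
    show "((\<lambda>n. real n powr (-s)) has_sum (\<Sum>n. real n powr (-s))) UNIV"
      using s summable_real_powr_iff[of "-s"] by (intro sums_nonneg_imp_has_sum summable_sums) auto
  qed auto
  ultimately show ?thesis unfolding a_def by (intro exI[of _ W]) linarith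
qed

end

theorem (in unimodular_multiplicative) mean_not_tendsto_0_if_pretends:
  assumes \<kappa>: "archimedean_character \<kappa>" and pr: "pretends g \<kappa>" and Re_2: "Re (g 2 * cnj (\<kappa> 2)) \<ge> 0"
  shows "\<not> (\<lambda>N. mean_upto g (real N)) \<longlonglongrightarrow> 0"
proof
  assume lim: "(\<lambda>N. mean_upto g (real N)) \<longlonglongrightarrow> 0"
  obtain B where B: "\<And>P. finite P \<Longrightarrow> (\<forall>p\<in>P. prime p) \<Longrightarrow> (\<Sum>p\<in>P. (norm (g p - \<kappa> p))\<^sup>2 / real p) \<le> B"
    using pr unfolding pretends_def by blast
  obtain L where L: "\<forall>n>0. norm (\<kappa> (Suc n) - \<kappa> n) \<le> L / real n"
    using \<kappa> unfolding archimedean_character_def by blast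
  have L0: "L \<ge> 0" using L[rule_format, of 1] by (simp add: order.trans[OF norm_ge_zero])
  define h where "h n = g n * cnj (\<kappa> n)" for n
  have \<kappa>_cnj: "\<kappa> n * cnj (\<kappa> n) = 1" if "n > 0" for n
    using archimedean_characterD(1)[OF \<kappa> that] complex_norm_square[of "\<kappa> n"] by simp
  interpret h: pretentious_to_1 h B
  proof
    show "norm (h n) = 1" if "n > 0" for n
      using archimedean_characterD(1)[OF \<kappa> that] norm_eq_1[OF that] by (simp add: h_def norm_mult)
    show "h (m * n) = h m * h n" if "m > 0" "n > 0" "coprime m n" for m n
      using archimedean_characterD(2)[OF \<kappa> that(1,2)] mult_coprime[OF that] by (simp add: h_def)
    show "0 \<le> Re (h 2)" using Re_2 by (simp add: h_def)
    show "(\<Sum>p\<in>P. (norm (h p - 1))\<^sup>2 / real p) \<le> B" if "finite P" "\<And>p. p \<in> P \<Longrightarrow> prime p" for P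
    proof -
      have "norm (h p - 1) = norm (g p - \<kappa> p)" if "p \<in> P" for p
      proof -
        have p: "p > 0" using \<open>\<And>p. p \<in> P \<Longrightarrow> prime p\<close>[OF that] by (simp add: prime_gt_0_nat)
        then have "h p - 1 = (g p - \<kappa> p) * cnj (\<kappa> p)"
          using \<kappa>_cnj by (simp add: h_def left_diff_distrib)
        then show ?thesis using archimedean_characterD(1)[OF \<kappa> p] by (simp add: norm_mult)
      qed
      then show ?thesis using B[of P] that by simp
    qed
  qed
  define c where "c = exp (- (B + 14))"
  \<comment> \<open>Chosen so that the upper bound from partial summation reaches only half of the
    lower bound \<open>c * W\<close> from the Euler product.\<close>
  define e where "e = c / (2 * (L + 2))"
  have c: "c > 0" by (simp add: c_def)
  then have e: "e > 0" "(L + 2) * e = c / 2" using L0 by (simp_all add: e_def field_simps)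
  have "\<forall>\<^sub>F N in sequentially. norm (mean_upto g (real N)) < e"
    using tendstoD[OF lim e(1)] by (simp add: dist_norm)
  then obtain n0 where n0: "\<And>N. N \<ge> n0 \<Longrightarrow> norm (mean_upto g (real N)) < e"
    by (auto simp: eventually_sequentially)
  define D where "D = real n0"
  have S: "norm (sum g {1..n}) \<le> e * real n + D" for n
  proof (cases "n0 \<le> n")
    case True
    show ?thesis
    proof (cases "n = 0")
      case False
      have "norm (sum g {1..n}) = norm (mean_upto g (real n)) * real n"
        using False by (simp add: mean_upto_of_nat norm_divide)
      also have "\<dots> \<le> e * real n" using n0[OF True] by (intro mult_right_mono) auto
      finally show ?thesis by (simp add: D_def)
    qed (simp add: D_def)
  next
    case False
    have "norm (sum g {1..n}) \<le> (\<Sum>k\<in>{1..n}. 1)"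
      by (rule sum_norm_le) (simp add: norm_eq_1)
    also have "\<dots> \<le> D" using False by (simp add: D_def)
    also have "\<dots> \<le> e * real n + D" using e by simp
    finally show ?thesis .
  qed
  define D' where "D' = e + D + (L + 2) * (2 * D)"
  \<comment> \<open>The right-hand side depends on neither \<open>s\<close> nor \<open>M\<close>;
    letting \<open>s\<close> decrease to 1 will bound all harmonic numbers.\<close>
  have le: "c / 2 * (\<Sum>n\<in>{1..M}. real n powr (-s)) \<le> D' + 1" if s: "1 < s" "s \<le> 2" for M s
  proof -
    define Z where "Z N = (\<Sum>n\<in>{1..N}. real n powr (-s))" for N
    have summ: "summable (\<lambda>n. real n powr (-s))" using s summable_real_powr_iff[of "-s"] by simp
    have "(\<lambda>N. \<Sum>n\<in>{..N}. real n powr (-s)) \<longlonglongrightarrow> (\<Sum>n. real n powr (-s))"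
      using summable_LIMSEQ'[OF summ] .
    moreover have "(\<Sum>n\<in>{..N}. real n powr (-s)) = Z N" for N
      unfolding Z_def by (rule sum.mono_neutral_right) (auto simp: Suc_le_eq)
    ultimately have "Z \<longlonglongrightarrow> (\<Sum>n. real n powr (-s))" by simp
    then have "\<forall>\<^sub>F N in sequentially. Z N > (\<Sum>n. real n powr (-s)) - 1"
      by (rule order_tendstoD) simp
    moreover have "\<forall>\<^sub>F N in sequentially. N \<ge> Suc M" by (rule eventually_ge_at_top)
    ultimately have "\<forall>\<^sub>F N in sequentially. Z N > (\<Sum>n. real n powr (-s)) - 1 \<and> N \<ge> Suc M"
      by eventually_elim simp
    \<comment> \<open>The tail of zeta beyond \<open>N\<close> is below 1, so
      \<open>W - Z N < 1\<close>; this is the \<open>+ 1\<close> in the claim.\<close>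
    then obtain N where N: "Z N > (\<Sum>n. real n powr (-s)) - 1" "N \<ge> Suc M"
      using eventually_happens'[OF sequentially_bot] by blast
    obtain W where W: "Z N \<le> W" "W \<le> (\<Sum>n. real n powr (-s))"
      "c * W \<le> norm (\<Sum>n\<in>{1..N}. h n * of_real (real n powr (-s))) + (W - Z N)"
      using h.partial_sum_zeta_le[OF s(1), of N] N(2) unfolding Z_def c_def by auto
    have "norm (\<Sum>n\<in>{1..N}. h n * of_real (real n powr (-s))) \<le> e + D + (L + 2) * (e * Z N + 2 * D)"
      using sum_twisted_le[OF \<kappa> L S _ _ s, of N] e unfolding Z_def h_def by (simp add: mult.assoc D_def)
    also have "\<dots> = D' + (L + 2) * e * Z N" by (simp add: D'_def algebra_simps)
    also have "\<dots> = D' + c / 2 * Z N" unfolding e(2) ..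
    also have "\<dots> \<le> D' + c / 2 * W" using W(1) c by simp
    finally have "c / 2 * W \<le> D' + 1" using W N(1) by linarith
    moreover have "Z M \<le> Z N" unfolding Z_def by (rule sum_mono2) (use N(2) in auto)
    then have "c / 2 * Z M \<le> c / 2 * W" using W(1) c by simp
    ultimately show ?thesis unfolding Z_def by linarith
  qed
  have harm: "c / 2 * harm M \<le> D' + 1" for M
  proof -
    have "((\<lambda>s. c / 2 * (\<Sum>n\<in>{1..M}. real n powr (-s))) \<longlongrightarrow> c / 2 * (\<Sum>n\<in>{1..M}. real n powr (-1))) (at_right 1)"
      by (intro tendsto_intros) auto
    moreover have "(\<Sum>n\<in>{1..M}. real n powr (-1)) = harm M"
      unfolding harm_def by (rule sum.cong) (auto simp: powr_minus_divide inverse_eq_divide)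
    moreover have "\<forall>\<^sub>F s in at_right 1. c / 2 * (\<Sum>n\<in>{1..M}. real n powr (-s)) \<le> D' + 1"
      by (rule eventually_at_rightI[of 1 2]) (use le in auto)
    ultimately show ?thesis
      using tendsto_upperbound[OF _ _ trivial_limit_at_right_real] by metis
  qed
  have "filterlim (\<lambda>M. ln (real M + 1)) at_top sequentially" by real_asymp
  then have "\<forall>\<^sub>F M in sequentially. ln (real M + 1) > (D' + 1) / (c / 2)"
    by (simp add: filterlim_at_top_dense)
  then obtain M where "ln (real M + 1) > (D' + 1) / (c / 2)"
    using eventually_happens'[OF sequentially_bot] by blast
  then have "harm M > (D' + 1) / (c / 2)" using ln_le_harm[of M] by linarith
  then show False using harm[of M] c by (simp add: field_simps)
qed

section \<open>Weyl's criterion\<close>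

inductive trig_poly :: "(real \<Rightarrow> complex) \<Rightarrow> bool" where
  monom: "trig_poly (\<lambda>t. c * cis (of_int k * (2 * pi * t)))"
| add: "trig_poly p \<Longrightarrow> trig_poly q \<Longrightarrow> trig_poly (\<lambda>t. p t + q t)"

lemma trig_poly_mult_monom: "trig_poly q \<Longrightarrow> trig_poly (\<lambda>t. c * cis (of_int k * (2 * pi * t)) * q t)"
proof (induction rule: trig_poly.induct)
  case (monom d l)
  have "(\<lambda>t. c * cis (of_int k * (2 * pi * t)) * (d * cis (of_int l * (2 * pi * t))))
      = (\<lambda>t. (c * d) * cis (of_int (k + l) * (2 * pi * t)))"
  proof
    fix t :: real
    have "cis (of_int (k + l) * (2 * pi * t)) = cis (of_int k * (2 * pi * t)) * cis (of_int l * (2 * pi * t))"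
      unfolding cis_mult by (simp only: of_int_add distrib_right)
    then show "c * cis (of_int k * (2 * pi * t)) * (d * cis (of_int l * (2 * pi * t)))
        = (c * d) * cis (of_int (k + l) * (2 * pi * t))"
      by (simp only: mult_ac)
  qed
  then show ?case by (simp only: trig_poly.monom)
next
  case (add p q)
  from add.IH show ?case unfolding distrib_left by (rule trig_poly.add)
qed

lemma trig_poly_mult: "trig_poly p \<Longrightarrow> trig_poly q \<Longrightarrow> trig_poly (\<lambda>t. p t * q t)"
proof (induction rule: trig_poly.induct)
  case (monom c k)
  then show ?case by (rule trig_poly_mult_monom)
next
  case (add p p')
  then show ?case unfolding distrib_right by (intro trig_poly.add) auto
qed

text \<open>On the circle a linear functional of the plane is
  \<open>f 1 * cos \<theta> + f \<i> * sin \<theta>\<close>, a combination of the frequencies 1 and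
  -1. Thus Stone-Weierstrass for real polynomial functions on the circle supplies trigonometric
  polynomials.\<close>

lemma trig_poly_real_polynomial_function:
  "real_polynomial_function P \<Longrightarrow> trig_poly (\<lambda>t. of_real (P (cis (2 * pi * t))))"
proof (induction rule: real_polynomial_function.induct)
  case (linear f)
  interpret bounded_linear f by fact
  have "of_real (f (cis \<theta>)) = (of_real (f 1) / 2 + of_real (f \<i>) / (2 * \<i>)) * cis \<theta>
      + (of_real (f 1) / 2 - of_real (f \<i>) / (2 * \<i>)) * cis (- \<theta>)" for \<theta>
  proof -
    have "cis \<theta> = cos \<theta> *\<^sub>R 1 + sin \<theta> *\<^sub>R \<i>" by (simp add: complex_eq_iff)
    then have "f (cis \<theta>) = cos \<theta> * f 1 + sin \<theta> * f \<i>" by (simp only: add scaleR) simp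
    then show ?thesis by (simp add: complex_eq_iff Re_divide Im_divide power2_eq_square field_simps)
  qed
  then have "(\<lambda>t. complex_of_real (f (cis (2 * pi * t)))) =
    (\<lambda>t. (of_real (f 1) / 2 + of_real (f \<i>) / (2 * \<i>)) * cis (of_int 1 * (2 * pi * t))
      + (of_real (f 1) / 2 - of_real (f \<i>) / (2 * \<i>)) * cis (of_int (-1) * (2 * pi * t)))"
    by (simp only: of_int_1 of_int_minus mult_1 mult_minus_left)
  then show ?case by (simp only:) (intro trig_poly.intros)
next
  case (const c)
  show ?case using trig_poly.monom[of "of_real c" 0] by simp
next
  case (add P Q)
  then show ?case by (simp add: trig_poly.add)
next
  case (mult P Q)
  then show ?case by (simp add: trig_poly_mult)
qed

lemma has_integral_cis_period:
  assumes "k \<noteq> 0"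
  shows "((\<lambda>t. c * cis (of_int k * (2 * pi * t))) has_integral 0) {0..1}"
proof -
  define w where "w = 2 * of_real pi * of_int k * \<i>"
  have w: "w \<noteq> 0" using assms by (simp add: w_def)
  have cis: "cis (of_int k * (2 * pi * t)) = exp (w * of_real t)" for t
    by (simp add: cis_conv_exp w_def mult_ac)
  have "((\<lambda>t. c * exp (w * of_real t)) has_integral (c * exp (w * of_real 1) / w - c * exp (w * of_real 0) / w)) {0..1}"
  proof (rule fundamental_theorem_of_calculus)
    fix t :: real assume "t \<in> {0..1}"
    show "((\<lambda>t. c * exp (w * of_real t) / w) has_vector_derivative c * exp (w * of_real t)) (at t within {0..1})"
      by (rule has_vector_derivative_real_field, (rule derivative_eq_intros refl)+) (use w in auto)
  qed simp
  moreover have "exp w = 1"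
    using cis[of 1] cis_multiple_2pi[of "of_int k"] by (simp add: mult_ac)
  ultimately show ?thesis unfolding cis by simp
qed

definition frequency :: "(nat \<Rightarrow> bool) \<Rightarrow> nat \<Rightarrow> real" where
  "frequency A N = real (card {n \<in> {1..N}. A n}) / real N"

lemma frequency_eq_sum: "frequency A N = (\<Sum>n\<in>{1..N}. of_bool (A n)) / real N"
  by (simp add: frequency_def of_bool_def sum.If_cases Int_def)

lemma mean_upto_const_tendsto: "(\<lambda>N. mean_upto (\<lambda>_. c) (real N)) \<longlonglongrightarrow> c"
  using tendsto_mult_left[OF filterlim_compose[OF mean_upto_one_tendsto filterlim_real_sequentially], of c]
    mean_upto_cmult[of c "\<lambda>_. 1"] by simp

locale weyl =
  fixes x :: "nat \<Rightarrow> real"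
  assumes mean_tendsto_0: "m > 0 \<Longrightarrow> (\<lambda>N. mean_upto (\<lambda>n. cis (real m * (2 * pi * x n))) (real N)) \<longlonglongrightarrow> 0"
begin

lemma trig_poly_mean:
  "trig_poly p \<Longrightarrow> \<exists>I. (p has_integral I) {0..1} \<and> (\<lambda>N. mean_upto (\<lambda>n. p (x n)) (real N)) \<longlonglongrightarrow> I"
proof (induction rule: trig_poly.induct)
  case (monom c k)
  show ?case
  proof (cases "k = 0")
    case True
    then show ?thesis
      using mean_upto_const_tendsto[of c] has_integral_const_real[of c 0 1] by (intro exI[of _ c]) simp
  next
    case False
    define m where "m = nat \<bar>k\<bar>"
    have "m > 0" using False by (simp add: m_def)
    note lim = mean_tendsto_0[OF this]
    have "(\<lambda>N. mean_upto (\<lambda>n. cis (of_int k * (2 * pi * x n))) (real N)) \<longlonglongrightarrow> 0"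
    proof (cases "k > 0")
      case True
      then show ?thesis using lim by (simp add: m_def)
    next
      case neg: False
      have "mean_upto (\<lambda>n. cis (of_int k * (2 * pi * x n))) N = cnj (mean_upto (\<lambda>n. cis (real m * (2 * pi * x n))) N)" for N
        unfolding mean_upto_cnj[symmetric] using neg by (simp add: m_def cis_cnj)
      then show ?thesis using tendsto_cnj[OF lim] by simp
    qed
    from tendsto_mult_left[OF this, of c] show ?thesis
      using has_integral_cis_period[OF False, of c] by (intro exI[of _ 0]) (simp add: mean_upto_cmult)
  qed
next
  case (add p q)
  then obtain I J where "(p has_integral I) {0..1}" "(\<lambda>N. mean_upto (\<lambda>n. p (x n)) (real N)) \<longlonglongrightarrow> I"
    "(q has_integral J) {0..1}" "(\<lambda>N. mean_upto (\<lambda>n. q (x n)) (real N)) \<longlonglongrightarrow> J" by blast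
  then show ?case unfolding mean_upto_add by (intro exI[of _ "I + J"] conjI has_integral_add tendsto_add)
qed

text \<open>
  The indicator of an arc is the pointwise limit of the continuous bumps
  \<open>max 0 (1 - j * infdist z Arc)\<close>, which are uniform limits of trigonometric polynomials.
\<close>
lemma eventually_frequency_le:
  assumes ab: "0 \<le> \<alpha>" "\<alpha> \<le> \<beta>" "\<beta> \<le> 1" and e: "e > 0"
  shows "\<forall>\<^sub>F N in sequentially. frequency (\<lambda>n. \<alpha> \<le> frac (x n) \<and> frac (x n) < \<beta>) N \<le> \<beta> - \<alpha> + e"
proof -
  define Arc where "Arc = (\<lambda>t. cis (2 * pi * t)) ` {\<alpha>..\<beta>}"
  have "compact Arc" unfolding Arc_def by (intro compact_continuous_image continuous_intros compact_Icc)
  then have Arc: "closed Arc" "Arc \<noteq> {}" using ab by (auto simp: compact_imp_closed Arc_def)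
  define G where "G j z = max 0 (1 - real j * infdist z Arc)" for j :: nat and z
  have G_cont: "continuous_on S (G j)" for j S
    unfolding G_def by (intro continuous_intros)
  have G01: "0 \<le> G j z" "G j z \<le> 1" for j z by (auto simp: G_def infdist_nonneg)
  have G_Arc: "G j z = 1" if "z \<in> Arc" for j z using that by (simp add: G_def)
  define g where "g t = (if cis (2 * pi * t) \<in> Arc then 1 else 0 :: real)" for t
  have G_lim: "(\<lambda>j. G j (cis (2 * pi * t))) \<longlonglongrightarrow> g t" for t
  proof (cases "cis (2 * pi * t) \<in> Arc")
    case True
    then show ?thesis by (simp add: G_Arc g_def)
  next
    case False
    define d where "d = infdist (cis (2 * pi * t)) Arc"
    have d: "d > 0"
      using False Arc in_closed_iff_infdist_zero[of Arc] infdist_nonneg[of "cis (2 * pi * t)" Arc]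
      unfolding d_def by fastforce
    have "filterlim (\<lambda>j. real j * d) at_top sequentially" using d by real_asymp
    then have "\<forall>\<^sub>F j in sequentially. real j * d \<ge> 1" unfolding filterlim_at_top by blast
    then have "\<forall>\<^sub>F j in sequentially. G j (cis (2 * pi * t)) = 0"
      by eventually_elim (simp add: G_def d_def)
    then show ?thesis using False by (simp add: g_def tendsto_eventually)
  qed
  have G_int: "(\<lambda>t. G j (cis (2 * pi * t))) integrable_on {0..1}" for j
    by (intro integrable_continuous_real continuous_on_compose2[OF G_cont[of UNIV]] continuous_intros) auto
  have "(\<lambda>j. integral {0..1} (\<lambda>t. G j (cis (2 * pi * t)))) \<longlonglongrightarrow> integral {0..1} g"
  proof (rule dominated_convergence(2)[OF G_int, where h = "\<lambda>_. 1"])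
    show "(\<lambda>_::real. 1::real) integrable_on {0..1}" by (rule has_integral_integrable[OF has_integral_const_real])
  qed (use G01 G_lim in auto)
  also have "integral {0..1} g = \<beta> - \<alpha>"
  proof (rule integral_unique, rule has_integral_spike_finite)
    have "((\<lambda>t. if t \<in> {\<alpha>..\<beta>} then 1 else 0) has_integral (\<beta> - \<alpha>)) {0..1}"
      using has_integral_const_real[of "1::real" \<alpha> \<beta>] ab
      by (subst has_integral_restrict) auto
    then show "((\<lambda>t. if t \<in> {\<alpha>..\<beta>} then 1 else 0) has_integral (\<beta> - \<alpha>)) {0..1}" .
    \<comment> \<open>The parameters 0 and 1 give the same point of the circle, so there
      \<open>g\<close> may be 1 outside \<open>{\<alpha>..\<beta>}\<close>; strictly between them
      the point determines the parameter.\<close>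
    show "finite {0, 1::real}" by simp
    fix t :: real assume t: "t \<in> {0..1} - {0, 1}"
    have "t = s" if s: "s \<in> {\<alpha>..\<beta>}" "cis (2 * pi * t) = cis (2 * pi * s)" for s
    proof -
      have "sin (2 * pi * t) = sin (2 * pi * s) \<and> cos (2 * pi * t) = cos (2 * pi * s)"
        using s(2) by (simp add: complex_eq_iff)
      then obtain n :: int where "2 * pi * t = 2 * pi * s + 2 * pi * of_int n"
        unfolding sin_cos_eq_iff by auto
      then have "2 * pi * t = 2 * pi * (s + of_int n)" by (simp add: distrib_left)
      then have n: "t = s + of_int n" by simp
      have "s \<ge> 0" "s \<le> 1" "t > 0" "t < 1" using s(1) ab t by auto
      then have "real_of_int n < 1" "real_of_int n > -1" using n by linarith+
      then have "n = 0" by linarith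
      then show ?thesis using n by simp
    qed
    then show "g t = (if t \<in> {\<alpha>..\<beta>} then 1 else 0)" by (auto simp: g_def Arc_def)
  qed
  finally have "\<forall>\<^sub>F j in sequentially. integral {0..1} (\<lambda>t. G j (cis (2 * pi * t))) < \<beta> - \<alpha> + e / 4"
    by (rule order_tendstoD) (use e in simp)
  then obtain j where j: "integral {0..1} (\<lambda>t. G j (cis (2 * pi * t))) < \<beta> - \<alpha> + e / 4"
    using eventually_happens'[OF sequentially_bot] by blast
  \<comment> \<open>The error budget has three parts \<open>e / 4\<close>: replacing the arc by a
    bump, integrating \<open>P\<close> instead of the bump, and the pointwise bound of the bump by
    \<open>P + e / 4\<close>.\<close>
  obtain P where P: "real_polynomial_function P" "\<And>z. z \<in> sphere 0 1 \<Longrightarrow> \<bar>G j z - P z\<bar> < e / 4"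
    using Stone_Weierstrass_real_polynomial_function[OF compact_sphere[of "0::complex" 1] G_cont[of _ j], of "e / 4"] e
    by auto
  have P': "\<bar>G j (cis \<theta>) - P (cis \<theta>)\<bar> < e / 4" for \<theta> by (rule P(2)) simp
  obtain I where I: "((\<lambda>t. of_real (P (cis (2 * pi * t))) :: complex) has_integral I) {0..1}"
    "(\<lambda>N. mean_upto (\<lambda>n. of_real (P (cis (2 * pi * x n)))) (real N)) \<longlonglongrightarrow> I"
    using trig_poly_mean[OF trig_poly_real_polynomial_function[OF P(1)]] by blast
  have "((\<lambda>t. P (cis (2 * pi * t))) has_integral Re I) {0..1}"
    using has_integral_linear[OF I(1) bounded_linear_Re] by (simp add: o_def)
  moreover have "((\<lambda>t. G j (cis (2 * pi * t)) + e / 4) has_integral (integral {0..1} (\<lambda>t. G j (cis (2 * pi * t))) + e / 4)) {0..1}"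
    using has_integral_add[OF integrable_integral[OF G_int] has_integral_const_real[of "e / 4" 0 1]] by simp
  ultimately have "Re I \<le> integral {0..1} (\<lambda>t. G j (cis (2 * pi * t))) + e / 4"
    by (rule has_integral_le) (use P' in \<open>smt (verit)\<close>)
  then have ReI: "Re I < \<beta> - \<alpha> + e / 2" using j by simp
  have "\<forall>\<^sub>F N in sequentially. Re (mean_upto (\<lambda>n. of_real (P (cis (2 * pi * x n)))) (real N)) < \<beta> - \<alpha> + e / 2"
    by (rule order_tendstoD(2)[OF tendsto_Re[OF I(2)] ReI])
  then show ?thesis
    using eventually_gt_at_top[of 0]
  proof eventually_elim
    case (elim N)
    have "frequency (\<lambda>n. \<alpha> \<le> frac (x n) \<and> frac (x n) < \<beta>) N
       \<le> (\<Sum>n\<in>{1..N}. P (cis (2 * pi * x n)) + e / 4) / real N"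
      unfolding frequency_eq_sum
    proof (intro divide_right_mono sum_mono)
      fix n
      have "cis (2 * pi * x n) = cis (2 * pi * frac (x n)) * cis (2 * pi * of_int \<lfloor>x n\<rfloor>)"
        by (simp add: frac_def cis_mult algebra_simps)
      then have "cis (2 * pi * x n) = cis (2 * pi * frac (x n))"
        by (simp add: cis_multiple_2pi)
      then have "cis (2 * pi * x n) \<in> Arc" if "\<alpha> \<le> frac (x n)" "frac (x n) < \<beta>"
        unfolding Arc_def using that by (intro image_eqI[of _ _ "frac (x n)"]) auto
      then have "of_bool (\<alpha> \<le> frac (x n) \<and> frac (x n) < \<beta>) \<le> G j (cis (2 * pi * x n))"
        using G01 G_Arc by auto
      then show "of_bool (\<alpha> \<le> frac (x n) \<and> frac (x n) < \<beta>) \<le> P (cis (2 * pi * x n)) + e / 4"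
        using P'[of "2 * pi * x n"] by linarith
    qed simp
    also have "\<dots> = Re (mean_upto (\<lambda>n. of_real (P (cis (2 * pi * x n)))) (real N)) + e / 4"
      using elim(2) by (simp add: mean_upto_of_nat sum.distrib add_divide_distrib Re_divide_of_nat)
    finally show ?case using elim(1) e by simp
  qed
qed

text \<open>The lower bound comes from upper bounds for the two complementary intervals, since the
  three frequencies sum to 1. It loses \<open>2 * d\<close>, hence the choice
  \<open>d = e / 3\<close>.\<close>

lemma frequency_tendsto:
  assumes ab: "0 \<le> \<alpha>" "\<alpha> \<le> \<beta>" "\<beta> \<le> 1"
  shows "frequency (\<lambda>n. \<alpha> \<le> frac (x n) \<and> frac (x n) < \<beta>) \<longlonglongrightarrow> \<beta> - \<alpha>"
proof (rule tendstoI)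
  fix e :: real assume e: "e > 0"
  define d where "d = e / 3"
  have e3: "d > 0" "e = 3 * d" using e by (simp_all add: d_def)
  show "\<forall>\<^sub>F N in sequentially. dist (frequency (\<lambda>n. \<alpha> \<le> frac (x n) \<and> frac (x n) < \<beta>) N) (\<beta> - \<alpha>) < e"
    using eventually_frequency_le[OF ab e3(1)] eventually_frequency_le[OF order.refl ab(1) order.trans[OF ab(2,3)] e3(1)]
      eventually_frequency_le[OF order.trans[OF ab(1,2)] ab(3) order.refl e3(1)] eventually_gt_at_top[of 0]
  proof eventually_elim
    case (elim N)
    have "of_bool (0 \<le> frac (x n) \<and> frac (x n) < \<alpha>) + of_bool (\<alpha> \<le> frac (x n) \<and> frac (x n) < \<beta>)
        + of_bool (\<beta> \<le> frac (x n) \<and> frac (x n) < 1) = (1::real)" for n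
      using frac_ge_0[of "x n"] frac_lt_1[of "x n"] ab by auto
    then have "frequency (\<lambda>n. 0 \<le> frac (x n) \<and> frac (x n) < \<alpha>) N + frequency (\<lambda>n. \<alpha> \<le> frac (x n) \<and> frac (x n) < \<beta>) N
        + frequency (\<lambda>n. \<beta> \<le> frac (x n) \<and> frac (x n) < 1) N = 1"
      unfolding frequency_eq_sum add_divide_distrib[symmetric] sum.distrib[symmetric] using elim(4) by simp
    then show ?case using elim(1-3) e3 unfolding dist_real_def by linarith
  qed
qed

end

section \<open>Leading digits\<close>

text \<open>The digits are read off from the floors of \<open>y * 10 ^ j\<close>. They cannot end in
  nines: each nine multiplies \<open>1 - t j\<close> by 10, yet this positive quantity never exceeds
  1.\<close>

lemma ex_digit_expansion:
  fixes y :: real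
  assumes "0 \<le> y" "y < 1"
  shows "\<exists>d::nat \<Rightarrow> nat. (\<forall>j. d j \<le> 9) \<and> (\<forall>J. \<exists>j\<ge>J. d j \<noteq> 9) \<and> (\<lambda>j. real (d j) / 10 ^ Suc j) sums y"
proof -
  define F where "F j = \<lfloor>y * 10 ^ j\<rfloor>" for j :: nat
  define t where "t j = y * 10 ^ j - of_int (F j)" for j
  define d where "d j = nat (F (Suc j) - 10 * F j)" for j
  have t: "0 \<le> t j" "t j < 1" for j
    unfolding t_def F_def by linarith+
  have t_Suc: "t (Suc j) = 10 * t j - of_int (F (Suc j) - 10 * F j)" for j
    by (simp add: t_def algebra_simps)
  have range: "0 \<le> F (Suc j) - 10 * F j \<and> F (Suc j) - 10 * F j \<le> 9" for j
  proof -
    have "real_of_int (F (Suc j) - 10 * F j) = 10 * t j - t (Suc j)" using t_Suc[of j] by simp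
    then have "real_of_int (F (Suc j) - 10 * F j) > -1" "real_of_int (F (Suc j) - 10 * F j) < 10"
      using t[of j] t[of "Suc j"] by linarith+
    then show ?thesis by linarith
  qed
  have d: "real (d j) = of_int (F (Suc j) - 10 * F j)" for j
    using range[of j] by (simp add: d_def)
  have partial: "(\<Sum>j<n. real (d j) / 10 ^ Suc j) = of_int (F n) / 10 ^ n" for n
  proof (induction n)
    case 0
    have "F 0 = 0" using assms by (simp add: F_def floor_eq_iff)
    then show ?case by simp
  next
    case (Suc n)
    then show ?case by (simp add: d field_simps)
  qed
  have "(\<lambda>n. y - t n / 10 ^ n) \<longlonglongrightarrow> y - 0"
  proof (intro tendsto_diff tendsto_const)
    show "(\<lambda>n. t n / 10 ^ n) \<longlonglongrightarrow> 0"
    proof (rule Lim_null_comparison)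
      show "\<forall>\<^sub>F n in sequentially. norm (t n / 10 ^ n) \<le> (1 / 10) ^ n"
        using t by (intro always_eventually allI) (simp add: power_one_over divide_right_mono less_imp_le)
      show "(\<lambda>n. (1 / 10 :: real) ^ n) \<longlonglongrightarrow> 0" by (rule LIMSEQ_power_zero) simp
    qed
  qed
  moreover have "y - t n / 10 ^ n = of_int (F n) / 10 ^ n" for n
    by (simp add: t_def field_simps)
  ultimately have sums: "(\<lambda>j. real (d j) / 10 ^ Suc j) sums y"
    unfolding sums_def partial by simp
  moreover have "\<exists>j\<ge>J. d j \<noteq> 9" for J
  proof (rule ccontr)
    assume "\<not> (\<exists>j\<ge>J. d j \<noteq> 9)"
    then have nine: "d j = 9" if "j \<ge> J" for j using that by auto
    have grow: "1 - t (J + n) = 10 ^ n * (1 - t J)" for n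
    proof (induction n)
      case (Suc n)
      have "of_int (F (Suc (J + n)) - 10 * F (J + n)) = (9::real)"
        using nine[of "J + n"] d[of "J + n"] by simp
      then show ?case using Suc t_Suc[of "J + n"] by simp
    qed simp
    have "((\<lambda>n. (1 / 10 :: real) ^ n) \<longlongrightarrow> 0) sequentially" by (rule LIMSEQ_power_zero) simp
    then have "\<forall>\<^sub>F n in sequentially. (1 / 10) ^ n < 1 - t J"
      by (rule order_tendstoD) (use t in simp)
    then obtain n where "(1 / 10) ^ n < 1 - t J"
      using eventually_happens'[OF sequentially_bot] by blast
    then have "1 < 10 ^ n * (1 - t J)" by (simp add: power_one_over field_simps)
    then show False using grow[of n] t[of "J + n"] by linarith
  qed
  moreover have "d j \<le> 9" for j using range[of j] unfolding d_def by linarith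
  ultimately show ?thesis by blast
qed

lemma digit_tail_bounds:
  fixes d :: "nat \<Rightarrow> nat"
  assumes d: "\<forall>j. d j \<le> 9" "\<exists>j. d j \<noteq> 9"
  shows "summable (\<lambda>j. real (d j) / 10 ^ Suc j)"
    "0 \<le> (\<Sum>j. real (d j) / 10 ^ Suc j)" "(\<Sum>j. real (d j) / 10 ^ Suc j) < 1"
proof -
  have geo: "(\<lambda>j. 9 / 10 ^ Suc j :: real) sums 1"
    using sums_mult[OF geometric_sums[of "1 / 10 :: real"], of "9 / 10"] by (simp add: power_one_over)
  have le: "real (d j) / 10 ^ Suc j \<le> 9 / 10 ^ Suc j" for j
    using d(1)[rule_format, of j] by (intro divide_right_mono) auto
  show summ: "summable (\<lambda>j. real (d j) / 10 ^ Suc j)"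
    by (rule summable_comparison_test'[OF sums_summable[OF geo], of 0]) (use le in simp)
  show "0 \<le> (\<Sum>j. real (d j) / 10 ^ Suc j)" by (intro suminf_nonneg summ) simp
  obtain j where "d j \<noteq> 9" using d(2) by blast
  then have "d j < 9" using d(1)[rule_format, of j] by simp
  then have "0 < (\<Sum>j. 9 / 10 ^ Suc j - real (d j) / 10 ^ Suc j)"
    using le by (intro suminf_pos2[of _ j] summable_diff summ sums_summable[OF geo])
      (auto simp: divide_strict_right_mono)
  also have "\<dots> = 1 - (\<Sum>j. real (d j) / 10 ^ Suc j)"
    using suminf_diff[OF sums_summable[OF geo] summ] sums_unique[OF geo] by simp
  finally show "(\<Sum>j. real (d j) / 10 ^ Suc j) < 1" by simp
qed

lemma powi_one_minus: "10 powi (- int n + 1) = (10 / 10 ^ n :: real)"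
proof -
  have "10 powi (- int n + 1) = (10 powi (- int n) * 10 powi 1 :: real)"
    by (rule power_int_add) simp
  then show ?thesis by (simp only: power_int_minus power_int_of_nat power_int_1_right) (simp add: field_simps)
qed

lemma significand_bounds:
  assumes "digit_string S"
  shows "1 \<le> significand S" "significand S + 10 / 10 ^ length S \<le> 10"
proof -
  have S: "S \<noteq> []" "\<And>j. j < length S \<Longrightarrow> S ! j \<le> 9" "S ! 0 \<ge> 1"
    using assms by (auto simp: digit_string_def)
  have "real (S ! 0) / 10 ^ 0 \<le> significand S"
    unfolding significand_def by (rule member_le_sum) (use S in auto)
  then show "1 \<le> significand S" using S(3) by simp
  have "(\<Sum>j<n. 9 / 10 ^ j :: real) = 10 - 10 / 10 ^ n" for n :: nat
    by (induction n) (auto simp: field_simps)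
  moreover have "significand S \<le> (\<Sum>j<length S. 9 / 10 ^ j)"
    unfolding significand_def using S(2) by (intro sum_mono divide_right_mono) auto
  ultimately show "significand S + 10 / 10 ^ length S \<le> 10" by simp
qed

lemma frac_log10:
  assumes "1 \<le> z" "z < 10"
  shows "frac (log 10 (10 powi M * z)) = log 10 z"
proof -
  have "10 powi M = 10 powr real_of_int M" by (simp add: powr_real_of_int')
  then have "log 10 (10 powi M * z) = of_int M + log 10 z"
    using assms by (simp add: log_mult)
  moreover have "0 \<le> log 10 z" "log 10 z < 1"
    using assms by (auto simp: log_less_iff)
  ultimately show ?thesis by (simp add: frac_unique_iff)
qed

text \<open>With the leading digits fixed, the normalised number is \<open>r + w * T\<close>, where
  \<open>T\<close> is the fraction formed by the remaining digits. As expansions ending in nines are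
  excluded, \<open>T\<close> ranges over exactly the half-open unit interval.\<close>

lemma leading_digits_iff:
  assumes a: "a > 0" and S: "digit_string S"
  shows "leading_digits a S \<longleftrightarrow> log 10 (significand S) \<le> frac (log 10 a)
     \<and> frac (log 10 a) < log 10 (significand S + 10 powi (- int (length S) + 1))"
proof -
  define K where "K = length S"
  define r where "r = significand S"
  define w where "w = (10 / 10 ^ K :: real)"
  have w: "10 powi (- int (length S) + 1) = w" "w > 0"
    unfolding w_def K_def powi_one_minus by simp_all
  have K: "K > 0" using S by (simp add: K_def digit_string_def)
  have r: "1 \<le> r" "r + w \<le> 10" using significand_bounds[OF S] by (auto simp: r_def w_def K_def)
  have shift: "(\<Sum>j<K. real (d j) / 10 ^ j) + w * T = (\<Sum>j. real (d j) / 10 ^ j)"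
    if "(\<lambda>j. real (d (j + K)) / 10 ^ Suc j) sums T" for d T
  proof -
    have "(\<lambda>j. w * (real (d (j + K)) / 10 ^ Suc j)) sums (w * T)" by (rule sums_mult[OF that])
    then have "(\<lambda>j. real (d (j + K)) / 10 ^ (j + K)) sums (w * T)"
      by (simp add: w_def power_add mult_ac)
    then have "(\<lambda>j. real (d j) / 10 ^ j) sums (w * T + (\<Sum>j<K. real (d j) / 10 ^ j))"
      by (simp only: sums_iff_shift[of "\<lambda>j. real (d j) / 10 ^ j"])
    from sums_unique[OF this] show ?thesis by simp
  qed
  show ?thesis
    unfolding w(1) r_def[symmetric]
  proof
    assume "leading_digits a S"
    then obtain M d where d: "decimal_expansion a M d" "\<forall>j<length S. d j = S ! j"
      by (auto simp: leading_digits_def)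
    define T where "T = (\<Sum>j. real (d (j + K)) / 10 ^ Suc j)"
    have d': "\<forall>j. d (j + K) \<le> 9" "\<exists>j. d (j + K) \<noteq> 9"
    proof -
      show "\<forall>j. d (j + K) \<le> 9" using d(1) by (simp add: decimal_expansion_def)
      obtain j where "j \<ge> K" "d j \<noteq> 9" using d(1) unfolding decimal_expansion_def by blast
      then show "\<exists>j. d (j + K) \<noteq> 9" by (intro exI[of _ "j - K"]) simp
    qed
    note T = digit_tail_bounds[OF d', folded T_def]
    have "(\<Sum>j<K. real (d j) / 10 ^ j) = r"
      unfolding r_def significand_def K_def using d(2) by (intro sum.cong) auto
    then have "a = 10 powi M * (r + w * T)"
      using shift[of d T] summable_sums[OF T(1), folded T_def] d(1) by (simp add: decimal_expansion_def)
    moreover have z: "r \<le> r + w * T" "r + w * T < r + w" using T w(2) by auto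
    ultimately have "frac (log 10 a) = log 10 (r + w * T)"
      using r by (simp only: frac_log10)
    then show "log 10 r \<le> frac (log 10 a) \<and> frac (log 10 a) < log 10 (r + w)"
      using z r by simp
  next
    assume fr: "log 10 r \<le> frac (log 10 a) \<and> frac (log 10 a) < log 10 (r + w)"
    define M where "M = \<lfloor>log 10 a\<rfloor>"
    define z where "z = 10 powr frac (log 10 a)"
    have a_eq: "a = 10 powi M * z"
    proof -
      have "a = 10 powr (of_int M + frac (log 10 a))" using a by (simp add: M_def frac_def)
      then show ?thesis by (simp add: z_def powr_add powr_real_of_int')
    qed
    have z: "r \<le> z" "z < r + w"
      using fr r w(2) by (auto simp: z_def log_le_iff less_log_iff)
    define y where "y = (z - r) / w"
    have "0 \<le> y" "y < 1" using z w(2) by (auto simp: y_def field_simps)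
    from ex_digit_expansion[OF this] obtain e :: "nat \<Rightarrow> nat"
      where e: "\<forall>j. e j \<le> 9" "\<forall>J. \<exists>j\<ge>J. e j \<noteq> 9" "(\<lambda>j. real (e j) / 10 ^ Suc j) sums y" by blast
    define d where "d j = (if j < K then S ! j else e (j - K))" for j
    have "(\<Sum>j<K. real (d j) / 10 ^ j) = r"
      unfolding r_def significand_def K_def d_def by (intro sum.cong) auto
    then have "(\<Sum>j. real (d j) / 10 ^ j) = z"
      using shift[of d y] e(3) w(2) by (simp add: d_def y_def)
    moreover have "\<exists>j\<ge>J. d j \<noteq> 9" for J
    proof -
      obtain j where "j \<ge> J" "e j \<noteq> 9" using e(2) by blast
      then show ?thesis by (intro exI[of _ "j + K"]) (simp add: d_def)
    qed
    ultimately have "decimal_expansion a M d"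
      using a_eq S e(1) K by (auto simp: decimal_expansion_def d_def digit_string_def K_def)
    then show "leading_digits a S"
      unfolding leading_digits_def by (intro exI[of _ M] exI[of _ d]) (simp add: d_def K_def)
  qed
qed

text \<open>Integers with \<open>K + 1\<close> digits index the digit cells from
  \<open>i / 10 ^ K\<close> to \<open>(i + 1) / 10 ^ K\<close>, which tile a whole decade.\<close>

lemma ex_digit_string:
  "i \<in> {10 ^ K..<10 ^ Suc K} \<Longrightarrow> \<exists>S. digit_string S \<and> length S = Suc K \<and> significand S = real i / 10 ^ K"
proof (induction K arbitrary: i)
  case 0
  then show ?case by (intro exI[of _ "[i]"]) (auto simp: digit_string_def significand_def)
next
  case (Suc K)
  have "i div 10 \<in> {10 ^ K..<10 ^ Suc K}" using Suc.prems by auto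
  from Suc.IH[OF this] obtain S where S: "digit_string S" "length S = Suc K" "significand S = real (i div 10) / 10 ^ K"
    by blast
  have "significand (S @ [i mod 10]) = significand S + real (i mod 10) / 10 ^ Suc K"
    by (simp add: significand_def S(2) nth_append)
  also have "\<dots> = (10 * real (i div 10) + real (i mod 10)) / 10 ^ Suc K"
    by (simp add: S(3) field_simps)
  also have "10 * real (i div 10) + real (i mod 10) = real i"
  proof -
    have "real (10 * (i div 10) + i mod 10) = real i" by (simp only: mult_div_mod_eq)
    then show ?thesis by (simp only: of_nat_add of_nat_mult of_nat_numeral)
  qed
  finally have "significand (S @ [i mod 10]) = real i / 10 ^ Suc K" .
  moreover have "digit_string (S @ [i mod 10])"
    using S(1,2) by (auto simp: digit_string_def nth_append less_Suc_eq_le)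
  ultimately show ?case using S(2) by (intro exI[of _ "S @ [i mod 10]"]) simp
qed

section \<open>Exponential means from digit frequencies\<close>

lemma norm_cis_diff_le: "norm (cis a - cis b) \<le> \<bar>a - b\<bar>"
proof -
  have "norm (cis c - 1) \<le> \<bar>c\<bar>" for c
    using Taylor_exp[of "\<i> * of_real c" 0] by (simp add: norm_mult cis_conv_exp)
  moreover have "cis a - cis b = cis b * (cis (a - b) - 1)"
    by (simp add: right_diff_distrib cis_mult)
  ultimately show ?thesis by (simp add: norm_mult)
qed

lemma norm_cis_diff_linear_le: "norm (cis (a + h) - cis a - \<i> * of_real h * cis a) \<le> h\<^sup>2"
proof -
  have "norm (cis h - (1 + \<i> * of_real h)) \<le> h\<^sup>2"
    using Taylor_exp[of "\<i> * of_real h" 1] by (simp add: norm_mult cis_conv_exp power2_eq_square)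
  moreover have "cis (a + h) - cis a - \<i> * of_real h * cis a = cis a * (cis h - (1 + \<i> * of_real h))"
    by (simp add: algebra_simps flip: cis_mult)
  ultimately show ?thesis by (simp add: norm_mult)
qed

text \<open>
  Approximates the exponential by a step function on the cells of leading digit strings of length
  \<open>K + 1\<close>; the resulting sum is a Riemann sum for the integral over a full period.
\<close>
lemma mean_cis_tendsto_0:
  fixes x :: "nat \<Rightarrow> real"
  assumes cells: "\<And>K i. i \<in> {10 ^ K..<10 ^ Suc K} \<Longrightarrow>
      frequency (\<lambda>n. log 10 (real i / 10 ^ K) \<le> frac (x n) \<and> frac (x n) < log 10 (real (Suc i) / 10 ^ K))
        \<longlonglongrightarrow> log 10 (real (Suc i) / 10 ^ K) - log 10 (real i / 10 ^ K)"
    and m: "m > 0"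
  shows "(\<lambda>N. mean_upto (\<lambda>n. cis (real m * (2 * pi * x n))) (real N)) \<longlonglongrightarrow> 0"
proof (rule tendstoI)
  fix e :: real assume e: "e > 0"
  define w where "w = real m * (2 * pi)"
  have w: "w > 0" using m by (simp add: w_def)
  have "(\<lambda>K. 2 * w * (1 / 10) ^ K) \<longlonglongrightarrow> 2 * w * 0" by (intro tendsto_intros LIMSEQ_power_zero) simp
  then have "\<forall>\<^sub>F K in sequentially. 2 * w * (1 / 10) ^ K < e"
    by (rule order_tendstoD) (use e in simp)
  then obtain K where K: "2 * w * (1 / 10) ^ K < e"
    using eventually_happens'[OF sequentially_bot] by blast
  define \<delta> where "\<delta> = (1 / 10 :: real) ^ K"
  have \<delta>: "\<delta> > 0" by (simp add: \<delta>_def)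
  define I where "I = {10 ^ K..<10 ^ Suc K :: nat}"
  define \<alpha> where "\<alpha> i = log 10 (real i / 10 ^ K)" for i :: nat
  have pos: "i > 0" if "i \<in> I" for i
    using that by (auto simp: I_def intro: Nat.gr0I)
  have \<alpha>_mono: "\<alpha> i \<le> \<alpha> (Suc i)" if "i \<in> I" for i
    unfolding \<alpha>_def using pos[OF that] by (simp add: divide_right_mono)
  have \<alpha>_step: "\<alpha> (Suc i) - \<alpha> i \<le> \<delta>" if "i \<in> I" for i
  proof -
    have i: "real i > 0" "real i \<ge> 10 ^ K" using pos[OF that] that by (auto simp: I_def)
    have "\<alpha> (Suc i) - \<alpha> i = log 10 (real (Suc i) / real i)"
      unfolding \<alpha>_def using i by (simp add: log_def ln_div diff_divide_distrib)
    also have "real (Suc i) / real i = 1 + 1 / real i" using i by (simp add: field_simps)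
    also have "log 10 (1 + 1 / real i) = ln (1 + 1 / real i) / ln 10" by (simp add: log_def)
    also have "\<dots> \<le> ln (1 + 1 / real i) / 1"
    proof (rule divide_left_mono)
      have "exp 1 \<le> (10::real)" using exp_le by simp
      then show "1 \<le> ln (10::real)" by (simp add: ln_ge_iff)
    qed (use i in auto)
    also have "\<dots> \<le> 1 / real i" using ln_add_one_self_le_self[of "1 / real i"] i by simp
    also have "\<dots> \<le> 1 / 10 ^ K" using i by (intro frac_le) auto
    finally show ?thesis by (simp add: \<delta>_def power_one_over)
  qed
  have \<alpha>_total: "(\<Sum>i\<in>I. \<alpha> (Suc i) - \<alpha> i) = 1"
    unfolding I_def by (subst sum_Suc_diff') (simp_all add: \<alpha>_def)
  define A where "A i n \<longleftrightarrow> \<alpha> i \<le> frac (x n) \<and> frac (x n) < \<alpha> (Suc i)" for i n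
  define f where "f n = cis (w * frac (x n))" for n
  have f_eq: "cis (real m * (2 * pi * x n)) = f n" for n
  proof -
    have "real m * (2 * pi * x n) = w * frac (x n) + 2 * pi * of_int (int m * \<lfloor>x n\<rfloor>)"
      by (simp add: w_def frac_def algebra_simps)
    then have "cis (real m * (2 * pi * x n)) = cis (w * frac (x n)) * cis (2 * pi * of_int (int m * \<lfloor>x n\<rfloor>))"
      by (simp only: cis_mult)
    then show ?thesis unfolding f_def by (subst (asm) cis_multiple_2pi) auto
  qed
  define g where "g n = (\<Sum>i\<in>I. cis (w * \<alpha> i) * of_bool (A i n))" for n
  have fg: "norm (f n - g n) \<le> w * \<delta>" for n
  proof -
    \<comment> \<open>After scaling by \<open>10 ^ K\<close>, the cell containing
      \<open>frac (x n)\<close> is indexed by the floor of \<open>u\<close>.\<close>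
    define u where "u = 10 powr frac (x n) * 10 ^ K"
    define i where "i = nat \<lfloor>u\<rfloor>"
    have "1 \<le> 10 powr frac (x n)" by (simp add: ge_one_powr_ge_zero)
    moreover have "10 powr frac (x n) < 10 powr 1" using frac_lt_1[of "x n"] by (intro powr_less_mono) auto
    ultimately have u: "10 ^ K \<le> u" "u < 10 ^ Suc K" by (auto simp: u_def)
    have A_iff: "A j n \<longleftrightarrow> j = i" if "j \<in> I" for j
    proof -
      have "\<alpha> j \<le> frac (x n) \<longleftrightarrow> real j \<le> u"
        using pos[OF that] by (simp add: \<alpha>_def u_def log_le_iff field_simps)
      moreover have "frac (x n) < \<alpha> (Suc j) \<longleftrightarrow> u < real (Suc j)"
        by (simp add: \<alpha>_def u_def less_log_iff field_simps del: of_nat_Suc)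
      moreover have "real j \<le> u \<and> u < real (Suc j) \<longleftrightarrow> j = i"
        using order.trans[OF _ u(1), of 0] unfolding i_def by (auto simp: nat_eq_iff floor_eq_iff) linarith+
      ultimately show ?thesis by (simp add: A_def)
    qed
    have "i \<in> I"
    proof -
      have "10 ^ K \<le> \<lfloor>u\<rfloor>" "\<lfloor>u\<rfloor> < 10 ^ Suc K"
        using u by (auto simp: le_floor_iff floor_less_iff)
      moreover from this(1) have "0 \<le> \<lfloor>u\<rfloor>" by (rule order.trans[rotated]) simp
      ultimately show ?thesis by (auto simp: I_def i_def le_nat_iff nat_less_iff)
    qed
    then have Ai: "A i n" using A_iff by simp
    have "g n = (\<Sum>j\<in>I. if j = i then cis (w * \<alpha> i) else 0)"
      unfolding g_def by (rule sum.cong) (auto simp: A_iff)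
    then have "g n = cis (w * \<alpha> i)" using \<open>i \<in> I\<close> by (simp add: I_def)
    then have "norm (f n - g n) \<le> \<bar>w * frac (x n) - w * \<alpha> i\<bar>"
      unfolding f_def using norm_cis_diff_le by simp
    also have "\<dots> = w * (frac (x n) - \<alpha> i)"
      using Ai w by (simp add: A_def right_diff_distrib[symmetric] abs_mult)
    also have "\<dots> \<le> w * \<delta>"
      using Ai \<alpha>_step[OF \<open>i \<in> I\<close>] w by (intro mult_left_mono) (auto simp: A_def)
    finally show ?thesis .
  qed
  define L where "L = (\<Sum>i\<in>I. cis (w * \<alpha> i) * of_real (\<alpha> (Suc i) - \<alpha> i))"
  have "(\<lambda>N. \<Sum>i\<in>I. cis (w * \<alpha> i) * of_real (frequency (A i) N)) \<longlonglongrightarrow> L"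
    unfolding L_def A_def \<alpha>_def by (intro tendsto_intros cells) (simp add: I_def)
  moreover have "mean_upto g (real N) = (\<Sum>i\<in>I. cis (w * \<alpha> i) * of_real (frequency (A i) N))" for N
    unfolding g_def mean_upto_sum mean_upto_cmult
    by (simp add: mean_upto_of_nat frequency_eq_sum)
  ultimately have g_lim: "(\<lambda>N. mean_upto g (real N)) \<longlonglongrightarrow> L" by simp
  have L: "norm L \<le> w * \<delta>"
  proof -
    \<comment> \<open>\<open>R i\<close> is the error of linearising the exponential over cell
      \<open>i\<close>. The increments telescope to 0 because \<open>w\<close> is a multiple of
      \<open>2 * pi\<close>, so the errors sum to \<open>- (\<i> * w * L)\<close>; this bounds the
      Riemann sum \<open>L\<close> by the mesh.\<close>
    define R where "R i = cis (w * \<alpha> (Suc i)) - cis (w * \<alpha> i)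
      - \<i> * of_real (w * (\<alpha> (Suc i) - \<alpha> i)) * cis (w * \<alpha> i)" for i
    have "cis (w * \<alpha> (10 ^ Suc K)) = 1"
      using cis_multiple_2pi[of "real m"] by (simp add: \<alpha>_def w_def mult_ac)
    then have "(\<Sum>i\<in>I. cis (w * \<alpha> (Suc i)) - cis (w * \<alpha> i)) = 0"
      unfolding I_def by (subst sum_Suc_diff') (simp_all add: \<alpha>_def)
    then have "(\<Sum>i\<in>I. R i) = - (\<i> * of_real w * L)"
      by (simp add: R_def L_def sum_subtractf sum_distrib_left mult_ac)
    then have "w * norm L = norm (\<Sum>i\<in>I. R i)" using w by (simp add: norm_mult)
    also have "\<dots> \<le> (\<Sum>i\<in>I. w\<^sup>2 * \<delta> * (\<alpha> (Suc i) - \<alpha> i))"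
    proof (rule sum_norm_le)
      fix i assume i: "i \<in> I"
      have "norm (R i) \<le> (w * (\<alpha> (Suc i) - \<alpha> i))\<^sup>2"
        using norm_cis_diff_linear_le[of "w * \<alpha> i" "w * (\<alpha> (Suc i) - \<alpha> i)"]
        by (simp add: R_def algebra_simps)
      also have "\<dots> = w\<^sup>2 * ((\<alpha> (Suc i) - \<alpha> i) * (\<alpha> (Suc i) - \<alpha> i))"
        by (simp add: power2_eq_square mult_ac)
      also have "\<dots> \<le> w\<^sup>2 * (\<delta> * (\<alpha> (Suc i) - \<alpha> i))"
        using \<alpha>_step[OF i] \<alpha>_mono[OF i] by (intro mult_left_mono mult_right_mono) auto
      finally show "norm (R i) \<le> w\<^sup>2 * \<delta> * (\<alpha> (Suc i) - \<alpha> i)" by (simp add: mult_ac)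
    qed
    also have "\<dots> = w\<^sup>2 * \<delta>" unfolding sum_distrib_left[symmetric] \<alpha>_total by simp
    finally show ?thesis using w by (simp add: power2_eq_square)
  qed
  have "w * \<delta> + w * \<delta> < e" using K by (simp add: \<delta>_def)
  then have "norm L < e - w * \<delta>" using L by linarith
  then have "\<forall>\<^sub>F N in sequentially. norm (mean_upto g (real N)) < e - w * \<delta>"
    by (rule order_tendstoD(2)[OF tendsto_norm[OF g_lim]])
  then show "\<forall>\<^sub>F N in sequentially. dist (mean_upto (\<lambda>n. cis (real m * (2 * pi * x n))) (real N)) 0 < e"
    using eventually_gt_at_top[of 0]
  proof eventually_elim
    case (elim N)
    have "norm (mean_upto f (real N) - mean_upto g (real N)) \<le> w * \<delta>"
    proof -
      have "norm (\<Sum>n\<in>{1..N}. f n - g n) \<le> real N * (w * \<delta>)"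
        using sum_norm_bound[of "{1..N}" "\<lambda>n. f n - g n" "w * \<delta>"] fg by simp
      then show ?thesis
        using elim(2) unfolding mean_upto_diff[symmetric] mean_upto_of_nat
        by (simp add: norm_divide field_simps sum_subtractf)
    qed
    then show ?case
      using elim(1) norm_triangle_ineq[of "mean_upto f (real N) - mean_upto g (real N)" "mean_upto g (real N)"]
      by (simp add: f_eq)
  qed
qed

definition phase :: "(nat \<Rightarrow> real) \<Rightarrow> nat \<Rightarrow> nat \<Rightarrow> complex" where
  "phase f m n = cis (real m * (2 * pi * log 10 \<bar>f n\<bar>))"

lemma strong_benford_iff_frequency:
  assumes "\<forall>n\<ge>1. f n \<noteq> 0"
  shows "strong_benford f \<longleftrightarrow> (\<forall>S. digit_string S \<longrightarrow>
    frequency (\<lambda>n. log 10 (significand S) \<le> frac (log 10 \<bar>f n\<bar>) \<and>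
        frac (log 10 \<bar>f n\<bar>) < log 10 (significand S + 10 powi (- int (length S) + 1)))
      \<longlonglongrightarrow> log 10 (significand S + 10 powi (- int (length S) + 1)) - log 10 (significand S))"
proof -
  have "{k \<in> {1..N}. leading_digits \<bar>f k\<bar> S} = {k \<in> {1..N}. log 10 (significand S) \<le> frac (log 10 \<bar>f k\<bar>) \<and>
        frac (log 10 \<bar>f k\<bar>) < log 10 (significand S + 10 powi (- int (length S) + 1))}"
    if "digit_string S" for S N
    using assms by (intro Collect_cong) (auto simp: leading_digits_iff[OF _ that])
  then show ?thesis
    unfolding strong_benford_def strong_benford_pos_def frequency_def by (simp cong: imp_cong)
qed

text \<open>Digit cells at all scales approximate every exponential; conversely, each cell is an
  interval of fractional parts, to which equidistribution applies.\<close>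

lemma strong_benford_iff_mean:
  assumes f: "\<forall>n\<ge>1. f n \<noteq> 0"
  shows "strong_benford f \<longleftrightarrow> (\<forall>m>0. (\<lambda>N. mean_upto (phase f m) (real N)) \<longlonglongrightarrow> 0)"
proof
  assume sb: "strong_benford f"
  show "\<forall>m>0. (\<lambda>N. mean_upto (phase f m) (real N)) \<longlonglongrightarrow> 0"
    unfolding phase_def
  proof (intro allI impI mean_cis_tendsto_0)
    fix K i :: nat assume "i \<in> {10 ^ K..<10 ^ Suc K}"
    then obtain S where S: "digit_string S" "length S = Suc K" "significand S = real i / 10 ^ K"
      using ex_digit_string by blast
    have upper: "significand S + 10 powi (- int (length S) + 1) = real (Suc i) / 10 ^ K"
      unfolding powi_one_minus S(2,3) by (simp add: field_simps)
    have "\<forall>S. digit_string S \<longrightarrow>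
        frequency (\<lambda>n. log 10 (significand S) \<le> frac (log 10 \<bar>f n\<bar>) \<and>
          frac (log 10 \<bar>f n\<bar>) < log 10 (significand S + 10 powi (- int (length S) + 1)))
        \<longlonglongrightarrow> log 10 (significand S + 10 powi (- int (length S) + 1)) - log 10 (significand S)"
      using strong_benford_iff_frequency[OF f] sb by (rule iffD1)
    from this[rule_format, OF S(1)]
    show "frequency (\<lambda>n. log 10 (real i / 10 ^ K) \<le> frac (log 10 \<bar>f n\<bar>) \<and>
         frac (log 10 \<bar>f n\<bar>) < log 10 (real (Suc i) / 10 ^ K))
        \<longlonglongrightarrow> log 10 (real (Suc i) / 10 ^ K) - log 10 (real i / 10 ^ K)"
      unfolding upper unfolding S(3) .
  qed
next
  assume "\<forall>m>0. (\<lambda>N. mean_upto (phase f m) (real N)) \<longlonglongrightarrow> 0"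
  then interpret weyl "\<lambda>n. log 10 \<bar>f n\<bar>" by unfold_locales (simp add: phase_def[abs_def])
  show "strong_benford f"
    unfolding strong_benford_iff_frequency[OF f]
  proof (intro allI impI frequency_tendsto)
    fix S assume S: "digit_string S"
    note w = powi_one_minus[of "length S"]
    note b = significand_bounds[OF S]
    show "0 \<le> log 10 (significand S)" using b by simp
    show "log 10 (significand S) \<le> log 10 (significand S + 10 powi (- int (length S) + 1))"
      using b unfolding w by (subst log_le_cancel_iff) (auto intro: add_pos_pos)
    have "significand S + 10 / 10 ^ length S > 0" using b by (intro add_pos_pos) auto
    then show "log 10 (significand S + 10 powi (- int (length S) + 1)) \<le> 1"
      unfolding w using b by (simp add: log_le_iff)
  qed
qed

section \<open>The group of non-Benford functions\<close>

lemma archimedean_character_mult: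
  assumes "archimedean_character \<kappa>" "archimedean_character \<mu>"
  shows "archimedean_character (\<lambda>n. \<kappa> n * \<mu> n)"
proof -
  obtain L L' where L: "\<forall>n>0. norm (\<kappa> (Suc n) - \<kappa> n) \<le> L / real n" "\<forall>n>0. norm (\<mu> (Suc n) - \<mu> n) \<le> L' / real n"
    using assms unfolding archimedean_character_def by metis
  have "norm (\<kappa> (Suc n) * \<mu> (Suc n) - \<kappa> n * \<mu> n) \<le> (L + L') / real n" if n: "n > 0" for n
  proof -
    have "norm (\<kappa> (Suc n) * \<mu> (Suc n) - \<kappa> n * \<mu> n) \<le> norm (\<kappa> (Suc n) - \<kappa> n) + norm (\<mu> (Suc n) - \<mu> n)"
      by (rule norm_mult_diff_le) (use archimedean_characterD(1)[OF assms(1), of n] archimedean_characterD(1)[OF assms(2), of "Suc n"] n in auto)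
    also have "\<dots> \<le> L / real n + L' / real n" using L n by (intro add_mono) auto
    finally show ?thesis by (simp add: add_divide_distrib)
  qed
  then show ?thesis
    using assms unfolding archimedean_character_def by (auto simp: norm_mult intro!: exI[of _ "L + L'"])
qed

lemma archimedean_character_power:
  "archimedean_character \<kappa> \<Longrightarrow> archimedean_character (\<lambda>n. \<kappa> n ^ k)"
proof (induction k)
  case 0
  have "archimedean_character (\<lambda>_. 1)"
    unfolding archimedean_character_def by (intro conjI exI[of _ 0]) simp_all
  then show ?case by simp
next
  case (Suc k)
  show ?case unfolding power_Suc by (rule archimedean_character_mult[OF Suc.prems Suc.IH[OF Suc.prems]])
qed

text \<open>The triangle inequality adds the distances at each prime, and squaring their sum costs a
  factor 2.\<close>

lemma pretends_mult:
  assumes pr: "pretends g \<kappa>" "pretends g' \<kappa>'"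
    and le: "\<forall>p. prime p \<longrightarrow> norm (g' p) \<le> 1" "\<forall>p. prime p \<longrightarrow> norm (\<kappa> p) \<le> 1"
  shows "pretends (\<lambda>n. g n * g' n) (\<lambda>n. \<kappa> n * \<kappa>' n)"
proof -
  obtain B where B: "\<And>P. finite P \<Longrightarrow> (\<forall>p\<in>P. prime p) \<Longrightarrow> (\<Sum>p\<in>P. (norm (g p - \<kappa> p))\<^sup>2 / real p) \<le> B"
    using pr(1) unfolding pretends_def by blast
  obtain B' where B': "\<And>P. finite P \<Longrightarrow> (\<forall>p\<in>P. prime p) \<Longrightarrow> (\<Sum>p\<in>P. (norm (g' p - \<kappa>' p))\<^sup>2 / real p) \<le> B'"
    using pr(2) unfolding pretends_def by blast
  show ?thesis
    unfolding pretends_def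
  proof (intro exI[of _ "2 * B + 2 * B'"] allI impI)
    fix P :: "nat set" assume P: "finite P" "\<forall>p\<in>P. prime p"
    have "(norm (g p * g' p - \<kappa> p * \<kappa>' p))\<^sup>2 / real p
        \<le> 2 * ((norm (g p - \<kappa> p))\<^sup>2 / real p) + 2 * ((norm (g' p - \<kappa>' p))\<^sup>2 / real p)" if "p \<in> P" for p
    proof -
      have "norm (g p * g' p - \<kappa> p * \<kappa>' p) \<le> norm (g p - \<kappa> p) + norm (g' p - \<kappa>' p)"
        by (rule norm_mult_diff_le) (use le P that in auto)
      then have "(norm (g p * g' p - \<kappa> p * \<kappa>' p))\<^sup>2 \<le> (norm (g p - \<kappa> p) + norm (g' p - \<kappa>' p))\<^sup>2"
        by (intro power_mono) auto
      also have "\<dots> \<le> 2 * (norm (g p - \<kappa> p))\<^sup>2 + 2 * (norm (g' p - \<kappa>' p))\<^sup>2"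
        using sum_squares_bound[of "norm (g p - \<kappa> p)" "norm (g' p - \<kappa>' p)"] by (simp add: power2_sum)
      finally have "(norm (g p * g' p - \<kappa> p * \<kappa>' p))\<^sup>2 / real p
        \<le> (2 * (norm (g p - \<kappa> p))\<^sup>2 + 2 * (norm (g' p - \<kappa>' p))\<^sup>2) / real p"
        by (rule divide_right_mono) simp
      then show ?thesis by (simp add: add_divide_distrib)
    qed
    then have "(\<Sum>p\<in>P. (norm (g p * g' p - \<kappa> p * \<kappa>' p))\<^sup>2 / real p)
        \<le> (\<Sum>p\<in>P. 2 * ((norm (g p - \<kappa> p))\<^sup>2 / real p) + 2 * ((norm (g' p - \<kappa>' p))\<^sup>2 / real p))"
      by (rule sum_mono)
    also have "\<dots> = 2 * (\<Sum>p\<in>P. (norm (g p - \<kappa> p))\<^sup>2 / real p) + 2 * (\<Sum>p\<in>P. (norm (g' p - \<kappa>' p))\<^sup>2 / real p)"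
      by (simp only: sum.distrib sum_distrib_left)
    also have "\<dots> \<le> 2 * B + 2 * B'" using B[OF P] B'[OF P] by simp
    finally show "(\<Sum>p\<in>P. (norm (g p * g' p - \<kappa> p * \<kappa>' p))\<^sup>2 / real p) \<le> 2 * B + 2 * B'" .
  qed
qed

lemma pretends_power:
  assumes "pretends g \<kappa>" "\<forall>p. prime p \<longrightarrow> norm (g p) \<le> 1" "\<forall>p. prime p \<longrightarrow> norm (\<kappa> p) \<le> 1"
  shows "pretends (\<lambda>n. g n ^ k) (\<lambda>n. \<kappa> n ^ k)"
proof (induction k)
  case 0
  show ?case unfolding pretends_def by (intro exI[of _ 0]) simp
next
  case (Suc k)
  have "pretends (\<lambda>n. g n * g n ^ k) (\<lambda>n. \<kappa> n * \<kappa> n ^ k)"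
    by (rule pretends_mult[OF assms(1) Suc]) (use assms in \<open>auto simp: norm_power power_le_one\<close>)
  then show ?case by simp
qed

lemma pretends_cong:
  assumes "\<And>p. prime p \<Longrightarrow> g p = g' p" "pretends g \<kappa>"
  shows "pretends g' \<kappa>"
proof -
  have "(\<Sum>p\<in>P. (norm (g' p - \<kappa> p))\<^sup>2 / real p) = (\<Sum>p\<in>P. (norm (g p - \<kappa> p))\<^sup>2 / real p)" if "\<forall>p\<in>P. prime p" for P
    by (rule sum.cong) (use assms(1) that in auto)
  then show ?thesis using assms(2) unfolding pretends_def by simp
qed

text \<open>If \<open>z\<close> and its square both have negative real part, the argument of
  \<open>z\<close> lies between pi / 2 and 3 pi / 4 in absolute value, and tripling it leads to the
  right half-plane. So \<open>k \<le> 3\<close> suffices.\<close>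

lemma Re_power_nonneg:
  assumes "norm z = 1"
  shows "\<exists>k>0. Re (z ^ k) \<ge> 0"
proof -
  define c where "c = Re z"
  have sq: "c\<^sup>2 + (Im z)\<^sup>2 = 1" using assms by (simp add: cmod_def c_def)
  have "Re (z ^ 2) = c\<^sup>2 - (Im z)\<^sup>2" by (simp add: power2_eq_square c_def)
  then have z2: "Re (z ^ 2) = 2 * c\<^sup>2 - 1" using sq by linarith
  have "Re (z ^ 3) = c * c\<^sup>2 - 3 * c * (Im z)\<^sup>2"
    by (simp add: power3_eq_cube power2_eq_square c_def algebra_simps)
  also have "(Im z)\<^sup>2 = 1 - c\<^sup>2" using sq by linarith
  finally have z3: "Re (z ^ 3) = c * (4 * c\<^sup>2 - 3)" by (simp add: algebra_simps)
  consider "c \<ge> 0" | "2 * c\<^sup>2 \<ge> 1" | "c < 0" "2 * c\<^sup>2 < 1" by linarith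
  then show ?thesis
  proof cases
    case 1
    then show ?thesis by (intro exI[of _ 1]) (simp add: c_def)
  next
    case 2
    then show ?thesis using z2 by (intro exI[of _ 2]) simp
  next
    case 3
    then have "c * (4 * c\<^sup>2 - 3) \<ge> 0" by (intro mult_nonpos_nonpos) auto
    then show ?thesis using z3 by (intro exI[of _ 3]) simp
  qed
qed

text \<open>Taking powers stays within the family of means tested by Weyl's criterion.\<close>

lemma phase_power: "phase f (m * k) n = phase f m n ^ k"
  unfolding phase_def Complex.DeMoivre[of "real m * (2 * pi * log 10 \<bar>f n\<bar>)" k]
  by (simp only: of_nat_mult mult_ac)

lemma phase_mult:
  assumes "f n \<noteq> 0" "g n \<noteq> 0"
  shows "phase (\<lambda>n. f n * g n) m n = phase f m n * phase g m n"
  using assms by (simp add: phase_def abs_mult log_mult cis_mult distrib_left)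

locale nonzero_multiplicative =
  fixes f :: "nat \<Rightarrow> real"
  assumes mult: "multiplicative f" and nonzero: "\<forall>n\<ge>1. f n \<noteq> 0"
begin

lemma unimodular_multiplicative_phase: "unimodular_multiplicative (phase f m)"
proof
  show "norm (phase f m n) = 1" for n by (simp add: phase_def)
  show "phase f m (k * n) = phase f m k * phase f m n" if "k > 0" "n > 0" "coprime k n" for k n
  proof -
    have "f (k * n) = f k * f n" "f k \<noteq> 0" "f n \<noteq> 0"
      using that mult nonzero by (auto simp: multiplicative_def Suc_le_eq)
    then show ?thesis
      by (simp add: phase_def abs_mult log_mult cis_mult distrib_left)
  qed
qed

lemma not_strong_benford_iff:
  "\<not> strong_benford f \<longleftrightarrow> (\<exists>m>0. \<exists>\<kappa>. archimedean_character \<kappa> \<and> pretends (phase f m) \<kappa>)"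
proof
  assume "\<not> strong_benford f"
  then obtain m where m: "m > 0" "\<not> (\<lambda>N. mean_upto (phase f m) (real N)) \<longlonglongrightarrow> 0"
    using strong_benford_iff_mean[OF nonzero] by blast
  interpret unimodular_multiplicative "phase f m" by (rule unimodular_multiplicative_phase)
  show "\<exists>m>0. \<exists>\<kappa>. archimedean_character \<kappa> \<and> pretends (phase f m) \<kappa>"
    using pretends_if_mean_not_tendsto_0[OF m(2)] m(1) by blast
next
  assume "\<exists>m>0. \<exists>\<kappa>. archimedean_character \<kappa> \<and> pretends (phase f m) \<kappa>"
  then obtain m \<kappa> where m: "m > 0" and \<kappa>: "archimedean_character \<kappa>" "pretends (phase f m) \<kappa>" by blast
  have "norm (phase f m 2 * cnj (\<kappa> 2)) = 1"
    using archimedean_characterD(1)[OF \<kappa>(1), of 2] by (simp add: norm_mult phase_def)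
  \<comment> \<open>The \<open>k\<close>-th power moves the value at 2 into the closed right
    half-plane, as the Euler product argument requires.\<close>
  then obtain k where k: "k > 0" "Re ((phase f m 2 * cnj (\<kappa> 2)) ^ k) \<ge> 0" using Re_power_nonneg by blast
  interpret unimodular_multiplicative "phase f (m * k)" by (rule unimodular_multiplicative_phase)
  have "pretends (phase f (m * k)) (\<lambda>n. \<kappa> n ^ k)"
    unfolding phase_power[abs_def]
    by (rule pretends_power[OF \<kappa>(2)])
      (auto simp: phase_def archimedean_characterD(1)[OF \<kappa>(1)] prime_gt_0_nat)
  then have "\<not> (\<lambda>N. mean_upto (phase f (m * k)) (real N)) \<longlonglongrightarrow> 0"
    by (rule mean_not_tendsto_0_if_pretends[OF archimedean_character_power[OF \<kappa>(1)]])
      (use k(2) in \<open>simp add: phase_power power_mult_distrib\<close>)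
  moreover have "m * k > 0" using m k(1) by simp
  ultimately show "\<not> strong_benford f"
    unfolding strong_benford_iff_mean[OF nonzero] by blast
qed

end

text \<open>The two functions may fail at different frequencies \<open>m\<close> and
  \<open>l\<close>; the powers \<open>l\<close> and \<open>m\<close> of their phases share the
  frequency \<open>m * l\<close>. Agreement at primes is enough, as \<open>pretends\<close> looks at
  nothing else.\<close>

lemma not_strong_benford_mult:
  assumes "nonzero_multiplicative f" "nonzero_multiplicative g"
    and "\<not> strong_benford f" "\<not> strong_benford g"
  shows "\<not> strong_benford (\<lambda>n\<in>{1..}. f n * g n)"
proof -
  interpret f: nonzero_multiplicative f by fact
  interpret g: nonzero_multiplicative g by fact
  interpret fg: nonzero_multiplicative "\<lambda>n\<in>{1..}. f n * g n"
    using f.mult g.mult f.nonzero g.nonzero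
    by unfold_locales (auto simp: multiplicative_def Suc_le_eq)
  obtain m \<kappa> where m: "m > 0" and \<kappa>: "archimedean_character \<kappa>" "pretends (phase f m) \<kappa>"
    using assms(3) f.not_strong_benford_iff by blast
  obtain l \<mu> where l: "l > 0" and \<mu>: "archimedean_character \<mu>" "pretends (phase g l) \<mu>"
    using assms(4) g.not_strong_benford_iff by blast
  have "pretends (\<lambda>n. phase f m n ^ l * phase g l n ^ m) (\<lambda>n. \<kappa> n ^ l * \<mu> n ^ m)"
    by (intro pretends_mult pretends_power \<kappa> \<mu>)
      (auto simp: phase_def norm_power archimedean_characterD(1)[OF \<kappa>(1)] archimedean_characterD(1)[OF \<mu>(1)] prime_gt_0_nat)
  moreover have "phase f m p ^ l * phase g l p ^ m = phase (\<lambda>n\<in>{1..}. f n * g n) (m * l) p" if "prime p" for p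
  proof -
    have p: "p \<ge> 1" using that prime_gt_0_nat[of p] by simp
    then have "phase (\<lambda>n\<in>{1..}. f n * g n) (m * l) p = phase (\<lambda>n. f n * g n) (m * l) p"
      by (simp add: phase_def)
    also have "\<dots> = phase f (m * l) p * phase g (l * m) p"
      using p f.nonzero g.nonzero by (simp add: phase_mult mult.commute)
    finally show ?thesis by (simp only: phase_power)
  qed
  ultimately have "pretends (phase (\<lambda>n\<in>{1..}. f n * g n) (m * l)) (\<lambda>n. \<kappa> n ^ l * \<mu> n ^ m)"
    by (rule pretends_cong[rotated])
  moreover have "archimedean_character (\<lambda>n. \<kappa> n ^ l * \<mu> n ^ m)"
    by (intro archimedean_character_mult archimedean_character_power \<kappa> \<mu>)
  moreover have "m * l > 0" using m l by simp
  ultimately show ?thesis unfolding fg.not_strong_benford_iff by blast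
qed

text \<open>Inversion changes the sign of the logarithm, so all phases and their means are
  conjugated.\<close>

lemma strong_benford_inverse:
  assumes f: "\<forall>n\<ge>1. f n \<noteq> 0"
  shows "strong_benford (\<lambda>n\<in>{1..}. 1 / f n) \<longleftrightarrow> strong_benford f"
proof -
  have inv: "\<forall>n\<ge>1. (\<lambda>n\<in>{1..}. 1 / f n) n \<noteq> 0" using f by simp
  have "mean_upto (phase (\<lambda>n\<in>{1..}. 1 / f n) m) N = cnj (mean_upto (phase f m) N)" for m N
    unfolding mean_upto_cnj[symmetric]
    by (rule mean_upto_cong) (use f in \<open>simp add: phase_def cis_cnj log_divide Suc_le_eq\<close>)
  then show ?thesis
    unfolding strong_benford_iff_mean[OF inv] strong_benford_iff_mean[OF f]
    using lim_cnj[of _ 0 sequentially] by simp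
qed

lemma not_strong_benford_one: "\<not> strong_benford (\<lambda>n\<in>{1..}. 1)"
proof -
  have nz: "\<forall>n\<ge>1. (\<lambda>n\<in>{1..}. 1 :: real) n \<noteq> 0" by simp
  have "mean_upto (phase (\<lambda>n\<in>{1..}. 1) 1) N = mean_upto (\<lambda>_. 1) N" for N
    by (rule mean_upto_cong) (simp add: phase_def)
  then have "(\<lambda>N. mean_upto (phase (\<lambda>n\<in>{1..}. 1) 1) (real N)) \<longlonglongrightarrow> 1"
    using mean_upto_const_tendsto[of 1] by simp
  then show ?thesis
    unfolding strong_benford_iff_mean[OF nz] using LIMSEQ_unique by fastforce
qed

theorem corollary1p7: "group non_benford_multiplicative"
proof -
  let ?G = non_benford_multiplicative
  have carrier: "f \<in> carrier ?G \<longleftrightarrow> f \<in> extensional {1..} \<and> nonzero_multiplicative f \<and> \<not> strong_benford f" for f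
    by (auto simp: non_benford_multiplicative_def nonzero_multiplicative_def PiE_def)
  have mult: "f \<otimes>\<^bsub>?G\<^esub> g = (\<lambda>n\<in>{1..}. f n * g n)" for f g
    by (simp add: non_benford_multiplicative_def)
  have one: "\<one>\<^bsub>?G\<^esub> = (\<lambda>n\<in>{1..}. 1)"
    by (simp add: non_benford_multiplicative_def)
  show ?thesis
  proof (rule groupI)
    fix f g assume "f \<in> carrier ?G" "g \<in> carrier ?G"
    then show "f \<otimes>\<^bsub>?G\<^esub> g \<in> carrier ?G"
      unfolding carrier mult using not_strong_benford_mult[of f g]
      by (auto simp: nonzero_multiplicative_def multiplicative_def Suc_le_eq)
  next
    show "\<one>\<^bsub>?G\<^esub> \<in> carrier ?G"
      unfolding carrier one using not_strong_benford_one
      by (auto simp: nonzero_multiplicative_def multiplicative_def Suc_le_eq)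
  next
    fix f g h
    show "f \<otimes>\<^bsub>?G\<^esub> g \<otimes>\<^bsub>?G\<^esub> h = f \<otimes>\<^bsub>?G\<^esub> (g \<otimes>\<^bsub>?G\<^esub> h)"
      unfolding mult by (auto simp: restrict_def fun_eq_iff)
  next
    fix f assume "f \<in> carrier ?G"
    then show "\<one>\<^bsub>?G\<^esub> \<otimes>\<^bsub>?G\<^esub> f = f"
      unfolding mult one carrier by (auto simp: restrict_def fun_eq_iff extensional_def)
  next
    fix f assume f: "f \<in> carrier ?G"
    then have nz: "\<forall>n\<ge>1. f n \<noteq> 0" unfolding carrier by (simp add: nonzero_multiplicative_def)
    have "(\<lambda>n\<in>{1..}. 1 / f n) \<in> carrier ?G"
      using f unfolding carrier strong_benford_inverse[OF nz]
      by (auto simp: nonzero_multiplicative_def multiplicative_def Suc_le_eq)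
    moreover have "(\<lambda>n\<in>{1..}. 1 / f n) \<otimes>\<^bsub>?G\<^esub> f = \<one>\<^bsub>?G\<^esub>"
      unfolding mult one using nz by (auto simp: restrict_def fun_eq_iff)
    ultimately show "\<exists>g\<in>carrier ?G. g \<otimes>\<^bsub>?G\<^esub> f = \<one>\<^bsub>?G\<^esub>" by blast
  qed
qed

end
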